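(* Let $(G,P)$ be a quasi-lattice ordered group, let $A$ be a $C^*$-algebra, and let $X$ be a compactly aligned product system over $P$ of right-Hilbert $A$--$A$ bimodules. Suppose that each pair in $P$ has a least upper bound. Suppose that for each $p\in P$ the homomorphism $\phi_p:A\to\mathcal{L}(X_p)$ is injective. Let $\psi:X\to B$ be a representation of $X$ in a $C^*$-algebra $B$. (1) If $\psi$ satisfies (CP), then $\psi$ is Cuntz-Pimsner covariant in the sense of Fowler. (2) If $\phi_p(A)\subset\mathcal{K}(X_p)$ for each $p\in P$, and $\psi$ is Cuntz-Pimsner covariant in the sense of Fowler, then $\psi$ satisfies (CP).
   Context: BIMODULES. A right-Hilbert $A$--$A$ bimodule over a $C^*$-algebra $A$ is a right Hilbert $A$-module $X$ (with $A$-valued inner product $\langle\cdot,\cdot\rangle_A$, linear in the second variable) together with a $*$-homomorphism $\phi:A\to\mathcal{L}(X)$ into the adjointable operators (not assumed nondegenerate); write $a\cdot x=\phi(a)x$. $\mathcal{K}(X)=\overline{\mathrm{span}}\{x\otimes y^* : x,y\in X\}$, where $(x\otimes y^* )(z)=x\cdot\langle y,z\rangle_A$. ${}_AA_A$ denotes $A$ with $\langle a,b\rangle_A=a^*b$ and actions by multiplication; $\mathcal{K}({}_AA_A)\cong A$, with $a$ corresponding to left multiplication by $a$. $\otimes_A$ is the balanced (internal) tensor product, with left action $a\mapsto\phi(a)\otimes 1$. QUASI-LATTICE ORDERED GROUPS. $(G,P)$ is a quasi-lattice ordered group if $G$ is a discrete group, $P$ is a subsemigroup of $G$ with $P\cap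 P^{-1}=\{e\}$, and, for the partial order $p\le q \iff p^{-1}q\in P$, any two $p,q\in G$ having a common upper bound in $P$ have a least upper bound $p\vee q\in P$. Write $p\vee q=\infty$ if there is no common upper bound in $P$, and $p\vee q<\infty$ otherwise. PRODUCT SYSTEMS. A product system over $P$ of right-Hilbert $A$--$A$ bimodules is a semigroup $X=\bigsqcup_{p\in P}X_p$ such that: each $X_p$ is a right-Hilbert $A$--$A$ bimodule (left action $\phi_p:A\to\mathcal{L}(X_p)$, inner product $\langle\cdot,\cdot\rangle_A^p$); $X_e={}_AA_A$; for $p,q\in P\setminus\{e\}$ there is an isomorphism $M_{p,q}:X_p\otimes_A X_q\to X_{pq}$ with $M_{p,q}(x\otimes_A y)=xy$; and multiplication by elements of $X_e=A$ implements the left and right actions of $A$ on each $X_p$. For $p\neq e$ and $q\in P$, $\iota_p^{pq}:\mathcal{L}(X_p)\to\mathcal{L}(X_{pq})$ is the homomorphism characterised by $\iota_p^{pq}(S)(xy)=(Sx)y$ for $x\in X_p$, $y\in X_q$; $\iota_e^q:\mathcal{K}(X_e)\cong A\to\mathcal{L}(X_q)$ is $\phi_q$; and $\iota_p^r=0$ if $p\not\le r$. $X$ is compactly aligned if whenever $p\vee q<\infty$, $S\in\mathcal{K}(X_p)$ and $T\in\mathcal{K}(X_q)$, we have $\iota_p^{p\vee q}(S)\iota_q^{p\vee q}(T)\in\mathcal{K}(X_{p\vee q})$. THE MODULES $\widetilde{X}_q$. For a right Hilbert $A$-module $Y$ and an ideal $I$ of $A$, $Y\cdot I=\{y\cdot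 a:y\in Y,a\in I\}$, a closed sub-bimodule when $Y$ is a bimodule. Put $I_e=A$ and $I_p=\bigcap_{e<r\le p}\ker(\phi_r)$ for $p \in P\setminus\{e\}$. For $q\in P$, $\widetilde{X}_q=\bigoplus_{p\le q}X_p\cdot I_{p^{-1}q}$ (Hilbert module direct sum over $p\in P$, $p\le q$), with left action $\widetilde{\phi}_q:A\to\mathcal{L}(\widetilde{X}_q)$, $(\widetilde{\phi}_q(a)x)(p)=\phi_p(a)x(p)$. For $p\ne e$, $\widetilde{\iota}_p^{\,q}:\mathcal{L}(X_p)\to\mathcal{L}(\widetilde{X}_q)$ is given by $(\widetilde{\iota}_p^{\,q}(S)x)(r)=\iota_p^r(S)x(r)$ for $r\le q$; and $\widetilde{\iota}_e^{\,q}:\mathcal{K}(X_e)\cong A\to\mathcal{L}(\widetilde{X}_q)$ is $\widetilde{\phi}_q$. REPRESENTATIONS. A representation of $X$ in a $C^*$-algebra $B$ is a map $\psi:X\to B$, with $\psi_p=\psi|_{X_p}$, such that each $\psi_p$ is linear and $\psi_e$ is a $*$-homomorphism; $\psi_p(x)\psi_q(y)=\psi_{pq}(xy)$ for $x\in X_p,y\in X_q$; and $\psi_e(\langle x,y\rangle_A^p)=\psi_p(x)^*\psi_p(y)$ for $x,y\in X_p$. Then $\psi^{(p)}:\mathcal{K}(X_p)\to B$ is the homomorphism with $\psi^{(p)}(x\otimes y^* )=\psi_p(x)\psi_p(y)^*$. A statement $\mathcal{P}(s)$ ($s\in P$) holds for large $s$ if for every $q\in P$ there is $r\in P$ with $q\le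 r$ such that $\mathcal{P}(s)$ holds for all $s\ge r$. The representation $\psi$ satisfies (CP) if $\sum_{p\in F}\psi^{(p)}(T_p)=0$ for every finite $F\subset P$ and all $T_p\in\mathcal{K}(X_p)$ ($p\in F$) such that $\sum_{p\in F}\widetilde{\iota}_p^{\,s}(T_p)=0$ for large $s$. (This condition is defined for product systems in which all $\widetilde\phi_q$ are injective, which is the case when all $\phi_p$ are injective.) The representation $\psi$ is Cuntz-Pimsner covariant in the sense of Fowler if $\psi^{(p)}(\phi_p(a))=\psi_e(a)$ for all $p\in P$ and all $a\in A$ with $\phi_p(a)\in\mathcal{K}(X_p)$. *)

theory Defs
  imports "HOL-Analysis.Infinite_Sum" "HOL-Library.Function_Algebras" "HOL-Algebra.Group"
begin

section \<open>Complex vector spaces and $C^*$-algebras\<close>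

class scaleC =
  fixes scaleC :: "complex \<Rightarrow> 'a \<Rightarrow> 'a"  (infixr \<open>*\<^sub>C\<close> 75)

class complex_vector = ab_group_add + scaleC +
  assumes scaleC_add_right: "c *\<^sub>C (x + y) = c *\<^sub>C x + c *\<^sub>C y"
    and scaleC_add_left: "(c + d) *\<^sub>C x = c *\<^sub>C x + d *\<^sub>C x"
    and scaleC_scaleC: "c *\<^sub>C (d *\<^sub>C x) = (c * d) *\<^sub>C x"
    and scaleC_one: "1 *\<^sub>C x = x"

global_interpretation complex_vector:
  vector_space "scaleC :: complex \<Rightarrow> 'a \<Rightarrow> 'a::complex_vector"
  by unfold_locales
    (simp_all add: scaleC_add_right scaleC_add_left scaleC_scaleC scaleC_one)

instantiation "fun" :: (type, complex_vector) complex_vector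
begin

definition scaleC_fun :: "complex \<Rightarrow> ('a \<Rightarrow> 'b) \<Rightarrow> 'a \<Rightarrow> 'b"
  where "scaleC_fun c f = (\<lambda>x. c *\<^sub>C f x)"

instance
  by standard
    (simp_all add: scaleC_fun_def fun_eq_iff scaleC_add_right scaleC_add_left
      scaleC_scaleC scaleC_one)

end

class star =
  fixes star :: "'a \<Rightarrow> 'a"

class cstar_algebra = complex_vector + real_normed_algebra + banach + star +
  assumes scaleR_scaleC: "scaleR r x = complex_of_real r *\<^sub>C x"
    and norm_scaleC: "norm (c *\<^sub>C x) = cmod c * norm x"
    and mult_scaleC_left: "(c *\<^sub>C x) * y = c *\<^sub>C (x * y)"
    and mult_scaleC_right: "x * (c *\<^sub>C y) = c *\<^sub>C (x * y)"
    and star_add: "star (x + y) = star x + star y"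
    and star_scaleC: "star (c *\<^sub>C x) = cnj c *\<^sub>C star x"
    and star_mult: "star (x * y) = star y * star x"
    and star_star: "star (star x) = x"
    and cstar_identity: "norm (star x * x) = (norm x)\<^sup>2"

definition cstar_positive :: "'a::cstar_algebra \<Rightarrow> bool"
  where "cstar_positive a \<longleftrightarrow> (\<exists>b. a = star b * b)"

definition star_hom :: "('a::cstar_algebra \<Rightarrow> 'b::cstar_algebra) \<Rightarrow> bool" where
  "star_hom f \<longleftrightarrow>
     (\<forall>a b. f (a + b) = f a + f b) \<and> (\<forall>c a. f (c *\<^sub>C a) = c *\<^sub>C f a) \<and>
     (\<forall>a b. f (a * b) = f a * f b) \<and> (\<forall>a. f (star a) = star (f a))"


section \<open>Right-Hilbert bimodules\<close>

text \<open>
  A module lives on a complex-linear subspace (its carrier) of an ambient complex vector space,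
  whose only role is to supply the linear structure: any family of vector spaces embeds
  into its direct sum, so this loses no generality when a family of modules shares
  one ambient type.

  An operator on a module is represented by a function that is $0$ off the carrier.  Hence
  operators on a module are equal iff they agree on the carrier, and sums and scalar multiples of
  operators are the pointwise ones, and composition is \<^term>\<open>(\<circ>)\<close>.
\<close>

record ('a, 'x) bimod =
  car :: "'x set"
  ract :: "'x \<Rightarrow> 'a \<Rightarrow> 'x"
  inn :: "'x \<Rightarrow> 'x \<Rightarrow> 'a"
  lact :: "'a \<Rightarrow> 'x \<Rightarrow> 'x"   \<comment> \<open>the homomorphism $\phi : A \to \mathcal{L}(X)$\<close>

definition hnorm :: "('a::cstar_algebra, 'x) bimod \<Rightarrow> 'x \<Rightarrow> real"
  where "hnorm X x = sqrt (norm (inn X x x))"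

locale hilbert_module =
  fixes X :: "('a::cstar_algebra, 'x::complex_vector) bimod"
  assumes subspace: "complex_vector.subspace (car X)"
    and ract_closed: "x \<in> car X \<Longrightarrow> ract X x a \<in> car X"
    and ract_add_left: "x \<in> car X \<Longrightarrow> y \<in> car X \<Longrightarrow> ract X (x + y) a = ract X x a + ract X y a"
    and ract_add_right: "x \<in> car X \<Longrightarrow> ract X x (a + b) = ract X x a + ract X x b"
    and ract_mult: "x \<in> car X \<Longrightarrow> ract X x (a * b) = ract X (ract X x a) b"
    and ract_scaleC_left: "x \<in> car X \<Longrightarrow> ract X (c *\<^sub>C x) a = c *\<^sub>C ract X x a"
    and ract_scaleC_right: "x \<in> car X \<Longrightarrow> ract X x (c *\<^sub>C a) = c *\<^sub>C ract X x a"
    and inn_add: "x \<in> car X \<Longrightarrow> y \<in> car X \<Longrightarrow> z \<in> car X \<Longrightarrow> inn X x (y + z) = inn X x y + inn X x z"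
    and inn_scaleC: "x \<in> car X \<Longrightarrow> y \<in> car X \<Longrightarrow> inn X x (c *\<^sub>C y) = c *\<^sub>C inn X x y"
    and inn_ract: "x \<in> car X \<Longrightarrow> y \<in> car X \<Longrightarrow> inn X x (ract X y a) = inn X x y * a"
    and inn_star: "x \<in> car X \<Longrightarrow> y \<in> car X \<Longrightarrow> star (inn X x y) = inn X y x"
    and inn_positive: "x \<in> car X \<Longrightarrow> cstar_positive (inn X x x)"
    and inn_definite: "x \<in> car X \<Longrightarrow> inn X x x = 0 \<Longrightarrow> x = 0"
    and complete: "(\<And>n. u n \<in> car X) \<Longrightarrow>
      (\<And>\<epsilon>. \<epsilon> > 0 \<Longrightarrow> \<exists>N. \<forall>m\<ge>N. \<forall>n\<ge>N. hnorm X (u m - u n) < \<epsilon>) \<Longrightarrow>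
      \<exists>l\<in>car X. (\<lambda>n. hnorm X (u n - l)) \<longlonglongrightarrow> 0"

definition adjoint_pair ::
  "('a::cstar_algebra, 'x::complex_vector) bimod \<Rightarrow> ('x \<Rightarrow> 'x) \<Rightarrow> ('x \<Rightarrow> 'x) \<Rightarrow> bool" where
  "adjoint_pair X S T \<longleftrightarrow>
     (\<forall>x\<in>car X. S x \<in> car X \<and> T x \<in> car X) \<and>
     (\<forall>x. x \<notin> car X \<longrightarrow> S x = 0 \<and> T x = 0) \<and>
     (\<forall>x\<in>car X. \<forall>y\<in>car X. inn X (S x) y = inn X x (T y))"

definition adjointable :: "('a::cstar_algebra, 'x::complex_vector) bimod \<Rightarrow> ('x \<Rightarrow> 'x) set"
  where "adjointable X = {S. \<exists>T. adjoint_pair X S T}"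

definition adj :: "('a::cstar_algebra, 'x::complex_vector) bimod \<Rightarrow> ('x \<Rightarrow> 'x) \<Rightarrow> ('x \<Rightarrow> 'x)"
  where "adj X S = (THE T. adjoint_pair X S T)"

locale hilbert_bimodule = hilbert_module +
  assumes lact_adjointable: "lact X a \<in> adjointable X"
    and lact_add: "lact X (a + b) = lact X a + lact X b"
    and lact_scaleC: "lact X (c *\<^sub>C a) = c *\<^sub>C lact X a"
    and lact_mult: "lact X (a * b) = lact X a \<circ> lact X b"
    and lact_star: "lact X (star a) = adj X (lact X a)"

definition rank_one ::
  "('a::cstar_algebra, 'x::complex_vector) bimod \<Rightarrow> 'x \<Rightarrow> 'x \<Rightarrow> ('x \<Rightarrow> 'x)"
  where "rank_one X x y = (\<lambda>z. if z \<in> car X then ract X x (inn X y z) else 0)"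

text \<open>
  Closure in the operator norm: \<open>\<forall>z\<in>car X. hnorm X (T z - S z) \<le> \<epsilon> * hnorm X z\<close>
  says $\|T - S\| \le \varepsilon$.
\<close>

definition compacts :: "('a::cstar_algebra, 'x::complex_vector) bimod \<Rightarrow> ('x \<Rightarrow> 'x) set" where
  "compacts X = {T \<in> adjointable X. \<forall>\<epsilon>>0.
     \<exists>S\<in>complex_vector.span {rank_one X x y | x y. x \<in> car X \<and> y \<in> car X}.
       \<forall>z\<in>car X. hnorm X (T z - S z) \<le> \<epsilon> * hnorm X z}"

definition bimod_iso ::
  "('a::cstar_algebra, 'x::complex_vector) bimod \<Rightarrow> ('a, 'y::complex_vector) bimod \<Rightarrow> ('x \<Rightarrow> 'y) \<Rightarrow> bool"
  where
  "bimod_iso X Y U \<longleftrightarrow> bij_betw U (car X) (car Y) \<and>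
     (\<forall>x\<in>car X. \<forall>y\<in>car X. U (x + y) = U x + U y) \<and>
     (\<forall>c. \<forall>x\<in>car X. U (c *\<^sub>C x) = c *\<^sub>C U x) \<and>
     (\<forall>x\<in>car X. \<forall>a. U (ract X x a) = ract Y (U x) a) \<and>
     (\<forall>x\<in>car X. \<forall>a. U (lact X a x) = lact Y a (U x)) \<and>
     (\<forall>x\<in>car X. \<forall>y\<in>car X. inn Y (U x) (U y) = inn X x y)"

definition standard_bimod :: "('a::cstar_algebra, 'a) bimod"  \<comment> \<open>${}_AA_A$\<close>
  where "standard_bimod = \<lparr>car = UNIV, ract = (*), inn = (\<lambda>a b. star a * b), lact = (*)\<rparr>"

text \<open>
  $Z$ together with $t(x,y) = x \otimes_A y$ is (a model of) the internal tensor product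
  $X \otimes_A Y$: the completion of the balanced algebraic tensor product for
  $\langle x \otimes y, x' \otimes y'\rangle = \langle y, \langle x, x'\rangle \cdot y'\rangle$.
\<close>

definition is_internal_tensor ::
  "('a::cstar_algebra, 'x::complex_vector) bimod \<Rightarrow> ('a, 'y::complex_vector) bimod \<Rightarrow>
   ('a, 'z::complex_vector) bimod \<Rightarrow> ('x \<Rightarrow> 'y \<Rightarrow> 'z) \<Rightarrow> bool" where
  "is_internal_tensor X Y Z t \<longleftrightarrow> hilbert_bimodule Z \<and>
     (\<forall>x\<in>car X. \<forall>y\<in>car Y. t x y \<in> car Z) \<and>
     (\<forall>x\<in>car X. \<forall>x'\<in>car X. \<forall>y\<in>car Y. t (x + x') y = t x y + t x' y) \<and>
     (\<forall>x\<in>car X. \<forall>y\<in>car Y. \<forall>y'\<in>car Y. t x (y + y') = t x y + t x y') \<and>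
     (\<forall>c. \<forall>x\<in>car X. \<forall>y\<in>car Y. t (c *\<^sub>C x) y = c *\<^sub>C t x y \<and> t x (c *\<^sub>C y) = c *\<^sub>C t x y) \<and>
     (\<forall>x\<in>car X. \<forall>a. \<forall>y\<in>car Y. t (ract X x a) y = t x (lact Y a y)) \<and>
     (\<forall>x\<in>car X. \<forall>x'\<in>car X. \<forall>y\<in>car Y. \<forall>y'\<in>car Y.
        inn Z (t x y) (t x' y') = inn Y y (lact Y (inn X x x') y')) \<and>
     (\<forall>x\<in>car X. \<forall>y\<in>car Y. \<forall>a. ract Z (t x y) a = t x (ract Y y a)) \<and>
     (\<forall>x\<in>car X. \<forall>y\<in>car Y. \<forall>a. lact Z a (t x y) = t (lact X a x) y) \<and>
     (\<forall>z\<in>car Z. \<forall>\<epsilon>>0.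
        \<exists>w\<in>complex_vector.span {t x y | x y. x \<in> car X \<and> y \<in> car Y}. hnorm Z (z - w) < \<epsilon>)"

definition mod_ideal ::  \<comment> \<open>the sub-bimodule $Y \cdot I$\<close>
  "('a::cstar_algebra, 'x::complex_vector) bimod \<Rightarrow> 'a set \<Rightarrow> ('a, 'x) bimod" where
  "mod_ideal Y I =
     (let C = {ract Y y a | y a. y \<in> car Y \<and> a \<in> I}
      in Y\<lparr>car := C, lact := (\<lambda>a y. if y \<in> C then lact Y a y else 0)\<rparr>)"

definition direct_sum ::
  "'i set \<Rightarrow> ('i \<Rightarrow> ('a::cstar_algebra, 'x::complex_vector) bimod) \<Rightarrow> ('a, 'i \<Rightarrow> 'x) bimod" where
  "direct_sum J M =
     (let C = {x. (\<forall>i\<in>J. x i \<in> car (M i)) \<and> (\<forall>i. i \<notin> J \<longrightarrow> x i = 0) \<and>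
                  (\<lambda>i. inn (M i) (x i) (x i)) summable_on J}
      in \<lparr>car = C,
          ract = (\<lambda>x a i. if i \<in> J then ract (M i) (x i) a else 0),
          inn = (\<lambda>x y. infsum (\<lambda>i. inn (M i) (x i) (y i)) J),
          lact = (\<lambda>a x. if x \<in> C then (\<lambda>i. if i \<in> J then lact (M i) a (x i) else 0) else 0)\<rparr>)"


section \<open>Quasi-lattice ordered groups\<close>

definition ple :: "('g, 'm) monoid_scheme \<Rightarrow> 'g set \<Rightarrow> 'g \<Rightarrow> 'g \<Rightarrow> bool"
  where "ple G P p q \<longleftrightarrow> inv\<^bsub>G\<^esub> p \<otimes>\<^bsub>G\<^esub> q \<in> P"

definition is_sup :: "('g, 'm) monoid_scheme \<Rightarrow> 'g set \<Rightarrow> 'g \<Rightarrow> 'g \<Rightarrow> 'g \<Rightarrow> bool" where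
  "is_sup G P p q r \<longleftrightarrow> r \<in> P \<and> ple G P p r \<and> ple G P q r \<and>
     (\<forall>s\<in>P. ple G P p s \<and> ple G P q s \<longrightarrow> ple G P r s)"

locale quasi_lattice_ordered_group = group G
  for G :: "('g, 'm) monoid_scheme" and P :: "'g set" +
  assumes P_subset: "P \<subseteq> carrier G"
    and P_closed: "p \<in> P \<Longrightarrow> q \<in> P \<Longrightarrow> p \<otimes>\<^bsub>G\<^esub> q \<in> P"
    and P_inv: "P \<inter> (\<lambda>p. inv\<^bsub>G\<^esub> p) ` P = {\<one>\<^bsub>G\<^esub>}"
    and has_sup: "p \<in> carrier G \<Longrightarrow> q \<in> carrier G \<Longrightarrow>
      \<exists>u\<in>P. ple G P p u \<and> ple G P q u \<Longrightarrow> \<exists>r. is_sup G P p q r"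

definition for_large :: "('g, 'm) monoid_scheme \<Rightarrow> 'g set \<Rightarrow> ('g \<Rightarrow> bool) \<Rightarrow> bool" where
  "for_large G P Q \<longleftrightarrow> (\<forall>q\<in>P. \<exists>r\<in>P. ple G P q r \<and> (\<forall>s\<in>P. ple G P r s \<longrightarrow> Q s))"


section \<open>Product systems\<close>

text \<open>
  The semigroup $X = \bigsqcup_p X_p$ is given by its fibres and the components
  $X_p \times X_q \to X_{pq}$ of its multiplication (so an element of $X$ is a pair of an index
  and an element of that fibre).  As $A$ is a type of its own, the equality $X_e = {}_AA_A$
  is an isomorphism \<open>emb\<close> of ${}_AA_A$ onto the fibre over $e$.
\<close>

record ('g, 'a, 'x) prodsys =
  fib :: "'g \<Rightarrow> ('a, 'x) bimod"
  pmul :: "'g \<Rightarrow> 'g \<Rightarrow> 'x \<Rightarrow> 'x \<Rightarrow> 'x"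
  emb :: "'a \<Rightarrow> 'x"

text \<open>
  In \<open>tensor_iso\<close>, \<open>Z\<close>, \<open>t\<close> model the tensor product $X_p \otimes_A X_q$ and \<open>M\<close> is the
  isomorphism $M_{p,q}$.  Since the tensor product is isomorphic to $X_{pq}$, it is
  no restriction to look for it inside the type \<^typ>\<open>'x\<close>.
\<close>

locale product_system = quasi_lattice_ordered_group G P
  for G :: "('g, 'm) monoid_scheme" and P :: "'g set" +
  fixes X :: "('g, 'a::cstar_algebra, 'x::complex_vector) prodsys"
  assumes fib_bimod: "p \<in> P \<Longrightarrow> hilbert_bimodule (fib X p)"
    and fib_one: "bimod_iso standard_bimod (fib X \<one>\<^bsub>G\<^esub>) (emb X)"
    and pmul_closed: "p \<in> P \<Longrightarrow> q \<in> P \<Longrightarrow> x \<in> car (fib X p) \<Longrightarrow> y \<in> car (fib X q) \<Longrightarrow>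
      pmul X p q x y \<in> car (fib X (p \<otimes>\<^bsub>G\<^esub> q))"
    and pmul_assoc: "p \<in> P \<Longrightarrow> q \<in> P \<Longrightarrow> r \<in> P \<Longrightarrow>
      x \<in> car (fib X p) \<Longrightarrow> y \<in> car (fib X q) \<Longrightarrow> z \<in> car (fib X r) \<Longrightarrow>
      pmul X (p \<otimes>\<^bsub>G\<^esub> q) r (pmul X p q x y) z = pmul X p (q \<otimes>\<^bsub>G\<^esub> r) x (pmul X q r y z)"
    and tensor_iso: "p \<in> P - {\<one>\<^bsub>G\<^esub>} \<Longrightarrow> q \<in> P - {\<one>\<^bsub>G\<^esub>} \<Longrightarrow>
      \<exists>(Z :: ('a, 'x) bimod) t M. is_internal_tensor (fib X p) (fib X q) Z t \<and>
        bimod_iso Z (fib X (p \<otimes>\<^bsub>G\<^esub> q)) M \<and>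
        (\<forall>x\<in>car (fib X p). \<forall>y\<in>car (fib X q). M (t x y) = pmul X p q x y)"
    and pmul_one_left: "p \<in> P \<Longrightarrow> x \<in> car (fib X p) \<Longrightarrow>
      pmul X \<one>\<^bsub>G\<^esub> p (emb X a) x = lact (fib X p) a x"
    and pmul_one_right: "p \<in> P \<Longrightarrow> x \<in> car (fib X p) \<Longrightarrow>
      pmul X p \<one>\<^bsub>G\<^esub> x (emb X a) = ract (fib X p) x a"

definition coeff_of ::  \<comment> \<open>the identification $\mathcal{K}(X_e) \cong A$\<close>
  "('g, 'm) monoid_scheme \<Rightarrow> ('g, 'a::cstar_algebra, 'x::complex_vector) prodsys \<Rightarrow> ('x \<Rightarrow> 'x) \<Rightarrow> 'a"
  where "coeff_of G X S = (THE a. S = lact (fib X \<one>\<^bsub>G\<^esub>) a)"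

definition iota ::  \<comment> \<open>$\iota_p^r$\<close>
  "('g, 'm) monoid_scheme \<Rightarrow> 'g set \<Rightarrow> ('g, 'a::cstar_algebra, 'x::complex_vector) prodsys \<Rightarrow>
   'g \<Rightarrow> 'g \<Rightarrow> ('x \<Rightarrow> 'x) \<Rightarrow> ('x \<Rightarrow> 'x)" where
  "iota G P X p r S =
     (if \<not> ple G P p r then 0
      else if p = \<one>\<^bsub>G\<^esub> then lact (fib X r) (coeff_of G X S)
      else THE T. T \<in> adjointable (fib X r) \<and>
        (\<forall>x\<in>car (fib X p). \<forall>y\<in>car (fib X (inv\<^bsub>G\<^esub> p \<otimes>\<^bsub>G\<^esub> r)).
           T (pmul X p (inv\<^bsub>G\<^esub> p \<otimes>\<^bsub>G\<^esub> r) x y) = pmul X p (inv\<^bsub>G\<^esub> p \<otimes>\<^bsub>G\<^esub> r) (S x) y))"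

definition compactly_aligned ::
  "('g, 'm) monoid_scheme \<Rightarrow> 'g set \<Rightarrow> ('g, 'a::cstar_algebra, 'x::complex_vector) prodsys \<Rightarrow> bool"
  where
  "compactly_aligned G P X \<longleftrightarrow>
     (\<forall>p\<in>P. \<forall>q\<in>P. \<forall>r. is_sup G P p q r \<longrightarrow>
        (\<forall>S\<in>compacts (fib X p). \<forall>T\<in>compacts (fib X q).
           iota G P X p r S \<circ> iota G P X q r T \<in> compacts (fib X r)))"

definition ideal_I ::
  "('g, 'm) monoid_scheme \<Rightarrow> 'g set \<Rightarrow> ('g, 'a::cstar_algebra, 'x::complex_vector) prodsys \<Rightarrow> 'g \<Rightarrow> 'a set"
  where
  "ideal_I G P X p =
     (if p = \<one>\<^bsub>G\<^esub> then UNIV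
      else \<Inter>r\<in>{r\<in>P. r \<noteq> \<one>\<^bsub>G\<^esub> \<and> ple G P r p}. {a. lact (fib X r) a = 0})"

definition Xtilde ::
  "('g, 'm) monoid_scheme \<Rightarrow> 'g set \<Rightarrow> ('g, 'a::cstar_algebra, 'x::complex_vector) prodsys \<Rightarrow>
   'g \<Rightarrow> ('a, 'g \<Rightarrow> 'x) bimod" where
  "Xtilde G P X q =
     direct_sum {p\<in>P. ple G P p q} (\<lambda>p. mod_ideal (fib X p) (ideal_I G P X (inv\<^bsub>G\<^esub> p \<otimes>\<^bsub>G\<^esub> q)))"

definition iota_tilde ::
  "('g, 'm) monoid_scheme \<Rightarrow> 'g set \<Rightarrow> ('g, 'a::cstar_algebra, 'x::complex_vector) prodsys \<Rightarrow>
   'g \<Rightarrow> 'g \<Rightarrow> ('x \<Rightarrow> 'x) \<Rightarrow> (('g \<Rightarrow> 'x) \<Rightarrow> ('g \<Rightarrow> 'x))" where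
  "iota_tilde G P X p q S =
     (if p = \<one>\<^bsub>G\<^esub> then lact (Xtilde G P X q) (coeff_of G X S)
      else (\<lambda>x. if x \<in> car (Xtilde G P X q)
                then (\<lambda>r. if r \<in> P \<and> ple G P r q then iota G P X p r S (x r) else 0)
                else 0))"


section \<open>Representations\<close>

definition representation ::
  "('g, 'm) monoid_scheme \<Rightarrow> 'g set \<Rightarrow> ('g, 'a::cstar_algebra, 'x::complex_vector) prodsys \<Rightarrow>
   ('g \<Rightarrow> 'x \<Rightarrow> 'b::cstar_algebra) \<Rightarrow> bool" where
  "representation G P X \<psi> \<longleftrightarrow>
     (\<forall>p\<in>P. \<forall>x\<in>car (fib X p). \<forall>y\<in>car (fib X p). \<psi> p (x + y) = \<psi> p x + \<psi> p y) \<and>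
     (\<forall>p\<in>P. \<forall>c. \<forall>x\<in>car (fib X p). \<psi> p (c *\<^sub>C x) = c *\<^sub>C \<psi> p x) \<and>
     star_hom (\<lambda>a. \<psi> \<one>\<^bsub>G\<^esub> (emb X a)) \<and>
     (\<forall>p\<in>P. \<forall>q\<in>P. \<forall>x\<in>car (fib X p). \<forall>y\<in>car (fib X q).
        \<psi> p x * \<psi> q y = \<psi> (p \<otimes>\<^bsub>G\<^esub> q) (pmul X p q x y)) \<and>
     (\<forall>p\<in>P. \<forall>x\<in>car (fib X p). \<forall>y\<in>car (fib X p).
        \<psi> \<one>\<^bsub>G\<^esub> (emb X (inn (fib X p) x y)) = star (\<psi> p x) * \<psi> p y)"

definition compacts_hom ::  \<comment> \<open>*-homomorphisms $\mathcal{K}(X) \to B$, extended by $0$\<close>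
  "('a::cstar_algebra, 'x::complex_vector) bimod \<Rightarrow> (('x \<Rightarrow> 'x) \<Rightarrow> 'b::cstar_algebra) \<Rightarrow> bool" where
  "compacts_hom X \<kappa> \<longleftrightarrow>
     (\<forall>S\<in>compacts X. \<forall>T\<in>compacts X. \<kappa> (S + T) = \<kappa> S + \<kappa> T) \<and>
     (\<forall>c. \<forall>T\<in>compacts X. \<kappa> (c *\<^sub>C T) = c *\<^sub>C \<kappa> T) \<and>
     (\<forall>S\<in>compacts X. \<forall>T\<in>compacts X. \<kappa> (S \<circ> T) = \<kappa> S * \<kappa> T) \<and>
     (\<forall>T\<in>compacts X. \<kappa> (adj X T) = star (\<kappa> T)) \<and>
     (\<forall>T. T \<notin> compacts X \<longrightarrow> \<kappa> T = 0)"

definition psi_compacts ::  \<comment> \<open>$\psi^{(p)}$\<close>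
  "('g, 'a::cstar_algebra, 'x::complex_vector) prodsys \<Rightarrow> ('g \<Rightarrow> 'x \<Rightarrow> 'b::cstar_algebra) \<Rightarrow>
   'g \<Rightarrow> ('x \<Rightarrow> 'x) \<Rightarrow> 'b" where
  "psi_compacts X \<psi> p =
     (THE \<kappa>. compacts_hom (fib X p) \<kappa> \<and>
       (\<forall>x\<in>car (fib X p). \<forall>y\<in>car (fib X p).
          \<kappa> (rank_one (fib X p) x y) = \<psi> p x * star (\<psi> p y)))"

definition satisfies_CP ::
  "('g, 'm) monoid_scheme \<Rightarrow> 'g set \<Rightarrow> ('g, 'a::cstar_algebra, 'x::complex_vector) prodsys \<Rightarrow>
   ('g \<Rightarrow> 'x \<Rightarrow> 'b::cstar_algebra) \<Rightarrow> bool" where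
  "satisfies_CP G P X \<psi> \<longleftrightarrow>
     (\<forall>F T. finite F \<longrightarrow> F \<subseteq> P \<longrightarrow> (\<forall>p\<in>F. T p \<in> compacts (fib X p)) \<longrightarrow>
        for_large G P (\<lambda>s. (\<Sum>p\<in>F. iota_tilde G P X p s (T p)) = 0) \<longrightarrow>
        (\<Sum>p\<in>F. psi_compacts X \<psi> p (T p)) = 0)"

definition Fowler_CP_covariant ::
  "('g, 'm) monoid_scheme \<Rightarrow> 'g set \<Rightarrow> ('g, 'a::cstar_algebra, 'x::complex_vector) prodsys \<Rightarrow>
   ('g \<Rightarrow> 'x \<Rightarrow> 'b::cstar_algebra) \<Rightarrow> bool" where
  "Fowler_CP_covariant G P X \<psi> \<longleftrightarrow>
     (\<forall>p\<in>P. \<forall>a. lact (fib X p) a \<in> compacts (fib X p) \<longrightarrow>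
        psi_compacts X \<psi> p (lact (fib X p) a) = \<psi> \<one>\<^bsub>G\<^esub> (emb X a))"

end

theory Submission
  imports Defs "HOL-Analysis.Elementary_Normed_Spaces" "HOL-Analysis.Operator_Norm"
begin

text \<open>
  Since all left actions are injective, $I_p = 0$ for $p \neq e$, so that only the top summand
  $X_s \cdot A$ of $\widetilde{X}_s$ survives and $\widetilde\iota_p^s(T)$ amounts to
  $\iota_p^s(T)$.

  (1) For $s \ge p$ both $\phi_p(a)$ and $a$ act on $X_s$ as $\phi_s(a)$, so (CP) applies to their
  difference.

  (2) Choose $r$ above all of $F$ with $\sum_p \iota_p^r(T_p) = 0$.  It suffices that
  $\iota_p^r$ maps compact operators to compact ones and
  $\psi^{(r)} \circ \iota_p^r = \psi^{(p)}$.  For $r = pq$ and $T = xa \otimes y^*$ the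
  operator $\iota_p^r(T)$ is $\phi_q(a)$ sandwiched between the creation operator of $x$ and the
  annihilation operator of $y$, and
  $\psi_p(x) \psi_e(a) \psi_p(y)^* = \psi_p(x) \psi^{(q)}(\phi_q(a)) \psi_p(y)^*$ by covariance.

  The homomorphism $\psi^{(p)}$ sends $T$ to the unique $b$ in the closed span of
  $\psi_p(X_p) \psi_p(X_p)^*$ with $b \psi_p(z) = \psi_p(T z)$.
  That it exists uses $\|b\| \le \|T\|$, a spectral radius estimate, and that it is unique uses
  the automatic continuity of homomorphisms on $\mathcal{K}(X_p)$.  Everything rests on the
  Cauchy--Schwarz inequality for Hilbert modules, hence on the positivity of $c^* c$ in a
  $C^*$-algebra.
\<close>

section \<open>$C^*$-algebras\<close>

text \<open>No spectrum or functional calculus is used; two elementary devices replace them. The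
  first is the equation 2h = a^2 + h^2, solved by a fixed point argument. It says that 1 - h is a
  square root of 1 - a^2, makes sense without a unit and is preserved by *-homomorphisms. As a is
  then the average of two formal unitaries, homomorphisms and left actions are contractive. The
  second compares growth rates along the exponents 2^j, where self-adjointness turns the C*-identity
  or Cauchy-Schwarz into lower bounds; an upper bound with an uncontrolled constant then suffices to
  bound a norm. The adjointable operators are functions and do not form a normed type, so the same
  arguments recur for them with bounds \<open>op_le\<close> in place of norms. The essential use of
  covariance is that it puts \<psi>_e(a) into the closed span of \<psi>_q(X_q) \<psi>_q(X_q)^*; this
  carries the corresponding span for X_p into the one for X_{pq}. The identity of P needs separate
  treatment, because the isomorphisms M_{p,q} are only given away from it.\<close>

lemma star_zero [simp]: "star (0::'a::cstar_algebra) = 0"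
  using star_add[of "0::'a" 0] by simp

lemma star_minus [simp]: "star (- x) = - star (x::'a::cstar_algebra)"
  using star_add[of x "-x"] by (simp add: minus_unique)

lemma star_diff: "star (x - y) = star x - star (y::'a::cstar_algebra)"
  using star_add[of x "-y"] by simp

lemma star_scaleR: "star (r *\<^sub>R x) = r *\<^sub>R star (x::'a::cstar_algebra)"
  by (simp add: scaleR_scaleC star_scaleC)

lemma norm_star [simp]: "norm (star x) = norm (x::'a::cstar_algebra)"
proof -
  have *: "norm y \<le> norm (star y)" for y :: 'a
  proof (cases "y = 0")
    case False
    have "norm y * norm y \<le> norm (star y) * norm y"
      using cstar_identity[of y] norm_mult_ineq[of "star y" y] by (simp add: power2_eq_square)
    with False show ?thesis by simp
  qed simp
  from *[of x] *[of "star x"] show ?thesis by (simp add: star_star)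
qed

lemma bounded_linear_star: "bounded_linear (star :: 'a::cstar_algebra \<Rightarrow> 'a)"
  by (rule bounded_linear_intro[where K = 1]) (auto simp: star_add star_scaleR)

lemma cstar_identity': "norm (x * star x) = (norm (x::'a::cstar_algebra))\<^sup>2"
  using cstar_identity[of "star x"] by (simp add: star_star)

lemma bounded_linear_scaleC: "bounded_linear ((*\<^sub>C) c :: 'a::cstar_algebra \<Rightarrow> 'a)"
  by (rule bounded_linear_intro[where K = "cmod c"])
    (auto simp: scaleC_add_right norm_scaleC scaleR_scaleC scaleC_scaleC mult.commute)

lemma scaleC_minus_one: "(-1) *\<^sub>C x = - (x::'a::complex_vector)"
  by (metis complex_vector.scale_minus_left scaleC_one)

lemma norm_mult_le:
  fixes a b :: "'a::real_normed_algebra"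
  assumes "norm a \<le> r" "norm b \<le> s"
  shows "norm (a * b) \<le> r * s"
proof -
  have "0 \<le> r" using assms(1) norm_ge_zero order_trans by blast
  then have "norm a * norm b \<le> r * s" using assms by (intro mult_mono) auto
  then show ?thesis using norm_mult_ineq order_trans by blast
qed

text \<open>By the C*-identity, \<open>x = star b\<close> detects the full norm of \<open>b\<close>.
  This lets norms be estimated through left multiplication when no unit is at hand.\<close>

lemma norm_le_if_mult_le:
  assumes "\<And>x. norm (b * x) \<le> c * norm x" "0 \<le> c"
  shows "norm (b::'a::cstar_algebra) \<le> c"
proof (cases "b = 0")
  case False
  have "norm b * norm b \<le> c * norm b"
    using assms(1)[of "star b"] by (simp add: cstar_identity' power2_eq_square)
  with False show ?thesis by simp
qed (use assms in simp)

text \<open>Expanding (1 - h)^2 = 1 - e and cancelling the unit gives the equation for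
  \<open>h\<close>, so \<open>1 - h\<close> is the square root of \<open>1 - e\<close> in a form
  that is meaningful without a unit. It is a fixed point of h \<mapsto> (e + h^2)/2;
  self-adjointness and commutation are closed conditions kept by this map, so they are built into
  the set on which it contracts.\<close>

lemma sqrt_fixpoint:
  fixes e :: "'a::cstar_algebra"
  assumes sa: "star e = e" and e: "norm e < 1"
  obtains h where "star h = h" "norm h \<le> 1" "2 *\<^sub>R h = e + h * h"
    "\<And>x. x * e = e * x \<Longrightarrow> x * h = h * x"
proof -
  \<comment> \<open>Midway between \<open>norm e\<close> and 1: the ball of radius \<open>r\<close>
    is invariant because (norm e + r^2)/2 \<le> r, and \<open>r < 1\<close> is also the contraction
    constant.\<close>
  define r where "r = (1 + norm e) / 2"
  define S where "S = {h. star h = h \<and> norm h \<le> r \<and> (\<forall>x. x * e = e * x \<longrightarrow> x * h = h * x)}"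
  define f where "f h = (1/2) *\<^sub>R (e + h * h)" for h
  have r: "0 < r" "r < 1" using e by (auto simp: r_def add_pos_nonneg)
  have r2: "norm e + r * r \<le> 2 * r"
  proof -
    have "(1 - norm e) * (1 - norm e) \<le> 4 * (1 - norm e)"
      using e norm_ge_zero[of e] by (intro mult_right_mono) linarith+
    then show ?thesis by (simp add: r_def field_simps)
  qed
  have "closed S"
  proof -
    have "S = {h. star h = h} \<inter> {h. norm h \<le> r} \<inter> (\<Inter>x\<in>{x. x * e = e * x}. {h. x * h = h * x})"
      by (auto simp: S_def)
    moreover have "continuous_on UNIV (star :: 'a \<Rightarrow> 'a)"
      by (rule linear_continuous_on[OF bounded_linear_star])
    then have "closed {h. star h = (h::'a)}" "closed {h::'a. norm h \<le> r}"
      by (auto intro!: closed_Collect_eq closed_Collect_le continuous_intros)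
    moreover have "closed {h. x * h = h * (x::'a)}" for x
      by (intro closed_Collect_eq continuous_intros)
    ultimately show ?thesis by auto
  qed
  then have "complete S" by (simp add: complete_eq_closed)
  moreover have "0 \<in> S" using r by (simp add: S_def)
  moreover have "f ` S \<subseteq> S"
  proof clarify
    fix h assume h: "h \<in> S"
    have "norm (h * h) \<le> r * r"
      using h by (intro norm_mult_le) (auto simp: S_def)
    then have "norm (e + h * h) \<le> 2 * r"
      using norm_triangle_ineq[of e "h * h"] r2 by linarith
    then have "norm (f h) \<le> r" by (simp add: f_def)
    moreover have "star h = h" using h by (simp add: S_def)
    then have "star (f h) = f h" using sa by (simp add: f_def star_scaleR star_add star_mult)
    moreover have "x * f h = f h * x" if "x * e = e * x" for x
    proof -
      have "x * h = h * x" using h that by (simp add: S_def)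
      then have "x * h * h = h * (h * x)" by (simp add: mult.assoc)
      with that show ?thesis by (simp add: f_def distrib_left distrib_right mult.assoc)
    qed
    ultimately show "f h \<in> S" by (simp add: S_def)
  qed
  moreover have "dist (f h) (f k) \<le> r * dist h k" if "h \<in> S" "k \<in> S" for h k
  proof -
    have hk: "norm h \<le> r" "norm k \<le> r" using that by (auto simp: S_def)
    have "f h - f k = (1/2) *\<^sub>R (h * (h - k) + (h - k) * k)"
      by (simp add: f_def algebra_simps flip: scaleR_diff_right)
    also have "norm \<dots> \<le> (1/2) * (r * norm (h - k) + norm (h - k) * r)"
    proof -
      have "norm (h * (h - k)) \<le> r * norm (h - k)" "norm ((h - k) * k) \<le> norm (h - k) * r"
        using hk by (auto intro!: norm_mult_le)
      then show ?thesis using norm_triangle_ineq[of "h * (h - k)" "(h - k) * k"]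
        by (simp add: mult.commute[of _ r])
    qed
    finally show ?thesis by (simp add: dist_norm)
  qed
  ultimately have "\<exists>!h\<in>S. f h = h"
    using r by (intro Banach_fix[of S r f]) auto
  then obtain h where h: "h \<in> S" "f h = h" by blast
  show ?thesis
  proof
    have "2 *\<^sub>R f h = e + h * h" by (simp add: f_def)
    then show "2 *\<^sub>R h = e + h * h" using h by simp
  qed (use h r in \<open>auto simp: S_def\<close>)
qed

text \<open>Here \<open>1 - h\<close> is the square root of \<open>1 - a * a\<close>: if
  \<open>a\<close> is thought of as a cosine, it is the sine, and both together form a
  unitary.\<close>

lemma sqrt_defect:
  fixes a :: "'a::cstar_algebra"
  assumes sa: "star a = a" and a: "norm a < 1"
  obtains h where "star h = h" "a * h = h * a" "2 *\<^sub>R h = a * a + h * h"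
proof -
  have "norm (a * a) < 1"
    using norm_mult_ineq[of a a] mult_left_le[of "norm a" "norm a"] a by simp
  moreover have "star (a * a) = a * a" by (simp add: star_mult sa)
  ultimately obtain h where h: "star h = h" "2 *\<^sub>R h = a * a + h * h"
      "\<And>x. x * (a * a) = a * a * x \<Longrightarrow> x * h = h * x"
    using sqrt_fixpoint by blast
  have "a * h = h * a" using h(3)[of a] by (simp add: mult.assoc)
  then show ?thesis using that h by blast
qed

lemma Cauchy_if_dist_le:
  fixes X :: "nat \<Rightarrow> 'a::metric_space"
  assumes X: "\<And>m n. dist (X m) (X n) \<le> 1 / real (Suc m) + 1 / real (Suc n)"
  shows "Cauchy X"
proof (rule metric_CauchyI)
  fix e :: real assume "e > 0"
  then obtain N where N: "1 / real (Suc N) < e / 2" using nat_approx_posE[of "e / 2"] by auto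
  have "dist (X m) (X n) < e" if "m \<ge> N" "n \<ge> N" for m n
  proof -
    have "1 / real (Suc m) \<le> 1 / real (Suc N)" "1 / real (Suc n) \<le> 1 / real (Suc N)"
      using that by (auto intro!: divide_left_mono)
    then show ?thesis using X[of m n] N by linarith
  qed
  then show "\<exists>M. \<forall>m\<ge>M. \<forall>n\<ge>M. dist (X m) (X n) < e" by blast
qed

text \<open>
  The elements \<open>b \<plusminus> \<i> (1 - k)\<close> are formally unitary, and \<open>b\<close> is their average.
\<close>

lemma norm_le_one_if_sqrt_defect:
  fixes b k :: "'a::cstar_algebra"
  assumes sb: "star b = b" and sk: "star k = k" and com: "b * k = k * b"
    and eq: "2 *\<^sub>R k = b * b + k * k"
  shows "norm b \<le> 1"
proof (rule norm_le_if_mult_le)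
  \<comment> \<open>The formal unitary is applied to \<open>x\<close> by left multiplication, where
    \<open>1 - k\<close> has a meaning; it turns out to be isometric.\<close>
  have V: "norm (b * x + c *\<^sub>C (x - k * x)) = norm x" if c: "c = \<i> \<or> c = - \<i>" for c x
  proof -
    let ?v = "b * x + c *\<^sub>C (x - k * x)"
    have cc: "cnj c = - c" "c * c = -1" using c by auto
    have "star ?v * ?v = star x * (b * (b * x)) + star x * x - 2 *\<^sub>R (star x * (k * x))
        + star x * (k * (k * x)) + c *\<^sub>C (star x * (k * (b * x)) - star x * (b * (k * x)))"
      using cc by (simp add: star_add star_mult star_scaleC star_diff sb sk algebra_simps
          mult_scaleC_left mult_scaleC_right scaleC_scaleC scaleC_add_right
          complex_vector.scale_right_diff_distrib scaleC_minus_one scaleR_2)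
    also have "k * (b * x) = b * (k * x)" by (metis com mult.assoc)
    also have "b * (b * x) = 2 *\<^sub>R (k * x) - k * (k * x)"
      using eq by (simp add: algebra_simps flip: mult.assoc distrib_right mult_scaleR_left)
    finally have "star ?v * ?v = star x * x" by (simp add: algebra_simps)
    then have "(norm ?v)\<^sup>2 = (norm x)\<^sup>2" using cstar_identity by metis
    then show ?thesis by simp
  qed
  fix x
  have "2 *\<^sub>R (b * x) = (b * x + \<i> *\<^sub>C (x - k * x)) + (b * x + (-\<i>) *\<^sub>C (x - k * x))"
    by (simp add: scaleR_2)
  then have "norm (2 *\<^sub>R (b * x)) \<le> norm x + norm x"
    using norm_triangle_ineq V by metis
  then show "norm (b * x) \<le> 1 * norm x" by simp
qed simp

text \<open>A homomorphism maps the witness \<open>h\<close> for \<open>a\<close> to a witness for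
  \<open>f a\<close>, so the unit ball goes to the unit ball without any assumption of boundedness.
  Self-adjoint elements come first, the others follow from the C*-identity.\<close>

lemma star_hom_norm_le:
  fixes f :: "'a::cstar_algebra \<Rightarrow> 'b::cstar_algebra"
  assumes "star_hom f"
  shows "norm (f a) \<le> norm a"
proof -
  have f: "f (a + b) = f a + f b" "f (c *\<^sub>C a) = c *\<^sub>C f a" "f (a * b) = f a * f b"
      "f (star a) = star (f a)" for a b c
    using assms by (auto simp: star_hom_def)
  have fR: "f (r *\<^sub>R a) = r *\<^sub>R f a" for r a by (simp add: scaleR_scaleC f)
  have contr: "norm (f a) \<le> 1" if sa: "star a = a" and "norm a < 1" for a
  proof -
    obtain h where h: "star h = h" "a * h = h * a" "2 *\<^sub>R h = a * a + h * h"
      using sqrt_defect \<open>star a = a\<close> \<open>norm a < 1\<close> by blast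
    show ?thesis
    proof (rule norm_le_one_if_sqrt_defect)
      show "star (f a) = f a" "star (f h) = f h" using sa h(1) by (simp_all flip: f(4))
      show "f a * f h = f h * f a" using h(2) by (simp flip: f(3))
      show "2 *\<^sub>R f h = f a * f a + f h * f h" by (simp add: h(3) flip: f fR)
    qed
  qed
  have sa_le: "norm (f a) \<le> norm a" if sa: "star a = a" for a
  proof (rule field_le_epsilon)
    fix e :: real assume "e > 0"
    \<comment> \<open>A strict margin over the norm, since \<open>sqrt_defect\<close> asks for norm
      less than 1.\<close>
    define t where "t = norm a + e"
    have t: "t > 0" using \<open>e > 0\<close> by (simp add: t_def add_nonneg_pos)
    have "norm (f ((1/t) *\<^sub>R a)) \<le> 1"
      using sa t \<open>e > 0\<close> by (intro contr) (auto simp: star_scaleR t_def divide_simps)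
    then show "norm (f a) \<le> norm a + e" using t by (simp add: fR t_def divide_simps split: if_splits)
  qed
  have "(norm (f a))\<^sup>2 \<le> (norm a)\<^sup>2"
    using sa_le[of "star a * a"] by (simp add: f cstar_identity star_mult star_star)
  then show ?thesis by (simp add: power2_le_iff_abs_le)
qed

section \<open>Positivity in unital algebras\<close>

lemma star_one [simp]: "star (1::'a::{cstar_algebra,real_normed_algebra_1}) = 1"
  using star_mult[of "star (1::'a)" 1] by (simp add: star_star)

lemma star_of_real [simp]:
  "star (of_real r :: 'a::{cstar_algebra,real_normed_algebra_1}) = of_real r"
  by (simp add: of_real_def star_scaleR)

lemma star_power: "star (x ^ n) = star (x::'a::{cstar_algebra,real_normed_algebra_1}) ^ n"
  by (induction n) (auto simp: star_mult power_commutes)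

text \<open>Each squaring is one use of the C*-identity. This is the part of the spectral radius
  formula for self-adjoint elements that is needed, and the reason why growth is always compared
  along exponents \<open>2 ^ k\<close>.\<close>

lemma norm_power_two_power:
  fixes a :: "'a::{cstar_algebra,real_normed_algebra_1}"
  assumes "star a = a"
  shows "norm (a ^ 2 ^ k) = norm a ^ 2 ^ k"
proof (induction k)
  case (Suc k)
  have "norm (star (a ^ 2 ^ k) * a ^ 2 ^ k) = (norm (a ^ 2 ^ k))\<^sup>2" by (rule cstar_identity)
  then show ?case
    using Suc assms by (simp add: star_power flip: power_add power_mult mult_2 power_mult_distrib)
      (simp add: power_mult mult.commute flip: power2_eq_square)
qed simp

text \<open>
  Positivity of the spectrum, expressed through the norm so that sums of positive elements are
  positive by the triangle inequality.
\<close>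

definition cpos :: "'a::{cstar_algebra,real_normed_algebra_1} \<Rightarrow> bool" where
  "cpos a \<longleftrightarrow> star a = a \<and> (\<exists>t. norm (of_real t - a) \<le> t)"

lemma cposI: "star a = a \<Longrightarrow> norm (of_real t - a) \<le> t \<Longrightarrow> cpos a"
  by (auto simp: cpos_def)

section \<open>Sums, square roots and norm estimates of positive elements\<close>

lemma norm_of_real_diff_mono:
  fixes a :: "'a::real_normed_algebra_1"
  assumes "norm (of_real t - a) \<le> t" "t \<le> s"
  shows "norm (of_real s - a) \<le> s"
proof -
  have "of_real s - a = of_real (s - t) + (of_real t - a)" by simp
  also have "norm \<dots> \<le> (s - t) + t"
    using assms norm_triangle_ineq[of "of_real (s - t)" "of_real t - a"] by (simp flip: of_real_diff)
  finally show ?thesis by simp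
qed

lemma cpos_add: "cpos a \<Longrightarrow> cpos b \<Longrightarrow> cpos (a + b)"
proof -
  assume "cpos a" "cpos b"
  then obtain s t where *: "norm (of_real s - a) \<le> s" "norm (of_real t - b) \<le> t"
    "star a = a" "star b = b"
    by (auto simp: cpos_def)
  have "norm (of_real (s + t) - (a + b)) \<le> s + t"
    using norm_triangle_mono[OF *(1,2)] by (simp add: algebra_simps)
  then show ?thesis by (rule cposI[rotated]) (simp add: star_add *)
qed

lemma cpos_scaleR: "cpos a \<Longrightarrow> 0 \<le> r \<Longrightarrow> cpos (r *\<^sub>R a)"
proof -
  assume a: "cpos a" and r: "0 \<le> r"
  then obtain t where t: "norm (of_real t - a) \<le> t" "star a = a" by (auto simp: cpos_def)
  have "of_real (r * t) - r *\<^sub>R a = r *\<^sub>R (of_real t - a)"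
    by (simp add: of_real_def scaleR_diff_right)
  then have "norm (of_real (r * t) - r *\<^sub>R a) \<le> r * t"
    using t r by (simp add: mult_left_mono)
  then show ?thesis by (rule cposI[rotated]) (simp add: star_scaleR t)
qed

lemma cpos_of_real_diff: "star a = a \<Longrightarrow> norm a \<le> s \<Longrightarrow> cpos (of_real s - a)"
  by (rule cposI[where t = s]) (auto simp: star_diff)

text \<open>With \<open>T = t + \<epsilon>\<close> and \<open>e = (t - a) / T\<close> one has T(1 -
  e) = a + \<epsilon>, so the root of \<open>1 - e\<close> is rescaled by \<open>sqrt T\<close>. The
  shift by \<epsilon> is what makes the norm of \<open>e\<close> strictly less than 1.\<close>

lemma cpos_sqrt:
  fixes a :: "'a::{cstar_algebra,real_normed_algebra_1}"
  assumes "cpos a" "0 < \<epsilon>"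
  obtains d where "cpos d" "d * d = a + of_real \<epsilon>" "\<And>x. x * a = a * x \<Longrightarrow> x * d = d * x"
proof -
  obtain t where t: "norm (of_real t - a) \<le> t" and sa: "star a = a"
    using assms by (auto simp: cpos_def)
  define T where "T = t + \<epsilon>"
  have t0: "0 \<le> t" using t norm_ge_zero order_trans by blast
  with assms have T: "0 < T" "t < T" by (auto simp: T_def)
  define e where "e = (1/T) *\<^sub>R (of_real t - a)"
  have "norm e \<le> t / T" using t T by (simp add: e_def divide_right_mono)
  also have "\<dots> < 1" using T by simp
  finally have "norm e < 1" .
  moreover have "star e = e" by (simp add: e_def star_scaleR star_diff sa)
  ultimately obtain h where h: "star h = h" "norm h \<le> 1" "2 *\<^sub>R h = e + h * h"
    "\<And>x. x * e = e * x \<Longrightarrow> x * h = h * x"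
    using sqrt_fixpoint by blast
  define d where "d = sqrt T *\<^sub>R (1 - h)"
  show ?thesis
  proof
    show "cpos d"
    proof (rule cposI[where t = "sqrt T"])
      have "of_real (sqrt T) - d = sqrt T *\<^sub>R h" by (simp add: d_def of_real_def scaleR_diff_right)
      then show "norm (of_real (sqrt T) - d) \<le> sqrt T" using h(2) T by (simp add: mult_left_le)
    qed (simp add: d_def star_scaleR star_diff h)
    have "d * d = T *\<^sub>R (1 - 2 *\<^sub>R h + h * h)"
      using T by (simp add: d_def algebra_simps scaleR_2)
    also have "\<dots> = T *\<^sub>R (1 - e)" by (simp add: h(3))
    also have "\<dots> = a + of_real \<epsilon>"
      using T by (simp add: e_def scaleR_diff_right of_real_def) (simp add: T_def scaleR_left_distrib)
    finally show "d * d = a + of_real \<epsilon>" .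
    fix x assume "x * a = a * x"
    then have "x * e = e * x" by (simp add: e_def of_real_def algebra_simps)
    then show "x * d = d * x" using h(4)[of x] by (simp add: d_def algebra_simps)
  qed
qed

text \<open>For commuting self-adjoint elements, d + if has adjoint d - if, and their product is d^2
  + f^2. With a scalar value this makes d + if a multiple of a unitary.\<close>

lemma norm_add_i_scaleC:
  fixes d f :: "'a::{cstar_algebra,real_normed_algebra_1}"
  assumes "star d = d" "star f = f" "d * f = f * d" "d * d + f * f = of_real g"
  shows "(norm (d + \<i> *\<^sub>C f))\<^sup>2 = \<bar>g\<bar>" "(norm (d - \<i> *\<^sub>C f))\<^sup>2 = \<bar>g\<bar>"
proof -
  have st: "star (d + \<i> *\<^sub>C f) = d - \<i> *\<^sub>C f"
    using assms by (simp add: star_add star_scaleC)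
  have "(d - \<i> *\<^sub>C f) * (d + \<i> *\<^sub>C f) = of_real g"
    using assms(3,4) by (simp add: algebra_simps mult_scaleC_left mult_scaleC_right scaleC_scaleC
        scaleC_minus_one)
  then show "(norm (d + \<i> *\<^sub>C f))\<^sup>2 = \<bar>g\<bar>"
    using cstar_identity[of "d + \<i> *\<^sub>C f"] by (simp add: st)
  then show "(norm (d - \<i> *\<^sub>C f))\<^sup>2 = \<bar>g\<bar>" by (metis norm_star st)
qed

text \<open>The double angle formula: if c + is is unitary, then so are its square and the adjoint
  of that, and their sum is 2(c^2 - s^2) = -4(1/2 - c^2). Hence 1/2 - c^2 has norm at most 1/2,
  which is positivity of c^2.\<close>

lemma cpos_square:
  fixes d :: "'a::{cstar_algebra,real_normed_algebra_1}"
  assumes "star d = d"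
  shows "cpos (d * d)"
proof -
  define T where "T = norm d + 1"
  have T: "T > 0" by (simp add: T_def add_nonneg_pos)
  define c where "c = (1/T) *\<^sub>R d"
  have sc: "star c = c" by (simp add: c_def assms star_scaleR)
  have "norm c < 1" using T by (simp add: c_def T_def divide_simps)
  with sc obtain h where h: "star h = h" "c * h = h * c" "2 *\<^sub>R h = c * c + h * h"
    using sqrt_defect by blast
  define s where "s = 1 - h"
  have ss: "s * s = 1 - c * c"
    using h(3) by (simp add: s_def algebra_simps scaleR_2)
  have s: "star s = s" "c * s = s * c" using h by (simp_all add: s_def star_diff algebra_simps)
  have "(norm (c + \<i> *\<^sub>C s))\<^sup>2 = \<bar>1\<bar>" "(norm (c - \<i> *\<^sub>C s))\<^sup>2 = \<bar>1\<bar>"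
    using norm_add_i_scaleC[of c s 1] sc s ss by auto
  then have n: "norm (c + \<i> *\<^sub>C s) = 1" "norm (c - \<i> *\<^sub>C s) = 1"
    by (simp_all add: power2_eq_1_iff) (smt (verit) norm_ge_zero)+
  have "(c + \<i> *\<^sub>C s) * (c + \<i> *\<^sub>C s) + (c - \<i> *\<^sub>C s) * (c - \<i> *\<^sub>C s) = 2 *\<^sub>R (c * c - s * s)"
    by (simp add: algebra_simps mult_scaleC_left mult_scaleC_right scaleC_scaleC
        scaleC_minus_one scaleR_2)
  also have "\<dots> = (-4) *\<^sub>R (of_real (1/2) - c * c)"
    by (simp add: ss of_real_def algebra_simps flip: scaleR_left_distrib)
  finally have "4 * norm (of_real (1/2) - c * c)
      = norm ((c + \<i> *\<^sub>C s) * (c + \<i> *\<^sub>C s) + (c - \<i> *\<^sub>C s) * (c - \<i> *\<^sub>C s))"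
    by (simp del: of_real_divide)
  also have "\<dots> \<le> 1 * 1 + 1 * 1"
    using n by (intro norm_triangle_mono norm_mult_le) auto
  finally have "norm (of_real (1/2) - c * c) \<le> 1/2" by simp
  then have "cpos (c * c)" by (rule cposI[rotated]) (simp add: star_mult sc)
  then have "cpos ((T * T) *\<^sub>R (c * c))" using T by (intro cpos_scaleR) auto
  then show ?thesis using T by (simp add: c_def)
qed

text \<open>From 0 \<le> a \<le> g, take roots \<open>d\<close> of a and \<open>f\<close> of g - a,
  up to \<epsilon>. Then d^2 + f^2 is a scalar, so d \<plusminus> if are multiples of unitaries and
  \<open>d\<close> is their average.\<close>

lemma cpos_norm_le:
  fixes a :: "'a::{cstar_algebra,real_normed_algebra_1}"
  assumes a: "cpos a" and ga: "cpos (of_real g - a)"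
  shows "norm a \<le> g"
proof (rule field_le_epsilon)
  fix e :: real assume "e > 0"
  \<comment> \<open>Both roots contribute one \<epsilon> to \<open>d * d + f * f\<close>, and a
    third is lost when passing from \<open>a + \<epsilon>\<close> back to \<open>a\<close>.\<close>
  define \<epsilon> where "\<epsilon> = e / 3"
  have \<epsilon>: "\<epsilon> > 0" using \<open>e > 0\<close> by (simp add: \<epsilon>_def)
  obtain d where d: "cpos d" "d * d = a + of_real \<epsilon>" "\<And>x. x * a = a * x \<Longrightarrow> x * d = d * x"
    using cpos_sqrt[OF a \<epsilon>] by blast
  obtain f where f: "cpos f" "f * f = of_real g - a + of_real \<epsilon>"
      "\<And>x. x * (of_real g - a) = (of_real g - a) * x \<Longrightarrow> x * f = f * x"
    using cpos_sqrt[OF ga \<epsilon>] by blast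
  have "a * d = d * a" by (rule d) simp
  then have df: "d * f = f * d" by (intro f) (simp add: of_real_def algebra_simps)
  \<comment> \<open>The sum of both hypotheses is the scalar \<open>g\<close>, which is thereby
    nonnegative.\<close>
  have "cpos (a + (of_real g - a))" by (rule cpos_add[OF a ga])
  then obtain t where "norm (of_real t - of_real g :: 'a) \<le> t" by (auto simp: cpos_def)
  then have "\<bar>t - g\<bar> \<le> t" by (simp flip: of_real_diff)
  then have g: "g \<ge> 0" by simp
  have sq: "(norm (d + \<i> *\<^sub>C f))\<^sup>2 = g + 2 * \<epsilon>" "(norm (d - \<i> *\<^sub>C f))\<^sup>2 = g + 2 * \<epsilon>"
  proof -
    have "star d = d" "star f = f" using d(1) f(1) by (simp_all add: cpos_def)
    moreover have "d * d + f * f = of_real (g + 2 * \<epsilon>)"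
      unfolding d(2) f(2) mult_2 of_real_add by (simp add: algebra_simps del: mult_2)
    ultimately have "(norm (d + \<i> *\<^sub>C f))\<^sup>2 = \<bar>g + 2 * \<epsilon>\<bar>"
        "(norm (d - \<i> *\<^sub>C f))\<^sup>2 = \<bar>g + 2 * \<epsilon>\<bar>"
      using norm_add_i_scaleC[OF _ _ df] by blast+
    then show "(norm (d + \<i> *\<^sub>C f))\<^sup>2 = g + 2 * \<epsilon>" "(norm (d - \<i> *\<^sub>C f))\<^sup>2 = g + 2 * \<epsilon>"
      using g \<epsilon> by simp_all
  qed
  then have eq: "norm (d - \<i> *\<^sub>C f) = norm (d + \<i> *\<^sub>C f)" by (simp flip: power2_eq_iff_nonneg)
  have "2 *\<^sub>R d = (d + \<i> *\<^sub>C f) + (d - \<i> *\<^sub>C f)" by (simp add: scaleR_2)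
  then have "2 * norm d \<le> norm (d + \<i> *\<^sub>C f) + norm (d - \<i> *\<^sub>C f)"
    by (metis norm_scaleR norm_triangle_ineq abs_numeral)
  then have "norm d \<le> norm (d + \<i> *\<^sub>C f)" using eq by simp
  then have "norm (d * d) \<le> g + 2 * \<epsilon>"
    using sq(1) norm_mult_le[of d _ d] by (metis power2_eq_square)
  then have "norm (a + of_real \<epsilon>) \<le> g + 2 * \<epsilon>" by (simp add: d)
  then show "norm a \<le> g + e"
    using norm_triangle_ineq4[of "a + of_real \<epsilon>" "of_real \<epsilon>"] \<epsilon> by (simp add: \<epsilon>_def)
qed

lemma cpos_norm_add_le: "cpos a \<Longrightarrow> cpos b \<Longrightarrow> norm a \<le> norm (a + b)"
proof (rule cpos_norm_le)
  assume "cpos a" "cpos b"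
  then have "cpos ((of_real (norm (a + b)) - (a + b)) + b)"
    by (intro cpos_add cpos_of_real_diff) (auto simp: cpos_def star_add)
  then show "cpos (of_real (norm (a + b)) - a)" by simp
qed

text \<open>The definition of \<open>cpos\<close> offers only some radius; by this lemma every bound
  of the norm can serve as one.\<close>

lemma cpos_norm_of_real_diff_le: "cpos a \<Longrightarrow> norm a \<le> s \<Longrightarrow> norm (of_real s - a) \<le> s"
proof (rule cpos_norm_le)
  assume a: "cpos a" "norm a \<le> s"
  then show "cpos (of_real s - a)" by (intro cpos_of_real_diff) (auto simp: cpos_def)
  show "cpos (of_real s - (of_real s - a))" using a by simp
qed

text \<open>The fixed radius \<open>norm a + 1\<close> works for all approximants within distance 1
  of \<open>a\<close>, so the defining inequality passes to the limit.\<close>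

lemma cpos_approx:
  assumes "star a = a" and approx: "\<And>\<epsilon>. 0 < \<epsilon> \<Longrightarrow> \<exists>b. cpos b \<and> norm (a - b) \<le> \<epsilon>"
  shows "cpos a"
proof (rule cposI)
  show "norm (of_real (norm a + 1) - a) \<le> norm a + 1"
  proof (rule field_le_epsilon)
    fix e :: real assume "e > 0"
    then obtain b where b: "cpos b" "norm (a - b) \<le> min e 1" using approx[of "min e 1"] by auto
    have "norm b \<le> norm a + 1" using norm_triangle_ineq2[of b a] b by (simp add: norm_minus_commute)
    then have "norm (of_real (norm a + 1) - b) \<le> norm a + 1"
      using cpos_norm_of_real_diff_le b by blast
    moreover have "of_real (norm a + 1) - a = (of_real (norm a + 1) - b) - (a - b)" by simp
    ultimately show "norm (of_real (norm a + 1) - a) \<le> norm a + 1 + e"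
      using norm_triangle_ineq4[of "of_real (norm a + 1) - b" "a - b"] b by simp
  qed
qed (fact assms)

text \<open>
  This replaces the invariance of the spectrum, away from \<open>0\<close>, under exchanging
  \<open>y y*\<close> and \<open>y* y\<close>: the norms of the elements $(t - p)^n p = y^* (t - q)^n y$ grow
  at most like the powers of $\|t - q\|$.
\<close>

lemma cpos_star_mult_swap:
  fixes y :: "'a::{cstar_algebra,real_normed_algebra_1}"
  assumes pos: "cpos (y * star y + of_real \<epsilon>)" and \<epsilon>: "0 \<le> \<epsilon>"
  shows "cpos (star y * y + of_real \<epsilon>)"
proof -
  obtain s0 where s0: "norm (of_real s0 - (y * star y + of_real \<epsilon>)) \<le> s0"
    using pos by (auto simp: cpos_def)
  \<comment> \<open>\<open>s\<close> is an enlarged radius for the given positive element, and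
    \<open>t\<close> is chosen so that \<open>b\<close> equals
    \<open>s - (y * star y + \<epsilon>)\<close>. The maximum with \<epsilon> keeps \<open>t\<close>
    nonnegative.\<close>
  define s where "s = max s0 \<epsilon> + 1"
  define t where "t = s - \<epsilon>"
  have st: "0 < s" "0 \<le> t" "t \<le> s" using \<epsilon> by (auto simp: s_def t_def)
  define p where "p = star y * y"
  define b where "b = of_real t - y * star y"
  define a where "a = of_real t - p"
  have b: "norm b \<le> s"
    using norm_of_real_diff_mono[OF s0, of s] by (simp add: s_def b_def t_def algebra_simps)
  have sa: "star a = a" by (simp add: a_def p_def star_diff star_mult star_star)
  have swap: "a ^ n * star y = star y * b ^ n" for n
  proof (induction n)
    case (Suc n)
    have "a * star y = star y * b" by (simp add: a_def b_def p_def of_real_def algebra_simps)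
    then show ?case using Suc by (metis mult.assoc power_Suc)
  qed simp
  have ub: "norm (a ^ n * p) \<le> norm (star y) * s ^ n * norm y" for n
  proof -
    have "norm (b ^ n) \<le> s ^ n" using norm_power_ineq[of b n] power_mono[OF b, of n] by simp
    moreover have "a ^ n * p = star y * b ^ n * y" by (simp add: p_def swap flip: mult.assoc)
    ultimately show ?thesis by (metis norm_mult_le order_refl)
  qed
  have "norm a \<le> s"
  proof (rule ccontr)
    assume "\<not> norm a \<le> s"
    then have as: "s < norm a" by simp
    \<comment> \<open>The bound on \<open>(norm a / s) ^ m\<close> to which the estimates below
      lead, whereas these powers are unbounded if \<open>norm a > s\<close>.\<close>
    define C where "C = norm (star y) * norm y / (norm a - s)"
    from as st obtain n where n: "C < (norm a / s) ^ n" using real_arch_pow[of "norm a / s" C] by auto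
    \<comment> \<open>\<open>Suc m\<close> is a power of two, where the norm of the power of
      \<open>a\<close> is known exactly.\<close>
    define m where "m = (2::nat) ^ n - 1"
    have m: "n \<le> m" "Suc m = 2 ^ n" using less_exp[of n] unfolding m_def by linarith+
    have "norm (a ^ Suc m) = norm a ^ Suc m" using norm_power_two_power[OF sa, of n] m by simp
    moreover have "a ^ m * p = t *\<^sub>R a ^ m - a ^ Suc m"
    proof -
      have "a ^ m * p = a ^ m * (of_real t - a)" by (simp add: a_def)
      then show ?thesis by (simp add: right_diff_distrib of_real_def power_commutes)
    qed
    ultimately have "norm a ^ Suc m - t * norm (a ^ m) \<le> norm (a ^ m * p)"
      using norm_triangle_ineq2[of "a ^ Suc m" "t *\<^sub>R a ^ m"] st by (simp add: norm_minus_commute)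
    moreover have "t * norm (a ^ m) \<le> s * norm a ^ m"
      using st norm_power_ineq[of a m] by (intro mult_mono) auto
    ultimately have "norm a ^ m * (norm a - s) \<le> norm (star y) * norm y * s ^ m"
      using ub[of m] by (simp add: algebra_simps)
    then have "(norm a / s) ^ m \<le> C"
      using as st by (simp add: C_def power_divide divide_simps mult_ac)
    moreover have "(norm a / s) ^ n \<le> (norm a / s) ^ m"
      using as st m by (intro power_increasing) auto
    ultimately show False using n by simp
  qed
  then show ?thesis
    by (intro cposI[where t = s]) (simp_all add: a_def p_def t_def algebra_simps star_add star_mult star_star)
qed

text \<open>
  Kaplansky's argument: a negative part of \<open>c* c\<close> would give \<open>y\<close> with \<open>-y* y\<close> positive.
  Here \<open>k\<close> approximates the absolute value of \<open>c* c\<close>, and \<open>v\<close> twice its negative part.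
\<close>

theorem cpos_star_mult_self:
  fixes c :: "'a::{cstar_algebra,real_normed_algebra_1}"
  shows "cpos (star c * c)"
proof -
  define h where "h = star c * c"
  have sh: "star h = h" by (simp add: h_def star_mult star_star)
  \<comment> \<open>\<open>N\<close> will bound \<open>norm v\<close> and \<open>M\<close> will
    bound \<open>norm E\<close>, uniformly for \<epsilon> \<le> 1.\<close>
  define N where "N = 2 * norm h + 1"
  define M where "M = 2 * N ^ 3 + 2 * N + 1"
  have N: "N \<ge> 1" by (simp add: N_def)
  then have M: "M > 0" by (simp add: M_def add_nonneg_pos)
  have main: "\<exists>k. cpos k \<and> norm (h - k) ^ 4 \<le> 4 * \<epsilon> * M" if \<epsilon>: "0 < \<epsilon>" "\<epsilon> \<le> 1" for \<epsilon>
  proof -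
    obtain k where k: "cpos k" "k * k = h * h + of_real \<epsilon>"
        "\<And>x. x * (h * h) = h * h * x \<Longrightarrow> x * k = k * x"
      using cpos_sqrt[OF cpos_square[OF sh] \<epsilon>(1)] by metis
    obtain m where m: "cpos m" "m * m = k + of_real \<epsilon>" "\<And>x. x * k = k * x \<Longrightarrow> x * m = m * x"
      using cpos_sqrt[OF k(1) \<epsilon>(1)] by metis
    define v where "v = k - h"
    have sk: "star k = k" "star m = m" using k(1) m(1) by (auto simp: cpos_def)
    have sv: "star v = v" by (simp add: v_def star_diff sk sh)
    have hk: "h * k = k * h" by (rule k) (simp add: mult.assoc)
    have vk: "v * k = k * v" and hv: "h * v = v * h" by (simp_all add: v_def algebra_simps hk)
    have vm: "v * m = m * v" by (intro m vk)
    \<comment> \<open>Up to \<epsilon>, these say h v = - v^2 / 2 and v k = v^2 / 2.\<close>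
    have hv2: "2 *\<^sub>R (h * v) = of_real \<epsilon> - v * v" and kv2: "2 *\<^sub>R (v * k) = of_real \<epsilon> + v * v"
      by (simp_all add: v_def algebra_simps scaleR_2 hk k(2))
    \<comment> \<open>The factor \<open>m\<close> inserts \<open>k\<close> into y* y, which becomes
      - v^4 / 4 up to \<epsilon>. Without it one would get - v^3 / 2, and the sign of v^3 is not
      known at this stage, whereas v^4 is a square.\<close>
    define y where "y = c * v * m"
    define p where "p = star y * y"
    have "p = m * (v * h * v) * m"
      by (simp add: p_def y_def h_def star_mult sv sk mult.assoc)
    also have "\<dots> = v * h * v * (m * m)"
    proof -
      have "m * (v * h * v) = v * h * v * m"
        using vm m(3)[OF hk] by (metis mult.assoc)
      then show ?thesis by (simp add: mult.assoc)
    qed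
    also have "\<dots> = (v * h) * (v * (m * m))" by (simp add: mult.assoc)
    also have "\<dots> = h * v * (v * k + \<epsilon> *\<^sub>R v)"
      by (simp only: hv m(2)) (simp add: distrib_left of_real_def)
    finally have "4 *\<^sub>R p = (2 *\<^sub>R (h * v)) * (2 *\<^sub>R (v * k) + (2 * \<epsilon>) *\<^sub>R v)"
      by (simp add: distrib_left algebra_simps)
    also have "\<dots> = (of_real \<epsilon> - v * v) * (of_real \<epsilon> + v * v + (2 * \<epsilon>) *\<^sub>R v)"
      by (simp add: hv2 kv2)
    finally have p4: "4 *\<^sub>R p = \<epsilon> *\<^sub>R (of_real \<epsilon> + (2 * \<epsilon>) *\<^sub>R v - 2 *\<^sub>R (v * v * v)) - v * v * (v * v)"
      by (simp add: algebra_simps of_real_def)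
    define E where "E = of_real \<epsilon> + (2 * \<epsilon>) *\<^sub>R v - 2 *\<^sub>R (v * v * v)"
    have sE: "star E = E" by (simp add: E_def star_add star_diff star_scaleR star_mult sv mult.assoc)
    have "norm v \<le> N"
    proof -
      have "(norm k)\<^sup>2 = norm (h * h + of_real \<epsilon>)"
        using cstar_identity[of k] by (simp add: sk k(2))
      also have "\<dots> \<le> norm h * norm h + 1"
        using \<epsilon> by (intro norm_triangle_mono norm_mult_ineq) auto
      also have "\<dots> \<le> (norm h + 1)\<^sup>2" by (simp add: power2_eq_square algebra_simps)
      finally have "norm k \<le> norm h + 1" by (simp add: power2_le_iff_abs_le)
      then show ?thesis using norm_triangle_ineq4[of k h] by (simp add: v_def N_def)
    qed
    then have nv: "norm (v * v * v) \<le> N * N * N" by (intro norm_mult_le)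
    have "norm E \<le> (1 + 2 * N) + 2 * (N * N * N)"
      unfolding E_def
    proof (rule order_trans[OF norm_triangle_ineq4 add_mono[OF norm_triangle_mono]])
      show "norm ((2 * \<epsilon>) *\<^sub>R v) \<le> 2 * N"
        using \<epsilon> \<open>norm v \<le> N\<close> mult_mono[of \<epsilon> 1 "norm v" N] by simp
    qed (use \<epsilon> nv in auto)
    then have E: "norm E \<le> M" by (simp add: M_def power3_eq_cube)
    \<comment> \<open>From 4p = \<epsilon>E - v^4 and E \<le> M one gets p \<le>
      \<epsilon>M/4.\<close>
    define \<delta> where "\<delta> = \<epsilon> * M / 4"
    have \<delta>: "\<delta> > 0" using \<epsilon> M by (simp add: \<delta>_def)
    have v4: "cpos (v * v * (v * v))" by (rule cpos_square) (simp add: star_mult sv)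
    have "cpos ((1/4) *\<^sub>R (v * v * (v * v) + (of_real (\<epsilon> * M) - \<epsilon> *\<^sub>R E)))"
      using v4 sE E \<epsilon> by (intro cpos_scaleR cpos_add cpos_of_real_diff)
        (auto simp: star_scaleR)
    also have "(1/4) *\<^sub>R (v * v * (v * v) + (of_real (\<epsilon> * M) - \<epsilon> *\<^sub>R E)) = of_real \<delta> - (1/4) *\<^sub>R (4 *\<^sub>R p)"
      by (simp only: p4 E_def[symmetric]) (simp add: \<delta>_def of_real_def algebra_simps)
    finally have neg: "cpos (of_real \<delta> - p)" by simp
    have "cpos ((y + star y) * (y + star y))" "cpos ((\<i> *\<^sub>C (y - star y)) * (\<i> *\<^sub>C (y - star y)))"
      by (rule cpos_square; simp add: star_add star_star star_scaleC star_diff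
          complex_vector.scale_right_diff_distrib add.commute)+
    then have "cpos ((1/2) *\<^sub>R ((y + star y) * (y + star y) + (\<i> *\<^sub>C (y - star y)) * (\<i> *\<^sub>C (y - star y))))"
      by (intro cpos_scaleR cpos_add) auto
    also have "(1/2) *\<^sub>R ((y + star y) * (y + star y) + (\<i> *\<^sub>C (y - star y)) * (\<i> *\<^sub>C (y - star y)))
        = y * star y + p"
    proof -
      have "(y + star y) * (y + star y) + (\<i> *\<^sub>C (y - star y)) * (\<i> *\<^sub>C (y - star y))
          = 2 *\<^sub>R (y * star y + p)"
        by (simp add: mult_scaleC_left mult_scaleC_right scaleC_scaleC scaleC_minus_one p_def
            algebra_simps scaleR_2)
      then show ?thesis by simp
    qed
    finally have "cpos ((y * star y + p) + (of_real \<delta> - p))" using neg by (rule cpos_add)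
    \<comment> \<open>As \<delta> - y* y is positive, so is y y* + \<delta>; exchanging the factors
      bounds y* y from below by -\<delta>. Being also bounded above, \<open>p\<close> is small, and
      with it v^4.\<close>
    then have "cpos (y * star y + of_real \<delta>)" by simp
    then have pp: "cpos (p + of_real \<delta>)"
      unfolding p_def using \<delta> by (intro cpos_star_mult_swap) auto
    have "cpos (of_real (2 * \<delta>) - (p + of_real \<delta>))"
      using neg unfolding mult_2 of_real_add by (simp add: algebra_simps)
    with pp have "norm (p + of_real \<delta>) \<le> 2 * \<delta>" by (rule cpos_norm_le)
    then have np: "norm p \<le> 3 * \<delta>"
      using norm_triangle_ineq4[of "p + of_real \<delta>" "of_real \<delta>"] \<delta> by simp
    have "norm v ^ 4 = norm (v * v * (v * v))"
      using norm_power_two_power[OF sv, of 2] by (simp add: power4_eq_xxxx mult.assoc)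
    also have "v * v * (v * v) = \<epsilon> *\<^sub>R E - 4 *\<^sub>R p" by (simp add: p4 E_def)
    also have "norm \<dots> \<le> \<epsilon> * M + 4 * (3 * \<delta>)"
      using E \<epsilon> np by (intro order_trans[OF norm_triangle_ineq4] add_mono) auto
    finally have "norm v ^ 4 \<le> 4 * \<epsilon> * M" by (simp add: \<delta>_def mult.commute)
    then show ?thesis using k(1) by (auto simp: v_def norm_minus_commute)
  qed
  have "cpos h"
  proof (rule cpos_approx[OF sh])
    fix e :: real assume "e > 0"
    define \<epsilon> where "\<epsilon> = min 1 (e ^ 4 / (4 * M))"
    have "0 < \<epsilon>" "\<epsilon> \<le> 1" using \<open>e > 0\<close> M by (auto simp: \<epsilon>_def)
    then obtain k where k: "cpos k" "norm (h - k) ^ 4 \<le> 4 * \<epsilon> * M" using main by blast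
    have "\<epsilon> \<le> e ^ 4 / (4 * M)" by (simp add: \<epsilon>_def)
    then have "4 * \<epsilon> * M \<le> e ^ 4" using M by (simp add: field_simps)
    with k have "norm (h - k) ^ 4 \<le> e ^ 4" by simp
    then have "norm (h - k) \<le> e" using \<open>e > 0\<close> by (simp add: power_mono_iff)
    with k show "\<exists>b. cpos b \<and> norm (h - b) \<le> e" by blast
  qed
  then show ?thesis by (simp add: h_def)
qed

section \<open>The unitization\<close>

text \<open>Positivity is tested on differences \<open>t - a\<close> with a scalar \<open>t\<close>,
  so a unit is adjoined before it is applied to general C*-algebras.\<close>

datatype 'a unitization = Unitization (scal: complex) (elt: 'a)

definition uact :: "'a::cstar_algebra unitization \<Rightarrow> 'a \<Rightarrow> 'a" where
  "uact z x = scal z *\<^sub>C x + elt z * x"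

text \<open>
  The operator norm alone is only a seminorm when the algebra already has a unit.
\<close>

definition unorm :: "'a::cstar_algebra unitization \<Rightarrow> real" where
  "unorm z = max (cmod (scal z)) (onorm (uact z))"

lemma bounded_linear_uact: "bounded_linear (uact z)"
proof -
  have "bounded_linear (\<lambda>x. scal z *\<^sub>C x + elt z * x)"
    by (intro bounded_linear_add bounded_linear_scaleC bounded_linear_mult_right)
  then show ?thesis by (simp add: uact_def[abs_def])
qed

lemma norm_uact_le: "norm (uact z x) \<le> unorm z * norm x"
  by (rule order_trans[OF onorm[OF bounded_linear_uact]]) (auto simp: unorm_def intro: mult_right_mono)

lemma unorm_le:
  assumes "cmod (scal z) \<le> b" "\<And>x. norm (uact z x) \<le> b * norm x"
  shows "unorm z \<le> b"
proof -
  have "0 \<le> b" using assms(1) norm_ge_zero order_trans by blast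
  then show ?thesis using assms by (auto simp: unorm_def intro!: onorm_bound)
qed

lemma norm_scal_le: "cmod (scal z) \<le> unorm z"
  by (simp add: unorm_def)

lemma unorm_nonneg: "0 \<le> unorm z"
  using norm_scal_le[of z] norm_ge_zero order_trans by blast

text \<open>Together with \<open>norm_scal_le\<close> and \<open>unorm_le_add\<close> this makes the
  norm equivalent to the sum of the norms of both coordinates, which yields completeness. The factor
  2 pays for removing the scalar part.\<close>

lemma norm_elt_le: "norm (elt z) \<le> 2 * unorm z"
proof (rule norm_le_if_mult_le)
  fix x
  have "elt z * x = uact z x - scal z *\<^sub>C x" by (simp add: uact_def)
  also have "norm \<dots> \<le> unorm z * norm x + unorm z * norm x"
    using norm_triangle_ineq4[of "uact z x" "scal z *\<^sub>C x"] norm_uact_le[of z x]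
      mult_right_mono[OF norm_scal_le[of z] norm_ge_zero[of x]]
    unfolding norm_scaleC by linarith
  finally show "norm (elt z * x) \<le> 2 * unorm z * norm x" by (simp add: mult_ac)
qed (simp add: unorm_nonneg)

lemma unorm_le_add: "unorm z \<le> cmod (scal z) + norm (elt z)"
proof (rule unorm_le)
  fix x
  show "norm (uact z x) \<le> (cmod (scal z) + norm (elt z)) * norm x"
    unfolding uact_def distrib_right
    by (intro norm_triangle_mono norm_mult_ineq) (simp add: norm_scaleC)
qed simp

instantiation unitization :: (cstar_algebra) "{complex_vector, star, real_normed_algebra_1}"
begin

definition "0 = Unitization 0 0"
definition "1 = Unitization 1 0"
definition "x + y = Unitization (scal x + scal y) (elt x + elt y)"
definition "x - y = Unitization (scal x - scal y) (elt x - elt y)"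
definition "- x = Unitization (- scal x) (- elt x)"
definition "x * y = Unitization (scal x * scal y)
  (scal x *\<^sub>C elt y + scal y *\<^sub>C elt x + elt x * elt y)"
definition "scaleR r x = Unitization (scaleR r (scal x)) (scaleR r (elt x))"
definition "scaleC c x = Unitization (c * scal x) (c *\<^sub>C elt x)"
definition "star x = Unitization (cnj (scal x)) (star (elt x))"
definition norm_unitization :: "'a unitization \<Rightarrow> real" where "norm_unitization = unorm"
definition sgn_unitization :: "'a unitization \<Rightarrow> 'a unitization" where
  "sgn_unitization x = inverse (norm x) *\<^sub>R x"
definition dist_unitization :: "'a unitization \<Rightarrow> 'a unitization \<Rightarrow> real" where
  "dist_unitization x y = norm (x - y)"
definition uniformity_unitization :: "('a unitization \<times> 'a unitization) filter" where
  "uniformity_unitization = (INF e\<in>{0 <..}. principal {(x, y). dist x y < e})"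
definition open_unitization :: "'a unitization set \<Rightarrow> bool" where
  "open_unitization U = (\<forall>x\<in>U. eventually (\<lambda>(x', y). x' = x \<longrightarrow> y \<in> U) uniformity)"

lemmas unitization_defs = zero_unitization_def one_unitization_def plus_unitization_def
  minus_unitization_def uminus_unitization_def times_unitization_def scaleR_unitization_def
  scaleC_unitization_def star_unitization_def

lemma uact_simps:
  "uact (x + y) v = uact x v + uact y v" "uact (x * y) v = uact x (uact y v)"
  "uact (r *\<^sub>R x) v = r *\<^sub>R uact x v" "uact (c *\<^sub>C x) v = c *\<^sub>C uact x v"
  by (simp_all add: uact_def unitization_defs algebra_simps scaleC_add_left scaleC_add_right
      scaleC_scaleC mult_scaleC_left mult_scaleC_right scaleR_scaleC scaleR_conv_of_real mult.commute)

lemma star_mult_uact: "star w * uact x v = star (uact (star x) w) * v"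
  by (simp add: uact_def unitization_defs star_add star_scaleC star_mult star_star algebra_simps
      mult_scaleC_left mult_scaleC_right)

lemma unorm_mult: "unorm (x * y) \<le> unorm x * unorm y"
proof (rule unorm_le)
  show "cmod (scal (x * y)) \<le> unorm x * unorm y"
    by (simp add: times_unitization_def norm_mult mult_mono norm_scal_le unorm_nonneg)
  fix v
  have "norm (uact (x * y) v) \<le> unorm x * norm (uact y v)" by (simp add: uact_simps norm_uact_le)
  also have "\<dots> \<le> unorm x * (unorm y * norm v)" by (intro mult_left_mono norm_uact_le unorm_nonneg)
  finally show "norm (uact (x * y) v) \<le> unorm x * unorm y * norm v" by simp
qed

lemma unorm_square_le: "(unorm x)\<^sup>2 \<le> unorm (star x * x)"
proof -
  have "unorm x \<le> sqrt (unorm (star x * x))"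
  proof (rule unorm_le)
    have "(cmod (scal x))\<^sup>2 = cmod (scal (star x * x))"
      by (simp add: unitization_defs norm_mult power2_eq_square)
    then show "cmod (scal x) \<le> sqrt (unorm (star x * x))"
      using norm_scal_le[of "star x * x"] by (simp add: real_le_rsqrt)
    fix v
    have "(norm (uact x v))\<^sup>2 = norm (star (uact x v) * uact x v)" by (simp add: cstar_identity)
    also have "\<dots> = norm (star (uact (star x) (uact x v)) * v)" by (simp add: star_mult_uact)
    also have "\<dots> \<le> norm (uact (star x * x) v) * norm v"
      by (metis norm_mult_ineq norm_star uact_simps(2))
    also have "\<dots> \<le> unorm (star x * x) * norm v * norm v"
      by (intro mult_right_mono norm_uact_le) auto
    finally show "norm (uact x v) \<le> sqrt (unorm (star x * x)) * norm v"
      by (metis (no_types, lifting) abs_norm_cancel mult.assoc power2_eq_square real_le_rsqrt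
          real_sqrt_abs real_sqrt_mult)
  qed
  then have "(unorm x)\<^sup>2 \<le> (sqrt (unorm (star x * x)))\<^sup>2" by (intro power_mono unorm_nonneg)
  then show ?thesis by (simp add: unorm_nonneg)
qed

lemma norm_scaleC_unitization: "norm (c *\<^sub>C x) = cmod c * norm (x :: 'a unitization)"
proof (rule antisym)
  have le: "norm (c *\<^sub>C x) \<le> cmod c * norm x" for c and x :: "'a unitization"
    unfolding norm_unitization_def
  proof (rule unorm_le)
    show "cmod (scal (c *\<^sub>C x)) \<le> cmod c * unorm x"
      by (simp add: scaleC_unitization_def norm_mult mult_left_mono norm_scal_le)
    show "norm (uact (c *\<^sub>C x) v) \<le> cmod c * unorm x * norm v" for v
      by (simp add: uact_simps norm_scaleC mult.assoc mult_left_mono norm_uact_le)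
  qed
  then show "norm (c *\<^sub>C x) \<le> cmod c * norm x" .
  show "cmod c * norm x \<le> norm (c *\<^sub>C x)"
  proof (cases "c = 0")
    case False
    have "norm (inverse c *\<^sub>C c *\<^sub>C x) \<le> cmod (inverse c) * norm (c *\<^sub>C x)" by (rule le)
    moreover have "inverse c *\<^sub>C c *\<^sub>C x = x"
      using False by (cases x) (simp add: scaleC_unitization_def scaleC_scaleC scaleC_one)
    ultimately show ?thesis using False by (simp add: norm_inverse field_simps norm_divide)
  qed (simp add: norm_unitization_def unorm_nonneg)
qed

lemma scaleR_scaleC_unitization: "r *\<^sub>R x = complex_of_real r *\<^sub>C (x :: 'a unitization)"
  by (simp add: unitization_defs scaleR_scaleC complex_eq_iff)

instance
proof
  fix x y z :: "'a unitization" and c d :: complex and r s :: real and U :: "'a unitization set"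
  show "x + y + z = x + (y + z)" "x + y = y + x" "0 + x = x" "- x + x = 0" "x - y = x + - y"
    by (simp_all add: unitization_defs)
  show "c *\<^sub>C (x + y) = c *\<^sub>C x + c *\<^sub>C y" "(c + d) *\<^sub>C x = c *\<^sub>C x + d *\<^sub>C x"
    "c *\<^sub>C d *\<^sub>C x = (c * d) *\<^sub>C x" "1 *\<^sub>C x = x"
    by (simp_all add: unitization_defs algebra_simps scaleC_add_left scaleC_add_right scaleC_scaleC
        scaleC_one)
  show "r *\<^sub>R (x + y) = r *\<^sub>R x + r *\<^sub>R y" "(r + s) *\<^sub>R x = r *\<^sub>R x + s *\<^sub>R x"
    "r *\<^sub>R s *\<^sub>R x = (r * s) *\<^sub>R x" "1 *\<^sub>R x = x"
    by (simp_all add: unitization_defs algebra_simps)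
  show "x * y * z = x * (y * z)" "(x + y) * z = x * z + y * z" "x * (y + z) = x * y + x * z"
    "r *\<^sub>R x * y = r *\<^sub>R (x * y)" "x * r *\<^sub>R y = r *\<^sub>R (x * y)" "1 * x = x" "x * 1 = x"
    by (simp_all add: unitization_defs algebra_simps scaleC_add_left scaleC_add_right scaleC_scaleC
        scaleC_one mult_scaleC_left mult_scaleC_right scaleR_scaleC scaleR_conv_of_real mult.commute)
  show "(0::'a unitization) \<noteq> 1" by (simp add: unitization_defs)
  show "sgn x = inverse (norm x) *\<^sub>R x" "dist x y = norm (x - y)"
    "uniformity = (INF e\<in>{0 <..}. principal {(x, y::'a unitization). dist x y < e})"
    "open U = (\<forall>x\<in>U. \<forall>\<^sub>F (x', y) in uniformity. x' = x \<longrightarrow> y \<in> U)"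
    by (simp_all add: sgn_unitization_def dist_unitization_def uniformity_unitization_def
        open_unitization_def)
  show "norm (x * y) \<le> norm x * norm y" by (simp add: norm_unitization_def unorm_mult)
  show n0: "norm x = 0 \<longleftrightarrow> x = 0"
  proof
    assume "norm x = 0"
    then show "x = 0" using norm_scal_le[of x] norm_elt_le[of x]
      by (cases x) (simp add: norm_unitization_def unitization_defs)
  next
    assume "x = 0"
    then show "norm x = 0" using unorm_le_add[of x] unorm_nonneg[of x]
      by (simp add: norm_unitization_def unitization_defs)
  qed
  show "norm (x + y) \<le> norm x + norm y"
    unfolding norm_unitization_def
  proof (rule unorm_le)
    show "cmod (scal (x + y)) \<le> unorm x + unorm y"
      by (simp add: plus_unitization_def norm_triangle_mono norm_scal_le)
    show "norm (uact (x + y) v) \<le> (unorm x + unorm y) * norm v" for v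
      by (simp add: uact_simps distrib_right norm_triangle_mono norm_uact_le)
  qed
  show "norm (r *\<^sub>R x) = \<bar>r\<bar> * norm x" by (simp add: scaleR_scaleC_unitization norm_scaleC_unitization)
  show "norm (1::'a unitization) = 1"
  proof (rule antisym)
    show "norm (1::'a unitization) \<le> 1" using unorm_le_add[of 1] by (simp add: norm_unitization_def unitization_defs)
    show "1 \<le> norm (1::'a unitization)" using norm_scal_le[of 1] by (simp add: norm_unitization_def unitization_defs)
  qed
qed

end

instance unitization :: (cstar_algebra) cstar_algebra
proof
  fix x y :: "'a unitization" and c :: complex and r :: real
  show "r *\<^sub>R x = complex_of_real r *\<^sub>C x" by (rule scaleR_scaleC_unitization)
  show "norm (c *\<^sub>C x) = cmod c * norm x" by (rule norm_scaleC_unitization)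
  show "c *\<^sub>C x * y = c *\<^sub>C (x * y)" "x * c *\<^sub>C y = c *\<^sub>C (x * y)"
    by (simp_all add: unitization_defs algebra_simps scaleC_add_left scaleC_add_right scaleC_scaleC
        mult_scaleC_left mult_scaleC_right)
  show "star (x + y) = star x + star y" "star (c *\<^sub>C x) = cnj c *\<^sub>C star x"
    "star (x * y) = star y * star x" "star (star x) = x"
    by (simp_all add: unitization_defs star_add star_scaleC star_mult star_star algebra_simps)
  show "norm (star x * x) = (norm x)\<^sup>2"
  proof (rule antisym)
    have le: "norm x \<le> norm (star x)" if "norm x \<noteq> 0" for x :: "'a unitization"
    proof -
      have "norm x * norm x \<le> norm (star x) * norm x"
        using unorm_square_le[of x] unorm_mult[of "star x" x]
        by (simp add: norm_unitization_def power2_eq_square)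
      moreover have "0 < norm x" using that unorm_nonneg[of x] by (simp add: norm_unitization_def)
      ultimately show ?thesis by simp
    qed
    have ss: "star (star x) = x" by (simp add: unitization_defs star_star)
    have "norm (star x) \<le> norm x"
    proof (cases "norm (star x) = 0")
      case True
      then show ?thesis by (simp add: norm_unitization_def unorm_nonneg)
    next
      case False
      then show ?thesis using le[of "star x"] ss by simp
    qed
    then have "norm (star x) * norm x \<le> norm x * norm x"
      by (intro mult_right_mono) (auto simp: norm_unitization_def unorm_nonneg)
    then show "norm (star x * x) \<le> (norm x)\<^sup>2"
      using unorm_mult[of "star x" x] by (simp add: norm_unitization_def power2_eq_square)
    show "(norm x)\<^sup>2 \<le> norm (star x * x)" using unorm_square_le by (simp add: norm_unitization_def)
  qed
  fix X :: "nat \<Rightarrow> 'a unitization"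
  assume X: "Cauchy X"
  have "Cauchy (\<lambda>n. scal (X n))"
  proof (rule metric_CauchyI)
    fix e :: real assume "e > 0"
    then obtain M where M: "\<And>m n. m \<ge> M \<Longrightarrow> n \<ge> M \<Longrightarrow> dist (X m) (X n) < e"
      using metric_CauchyD[OF X] by blast
    have "dist (scal (X m)) (scal (X n)) < e" if "m \<ge> M" "n \<ge> M" for m n
      using M[OF that] norm_scal_le[of "X m - X n"]
      by (simp add: dist_unitization_def norm_unitization_def dist_norm minus_unitization_def)
    then show "\<exists>M. \<forall>m\<ge>M. \<forall>n\<ge>M. dist (scal (X m)) (scal (X n)) < e" by blast
  qed
  then obtain c where c: "(\<lambda>n. scal (X n)) \<longlonglongrightarrow> c" using Cauchy_convergent convergent_def by blast
  have "Cauchy (\<lambda>n. elt (X n))"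
  proof (rule metric_CauchyI)
    fix e :: real assume "e > 0"
    then obtain M where M: "\<And>m n. m \<ge> M \<Longrightarrow> n \<ge> M \<Longrightarrow> dist (X m) (X n) < e / 2"
      using metric_CauchyD[OF X, of "e/2"] by auto
    have "dist (elt (X m)) (elt (X n)) < e" if "m \<ge> M" "n \<ge> M" for m n
      using M[OF that] norm_elt_le[of "X m - X n"]
      by (simp add: dist_unitization_def norm_unitization_def dist_norm minus_unitization_def)
    then show "\<exists>M. \<forall>m\<ge>M. \<forall>n\<ge>M. dist (elt (X m)) (elt (X n)) < e" by blast
  qed
  then obtain a where a: "(\<lambda>n. elt (X n)) \<longlonglongrightarrow> a" using Cauchy_convergent convergent_def by blast
  have "(\<lambda>n. cmod (scal (X n) - c) + norm (elt (X n) - a)) \<longlonglongrightarrow> 0"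
    using tendsto_add[OF tendsto_norm_zero[OF LIM_zero[OF c]] tendsto_norm_zero[OF LIM_zero[OF a]]]
    by simp
  then have "(\<lambda>n. dist (X n) (Unitization c a)) \<longlonglongrightarrow> 0"
  proof (rule tendsto_sandwich[OF _ _ tendsto_const, rotated 2])
    show "\<forall>\<^sub>F n in sequentially. dist (X n) (Unitization c a) \<le> cmod (scal (X n) - c) + norm (elt (X n) - a)"
      using unorm_le_add[of "X _ - Unitization c a"]
      by (auto simp: dist_unitization_def norm_unitization_def minus_unitization_def)
  qed (auto simp: dist_unitization_def norm_unitization_def unorm_nonneg)
  then have "X \<longlonglongrightarrow> Unitization c a" by (subst tendsto_dist_iff)
  then show "convergent X" by (auto simp: convergent_def)
qed

definition unitize :: "'a::cstar_algebra \<Rightarrow> 'a unitization" where "unitize a = Unitization 0 a"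

lemma unitize_simps:
  "unitize (a + b) = unitize a + unitize b" "unitize (a - b) = unitize a - unitize b"
  "unitize (a * b) = unitize a * unitize b" "unitize (star a) = star (unitize a)"
  "unitize (r *\<^sub>R a) = r *\<^sub>R unitize a" "unitize (c *\<^sub>C a) = c *\<^sub>C unitize a"
  by (simp_all add: unitize_def unitization_defs)

lemma norm_unitize [simp]: "norm (unitize a) = norm a"
proof (rule antisym)
  show "norm (unitize a) \<le> norm a"
    using unorm_le_add[of "unitize a"] by (simp add: norm_unitization_def unitize_def)
  show "norm a \<le> norm (unitize a)"
  proof (rule norm_le_if_mult_le)
    show "norm (a * x) \<le> norm (unitize a) * norm x" for x
      using norm_uact_le[of "unitize a" x] by (simp add: norm_unitization_def unitize_def uact_def)
  qed simp
qed

text \<open>Connects positivity as a product b* b, which is what the axioms of Hilbert modules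
  provide, with the norm criterion.\<close>

lemma cpos_unitize: "cstar_positive b \<Longrightarrow> cpos (unitize b)"
  using cpos_star_mult_self by (auto simp: cstar_positive_def unitize_simps)

section \<open>Consequences for nonunital algebras\<close>

lemma cstar_positive_norm_diff_le:
  assumes "cstar_positive b" "norm b \<le> t"
  shows "norm (t *\<^sub>R x - b * x) \<le> t * norm x"
proof -
  have "norm (of_real t - unitize b) \<le> t"
    using assms by (intro cpos_norm_of_real_diff_le cpos_unitize) auto
  then have "norm ((of_real t - unitize b) * unitize x) \<le> t * norm x"
    by (intro norm_mult_le) auto
  moreover have "(of_real t - unitize b) * unitize x = unitize (t *\<^sub>R x - b * x)"
    by (simp add: unitize_simps of_real_def algebra_simps)
  ultimately show ?thesis by simp
qed

text \<open>Cauchy-Schwarz with \<alpha> = <x,x>, \<beta> = <y,y> and a = <x,y>. The positivity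
  hypothesis expresses that the inner square of s x a - y is positive.\<close>

lemma cstar_cauchy_schwarz:
  fixes \<alpha> \<beta> a :: "'a::cstar_algebra"
  assumes \<alpha>: "cstar_positive \<alpha>"
    and pos: "\<And>s. cstar_positive (s\<^sup>2 *\<^sub>R (star a * \<alpha> * a) - (2 * s) *\<^sub>R (star a * a) + \<beta>)"
  shows "(norm a)\<^sup>2 \<le> norm \<alpha> * norm \<beta>"
proof -
  have le: "(norm a)\<^sup>2 \<le> (norm \<alpha> + \<eta>) * norm \<beta>" if "0 < \<eta>" for \<eta>
  proof -
    define N where "N = norm \<alpha> + \<eta>"
    have N: "N > 0" using that by (simp add: N_def add_nonneg_pos)
    let ?a = "unitize a" and ?\<alpha> = "unitize \<alpha>"
    have "cpos (of_real (norm \<alpha>) - ?\<alpha>)"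
      using cpos_unitize[OF \<alpha>] by (intro cpos_of_real_diff) (auto simp: cpos_def)
    then obtain f where f: "cpos f" "f * f = of_real (norm \<alpha>) - ?\<alpha> + of_real \<eta>"
      using cpos_sqrt \<open>0 < \<eta>\<close> by metis
    have ff: "f * f = N *\<^sub>R 1 - ?\<alpha>" by (simp add: f(2) N_def of_real_def scaleR_left_distrib)
    have fa: "star (f * ?a) * (f * ?a) = N *\<^sub>R (star ?a * ?a) - star ?a * ?\<alpha> * ?a"
    proof -
      have "star (f * ?a) * (f * ?a) = star ?a * (f * f) * ?a"
        using f(1) by (simp add: cpos_def star_mult mult.assoc)
      then show ?thesis by (simp add: ff algebra_simps)
    qed
    \<comment> \<open>With s = 1/N the coefficients 1/N - 2/N + 1/N of a* a cancel, and so do the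
      terms with a* \<alpha> a; the positive terms then add up to \<beta>. The element
      \<open>f\<close> witnesses \<alpha> \<le> N.\<close>
    have "cpos ((1/N) *\<^sub>R (star ?a * ?a))"
      using N by (intro cpos_scaleR cpos_star_mult_self) auto
    moreover have "cpos (unitize ((1/N)\<^sup>2 *\<^sub>R (star a * \<alpha> * a) - (2 * (1/N)) *\<^sub>R (star a * a) + \<beta>)
        + (1/N)\<^sup>2 *\<^sub>R (star (f * ?a) * (f * ?a)))"
      by (intro cpos_add cpos_scaleR cpos_unitize pos cpos_star_mult_self) auto
    ultimately have "norm ((1/N) *\<^sub>R (star ?a * ?a)) \<le> norm ((1/N) *\<^sub>R (star ?a * ?a) +
        (unitize ((1/N)\<^sup>2 *\<^sub>R (star a * \<alpha> * a) - (2 * (1/N)) *\<^sub>R (star a * a) + \<beta>)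
        + (1/N)\<^sup>2 *\<^sub>R (star (f * ?a) * (f * ?a))))"
      by (rule cpos_norm_add_le)
    also have "(1/N) *\<^sub>R (star ?a * ?a) +
        (unitize ((1/N)\<^sup>2 *\<^sub>R (star a * \<alpha> * a) - (2 * (1/N)) *\<^sub>R (star a * a) + \<beta>)
        + (1/N)\<^sup>2 *\<^sub>R (star (f * ?a) * (f * ?a))) = unitize \<beta>"
      unfolding fa using N
      by (simp add: unitize_simps scaleR_diff_right power2_eq_square
          flip: scaleR_left_distrib scaleR_left_diff_distrib)
    finally have "(norm a)\<^sup>2 / N \<le> norm \<beta>" using N by (simp add: cstar_identity)
    then show ?thesis using N by (simp add: N_def divide_simps mult.commute)
  qed
  show ?thesis
  proof (rule field_le_epsilon)
    fix e :: real assume e: "e > 0"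
    define \<eta> where "\<eta> = e / (norm \<beta> + 1)"
    have "\<eta> > 0" using e by (simp add: \<eta>_def add_nonneg_pos)
    moreover have "\<eta> * norm \<beta> \<le> e"
      using e by (simp add: \<eta>_def divide_simps add_nonneg_pos)
    ultimately show "(norm a)\<^sup>2 \<le> norm \<alpha> * norm \<beta> + e"
      using le[of \<eta>] by (simp add: distrib_right)
  qed
qed

text \<open>The expression is (1 - d) b (1 - d), multiplied out. The element d = b (b +
  \<epsilon>/2)^{-1} is found as the solution of (\<epsilon>/2) d = b - b d, by the contraction d
  \<mapsto> (b + (t - b) d) / T with t = norm b. It contracts because positivity of \<open>b\<close>
  gives norm (t - b) \<le> t.\<close>

lemma approx_unit:
  fixes b :: "'a::cstar_algebra"
  assumes b: "cstar_positive b" and \<epsilon>: "0 < \<epsilon>"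
  obtains d where "star d = d" "norm (b - d * b - (b - d * b) * d) \<le> \<epsilon>"
proof -
  define t where "t = norm b"
  define T where "T = t + \<epsilon> / 2"
  have T: "0 \<le> t" "t < T" "0 < T" using \<epsilon> by (auto simp: T_def t_def add_nonneg_pos)
  have sb: "star b = b" using b by (auto simp: cstar_positive_def star_mult star_star)
  have tb: "norm (t *\<^sub>R x - b * x) \<le> t * norm x" for x
    using cstar_positive_norm_diff_le[OF b] by (simp add: t_def)
  define f where "f d = (1/T) *\<^sub>R (b + (t *\<^sub>R d - b * d))" for d
  \<comment> \<open>The last condition expresses norm (1 - d) \<le> 1 without a unit.\<close>
  define S where "S = {d. star d = d} \<inter> {d. b * d = d * b} \<inter> (\<Inter>x. {d. norm (x - d * x) \<le> norm x})"
  have "closed {d. star d = (d::'a)}"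
    by (intro closed_Collect_eq continuous_intros linear_continuous_on bounded_linear_star)
  moreover have "closed {d. b * d = d * b}"
    by (intro closed_Collect_eq continuous_intros)
  moreover have "closed {d. norm (x - d * x) \<le> norm x}" for x :: 'a
    by (intro closed_Collect_le continuous_intros)
  ultimately have "closed S" by (auto simp: S_def)
  then have "complete S" by (simp add: complete_eq_closed)
  moreover have "0 \<in> S" by (simp add: S_def)
  moreover have "f ` S \<subseteq> S"
  proof clarify
    fix d assume d: "d \<in> S"
    have sd: "star d = d" and bd: "b * d = d * b" and xd: "\<And>x. norm (x - d * x) \<le> norm x"
      using d by (auto simp: S_def)
    have "star (f d) = f d"
      by (simp add: f_def star_scaleR star_add star_diff star_mult sb sd bd)
    moreover have "b * (b * d) = b * d * b" by (metis bd mult.assoc)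
    then have "b * f d = f d * b"
      using bd by (simp add: f_def distrib_left distrib_right left_diff_distrib right_diff_distrib)
    moreover have "norm (x - f d * x) \<le> norm x" for x
    proof -
      have "T *\<^sub>R (x - f d * x) = (\<epsilon> / 2) *\<^sub>R x + (t *\<^sub>R (x - d * x) - b * (x - d * x))"
        using T by (simp add: f_def algebra_simps) (simp add: T_def algebra_simps)
      also have "norm \<dots> \<le> (\<epsilon> / 2) * norm x + t * norm x"
        using T \<epsilon> by (intro norm_triangle_mono order_trans[OF tb] mult_left_mono xd) auto
      finally have "T * norm (x - f d * x) \<le> (\<epsilon> / 2) * norm x + t * norm x" using T by simp
      also have "\<dots> = T * norm x" by (simp add: T_def algebra_simps)
      finally have "T * norm (x - f d * x) \<le> T * norm x" .
      then show ?thesis using T by simp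
    qed
    ultimately show "f d \<in> S" by (simp add: S_def)
  qed
  moreover have "dist (f d) (f d') \<le> t / T * dist d d'" for d d'
  proof -
    have "f d - f d' = (1/T) *\<^sub>R (t *\<^sub>R (d - d') - b * (d - d'))"
      by (simp add: f_def algebra_simps)
    then show ?thesis using tb[of "d - d'"] T by (simp add: dist_norm divide_right_mono)
  qed
  ultimately have "\<exists>!d\<in>S. f d = d"
    using T by (intro Banach_fix[of S "t / T" f]) auto
  then obtain d where d: "d \<in> S" "f d = d" by blast
  have sd: "star d = d" and bd: "b * d = d * b" and xd: "\<And>x. norm (x - d * x) \<le> norm x"
    using d by (auto simp: S_def)
  have "T *\<^sub>R f d = b + (t *\<^sub>R d - b * d)" using T by (simp add: f_def)
  then have eq: "(\<epsilon> / 2) *\<^sub>R d = b - d * b"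
    using d by (simp add: T_def algebra_simps bd)
  have "norm d \<le> 2"
  proof (rule norm_le_if_mult_le)
    fix x
    have "d * x = x - (x - d * x)" by simp
    then have "norm (d * x) \<le> norm x + norm (x - d * x)" by (metis norm_triangle_ineq4)
    with xd[of x] show "norm (d * x) \<le> 2 * norm x" by linarith
  qed simp
  have "b - d * b - (b - d * b) * d = (\<epsilon> / 2) *\<^sub>R (d - d * d)"
    by (simp flip: eq add: algebra_simps)
  also have "norm \<dots> \<le> (\<epsilon> / 2) * 2"
    using \<epsilon> xd[of d] \<open>norm d \<le> 2\<close> by simp
  finally show thesis using sd that by simp
qed

section \<open>Hilbert modules\<close>

text \<open>An upper bound for the operator norm. Working with bounds avoids forming suprema, and an
  adjointable operator need not be known to be bounded.\<close>

definition op_le :: "('a::cstar_algebra, 'x::complex_vector) bimod \<Rightarrow> ('x \<Rightarrow> 'x) \<Rightarrow> real \<Rightarrow> bool" where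
  "op_le X S c \<longleftrightarrow> (\<forall>z\<in>car X. hnorm X (S z) \<le> c * hnorm X z)"

lemma op_leD: "op_le X S c \<Longrightarrow> z \<in> car X \<Longrightarrow> hnorm X (S z) \<le> c * hnorm X z"
  by (simp add: op_le_def)

lemma hnorm_nonneg [simp]: "0 \<le> hnorm X x"
  by (simp add: hnorm_def)

lemma hnorm_square: "(hnorm X x)\<^sup>2 = norm (inn X x x)"
  by (simp add: hnorm_def)

lemma op_le_mono: "op_le X S c \<Longrightarrow> c \<le> d \<Longrightarrow> op_le X S d"
  unfolding op_le_def by (meson hnorm_nonneg mult_right_mono order_trans)

definition finrank :: "('a::cstar_algebra, 'x::complex_vector) bimod \<Rightarrow> ('x \<Rightarrow> 'x) set" where
  "finrank X = complex_vector.span {rank_one X x y | x y. x \<in> car X \<and> y \<in> car X}"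

lemma compacts_iff:
  "T \<in> compacts X \<longleftrightarrow> T \<in> adjointable X \<and> (\<forall>\<epsilon>>0. \<exists>S\<in>finrank X. op_le X (T - S) \<epsilon>)"
  by (simp add: compacts_def finrank_def op_le_def)

context hilbert_module
begin

lemmas car_simps [simp] = complex_vector.subspace_0[OF subspace]
  complex_vector.subspace_add[OF subspace] complex_vector.subspace_diff[OF subspace]
  complex_vector.subspace_scale[OF subspace] complex_vector.subspace_neg[OF subspace] ract_closed

lemma car_funpow: "(\<And>x. x \<in> car X \<Longrightarrow> f x \<in> car X) \<Longrightarrow> x \<in> car X \<Longrightarrow> (f ^^ n) x \<in> car X"
  by (induction n) auto

lemma inn_add_left: "x \<in> car X \<Longrightarrow> y \<in> car X \<Longrightarrow> z \<in> car X \<Longrightarrow> inn X (x + y) z = inn X x z + inn X y z"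
  using inn_star[of z "x + y"] by (simp add: inn_add star_add inn_star)

lemma inn_scaleC_left: "x \<in> car X \<Longrightarrow> y \<in> car X \<Longrightarrow> inn X (c *\<^sub>C x) y = cnj c *\<^sub>C inn X x y"
  using inn_star[of y "c *\<^sub>C x"] by (simp add: inn_scaleC star_scaleC inn_star)

lemma inn_zero [simp]:
  assumes "x \<in> car X" shows "inn X x 0 = 0" "inn X 0 x = 0"
  using inn_scaleC[of x 0 0] inn_scaleC_left[of 0 x 0] assms by simp_all

lemma inn_minus: "x \<in> car X \<Longrightarrow> y \<in> car X \<Longrightarrow> inn X x (- y) = - inn X x y"
  using inn_scaleC[of x y "-1"] by (simp add: scaleC_minus_one)

lemma inn_minus_left: "x \<in> car X \<Longrightarrow> y \<in> car X \<Longrightarrow> inn X (- x) y = - inn X x y"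
  using inn_scaleC_left[of x y "-1"] by (simp add: scaleC_minus_one)

lemma inn_diff: "x \<in> car X \<Longrightarrow> y \<in> car X \<Longrightarrow> z \<in> car X \<Longrightarrow> inn X x (y - z) = inn X x y - inn X x z"
  using inn_add[of x y "- z"] by (simp add: inn_minus)

lemma inn_diff_left: "x \<in> car X \<Longrightarrow> y \<in> car X \<Longrightarrow> z \<in> car X \<Longrightarrow> inn X (x - y) z = inn X x z - inn X y z"
  using inn_add_left[of x "- y" z] by (simp add: inn_minus_left)

lemma inn_ract_left: "x \<in> car X \<Longrightarrow> y \<in> car X \<Longrightarrow> inn X (ract X x a) y = star a * inn X x y"
  using inn_star[of y "ract X x a"] by (simp add: inn_ract star_mult inn_star)

lemmas inn_simps = inn_add inn_add_left inn_scaleC inn_scaleC_left inn_minus inn_minus_left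
  inn_diff inn_diff_left inn_ract inn_ract_left

lemma eq_zero_if_inn: "x \<in> car X \<Longrightarrow> (\<And>y. y \<in> car X \<Longrightarrow> inn X x y = 0) \<Longrightarrow> x = 0"
  using inn_definite by blast

lemma eq_if_inn:
  assumes "x \<in> car X" "y \<in> car X" "\<And>z. z \<in> car X \<Longrightarrow> inn X x z = inn X y z"
  shows "x = y"
  using eq_zero_if_inn[of "x - y"] assms by (simp add: inn_diff_left)

lemma ract_zero [simp]: "x \<in> car X \<Longrightarrow> ract X x 0 = 0" "ract X 0 a = 0"
  using ract_scaleC_right[of x 0 0] ract_scaleC_left[of 0 0 a] by simp_all

lemma ract_diff_left: "x \<in> car X \<Longrightarrow> y \<in> car X \<Longrightarrow> ract X (x - y) a = ract X x a - ract X y a"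
  using ract_add_left[of "x - y" y a] by (simp add: eq_diff_eq)

theorem cauchy_schwarz:
  assumes "x \<in> car X" "y \<in> car X"
  shows "norm (inn X x y) \<le> hnorm X x * hnorm X y"
proof -
  define a where "a = inn X x y"
  have "(norm a)\<^sup>2 \<le> norm (inn X x x) * norm (inn X y y)"
  proof (rule cstar_cauchy_schwarz)
    show "cstar_positive (inn X x x)" using assms inn_positive by blast
    fix s :: real
    let ?w = "ract X x (s *\<^sub>R a) - y"
    have sa: "star a = inn X y x" using assms by (simp add: a_def inn_star)
    have "inn X ?w ?w = s\<^sup>2 *\<^sub>R (star a * inn X x x * a) - (2 * s) *\<^sub>R (star a * a) + inn X y y"
      using assms by (simp add: inn_simps star_scaleR algebra_simps power2_eq_square
          flip: a_def sa) (simp flip: scaleR_left_distrib)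
    then show "cstar_positive (s\<^sup>2 *\<^sub>R (star a * inn X x x * a) - (2 * s) *\<^sub>R (star a * a) + inn X y y)"
      using assms inn_positive[of ?w] by simp
  qed
  then have "(norm a)\<^sup>2 \<le> (hnorm X x * hnorm X y)\<^sup>2"
    by (simp add: power_mult_distrib hnorm_square)
  then show ?thesis unfolding a_def by (rule power2_le_imp_le) simp
qed

lemma hnorm_triangle:
  assumes "x \<in> car X" "y \<in> car X"
  shows "hnorm X (x + y) \<le> hnorm X x + hnorm X y"
proof (rule power2_le_imp_le)
  have "(hnorm X (x + y))\<^sup>2 = norm ((inn X x x + inn X x y) + (inn X y x + inn X y y))"
    using assms by (simp add: hnorm_square inn_simps algebra_simps)
  also have "\<dots> \<le> (hnorm X x * hnorm X x + hnorm X x * hnorm X y) + (hnorm X y * hnorm X x + hnorm X y * hnorm X y)"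
    using assms by (intro norm_triangle_mono cauchy_schwarz)
  also have "\<dots> = (hnorm X x + hnorm X y)\<^sup>2" by (simp add: power2_eq_square algebra_simps)
  finally show "(hnorm X (x + y))\<^sup>2 \<le> (hnorm X x + hnorm X y)\<^sup>2" .
qed simp

lemma hnorm_scaleC: "x \<in> car X \<Longrightarrow> hnorm X (c *\<^sub>C x) = cmod c * hnorm X x"
  by (simp add: hnorm_def inn_simps norm_scaleC norm_mult real_sqrt_mult)

lemma hnorm_minus: "x \<in> car X \<Longrightarrow> hnorm X (- x) = hnorm X x"
  using hnorm_scaleC[of x "-1"] by (simp add: scaleC_minus_one)

lemma hnorm_minus_commute: "x \<in> car X \<Longrightarrow> y \<in> car X \<Longrightarrow> hnorm X (x - y) = hnorm X (y - x)"
  using hnorm_minus[of "x - y"] by simp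

lemma hnorm_triangle_diff: "x \<in> car X \<Longrightarrow> y \<in> car X \<Longrightarrow> hnorm X (x - y) \<le> hnorm X x + hnorm X y"
  using hnorm_triangle[of x "- y"] by (simp add: hnorm_minus)

lemma hnorm_diff_trans:
  "x \<in> car X \<Longrightarrow> y \<in> car X \<Longrightarrow> z \<in> car X \<Longrightarrow> hnorm X (x - z) \<le> hnorm X (x - y) + hnorm X (y - z)"
  using hnorm_triangle[of "x - y" "y - z"] by simp

lemma hnorm_zero [simp]: "hnorm X 0 = 0"
  by (simp add: hnorm_def)

lemma hnorm_eq_zero: "x \<in> car X \<Longrightarrow> hnorm X x = 0 \<Longrightarrow> x = 0"
  using inn_definite by (simp add: hnorm_def)

lemma hnorm_ract_le: "x \<in> car X \<Longrightarrow> hnorm X (ract X x a) \<le> hnorm X x * norm a"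
proof (rule power2_le_imp_le)
  assume x: "x \<in> car X"
  have "(hnorm X (ract X x a))\<^sup>2 = norm (star a * inn X x x * a)"
    using x by (simp add: hnorm_square inn_simps mult.assoc)
  also have "\<dots> \<le> norm (star a) * norm (inn X x x) * norm a" by (intro norm_mult_le) auto
  also have "\<dots> = (hnorm X x * norm a)\<^sup>2" by (simp add: power2_eq_square flip: hnorm_square)
  finally show "(hnorm X (ract X x a))\<^sup>2 \<le> (hnorm X x * norm a)\<^sup>2" .
qed simp

lemma inn_tendsto:
  assumes "\<And>n. u n \<in> car X" "l \<in> car X" "y \<in> car X" and lim: "(\<lambda>n. hnorm X (u n - l)) \<longlonglongrightarrow> 0"
  shows "(\<lambda>n. inn X (u n) y) \<longlonglongrightarrow> inn X l y" "(\<lambda>n. inn X y (u n)) \<longlonglongrightarrow> inn X y l"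
proof -
  have "(\<lambda>n. inn X (u n - l) y) \<longlonglongrightarrow> 0" "(\<lambda>n. inn X y (u n - l)) \<longlonglongrightarrow> 0"
    using assms cauchy_schwarz[of "u _ - l" y] cauchy_schwarz[of y "u _ - l"]
    by (auto intro!: Lim_null_comparison[OF _ tendsto_mult_left_zero[OF lim]] eventuallyI
        simp: mult.commute)
  then show "(\<lambda>n. inn X (u n) y) \<longlonglongrightarrow> inn X l y" "(\<lambda>n. inn X y (u n)) \<longlonglongrightarrow> inn X y l"
    using assms by (simp_all add: inn_simps LIM_zero_iff)
qed

lemma hnorm_tendsto_le:
  assumes "\<And>n. u n \<in> car X" "l \<in> car X" "(\<lambda>n. hnorm X (u n - l)) \<longlonglongrightarrow> 0"
    and "\<And>n. hnorm X (u n) \<le> c n" "c \<longlonglongrightarrow> d"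
  shows "hnorm X l \<le> d"
proof (rule LIMSEQ_le_const[where X = "\<lambda>n. hnorm X (u n - l) + c n"])
  show "(\<lambda>n. hnorm X (u n - l) + c n) \<longlonglongrightarrow> d"
    using tendsto_add[OF assms(3,5)] by simp
  have "hnorm X l \<le> hnorm X (u n - l) + c n" for n
    using hnorm_triangle_diff[of "u n" "u n - l"] assms(1)[of n] assms(2) assms(4)[of n] by simp
  then show "\<exists>N. \<forall>n\<ge>N. hnorm X l \<le> hnorm X (u n - l) + c n" by blast
qed

text \<open>The square of the norm of x - x d is the norm of (1 - d) <x,x> (1 - d). This replaces a
  factorization of \<open>x\<close> through the right action.\<close>

lemma right_approx_unit:
  assumes x: "x \<in> car X" and \<epsilon>: "0 < \<epsilon>"
  obtains a where "hnorm X (x - ract X x a) \<le> \<epsilon>"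
proof -
  let ?b = "inn X x x"
  obtain d where d: "star d = d" "norm (?b - d * ?b - (?b - d * ?b) * d) \<le> \<epsilon>\<^sup>2"
    using approx_unit[of ?b "\<epsilon>\<^sup>2"] inn_positive[OF x] \<epsilon> by auto
  have "(hnorm X (x - ract X x d))\<^sup>2 = norm (?b - d * ?b - (?b - d * ?b) * d)"
    using x by (simp add: hnorm_square inn_simps d(1) algebra_simps)
  with d have "(hnorm X (x - ract X x d))\<^sup>2 \<le> \<epsilon>\<^sup>2" by simp
  then have "hnorm X (x - ract X x d) \<le> \<epsilon>" by (rule power2_le_imp_le) (use \<epsilon> in simp)
  then show ?thesis by (rule that)
qed

section \<open>Adjointable operators\<close>

lemma adjoint_pair_car:
  assumes "adjoint_pair X S T" "x \<in> car X" shows "S x \<in> car X" "T x \<in> car X"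
  using assms by (auto simp: adjoint_pair_def)

lemma adjoint_pair_off: "adjoint_pair X S T \<Longrightarrow> x \<notin> car X \<Longrightarrow> S x = 0"
  by (auto simp: adjoint_pair_def)

lemma adjoint_pairD: "adjoint_pair X S T \<Longrightarrow> x \<in> car X \<Longrightarrow> y \<in> car X \<Longrightarrow> inn X (S x) y = inn X x (T y)"
  by (auto simp: adjoint_pair_def)

lemma adjoint_pair_sym: "adjoint_pair X S T \<Longrightarrow> adjoint_pair X T S"
  unfolding adjoint_pair_def by (metis inn_star)

lemma adjoint_pair_unique:
  assumes "adjoint_pair X S T" "adjoint_pair X S T'"
  shows "T = T'"
proof
  fix x
  show "T x = T' x"
  proof (cases "x \<in> car X")
    case True
    with adjoint_pairD[OF adjoint_pair_sym[OF assms(1)]] adjoint_pairD[OF adjoint_pair_sym[OF assms(2)]]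
      adjoint_pair_car(2)[OF assms(1)] adjoint_pair_car(2)[OF assms(2)]
    show ?thesis by (intro eq_if_inn) auto
  qed (use assms in \<open>auto simp: adjoint_pair_def\<close>)
qed

lemma adj_eq: "adjoint_pair X S T \<Longrightarrow> adj X S = T"
  unfolding adj_def using adjoint_pair_unique by blast

lemma adjoint_pair_adj: "S \<in> adjointable X \<Longrightarrow> adjoint_pair X S (adj X S)"
  using adj_eq by (auto simp: adjointable_def)

lemma adjointableI: "adjoint_pair X S T \<Longrightarrow> S \<in> adjointable X"
  by (auto simp: adjointable_def)

lemma adjointable_car [simp]: "S \<in> adjointable X \<Longrightarrow> x \<in> car X \<Longrightarrow> S x \<in> car X"
  using adjoint_pair_adj adjoint_pair_car by blast

lemma adjointable_off: "S \<in> adjointable X \<Longrightarrow> x \<notin> car X \<Longrightarrow> S x = 0"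
  using adjoint_pair_adj adjoint_pair_off by blast

lemma adjointable_eqI:
  assumes "S \<in> adjointable X" "T \<in> adjointable X" "\<And>x. x \<in> car X \<Longrightarrow> S x = T x"
  shows "S = T"
  using assms adjointable_off by (metis ext)

lemma adjointable_linear:
  assumes S: "S \<in> adjointable X" and x: "x \<in> car X"
  shows "y \<in> car X \<Longrightarrow> S (x + y) = S x + S y" "S (c *\<^sub>C x) = c *\<^sub>C S x" "S (ract X x a) = ract X (S x) a"
    "S 0 = 0" "y \<in> car X \<Longrightarrow> S (x - y) = S x - S y"
proof -
  note S' = adjoint_pair_adj[OF S]
  show "S (x + y) = S x + S y" if "y \<in> car X" for y
    using that x S by (intro eq_if_inn) (simp_all add: adjoint_pairD[OF S'] inn_simps adjoint_pair_car[OF S'])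
  show "S (c *\<^sub>C x) = c *\<^sub>C S x" "S (ract X x a) = ract X (S x) a"
    using x S by (auto intro!: eq_if_inn simp: adjoint_pairD[OF S'] inn_simps adjoint_pair_car[OF S'])
  show "S 0 = 0" using S by (intro eq_if_inn) (simp_all add: adjoint_pairD[OF S'] adjoint_pair_car[OF S'])
  show "S (x - y) = S x - S y" if "y \<in> car X"
    using that x S by (intro eq_if_inn) (simp_all add: adjoint_pairD[OF S'] inn_simps adjoint_pair_car[OF S'])
qed

lemma adjoint_pair_zero: "adjoint_pair X 0 0"
  by (simp add: adjoint_pair_def)

lemma adjoint_pair_add:
  "adjoint_pair X S T \<Longrightarrow> adjoint_pair X S' T' \<Longrightarrow> adjoint_pair X (S + S') (T + T')"
  by (auto simp: adjoint_pair_def inn_simps)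

lemma adjoint_pair_scaleC:
  "adjoint_pair X S T \<Longrightarrow> adjoint_pair X (c *\<^sub>C S) (cnj c *\<^sub>C T)"
  by (auto simp: adjoint_pair_def inn_simps scaleC_fun_def)

lemma adjoint_pair_diff:
  "adjoint_pair X S T \<Longrightarrow> adjoint_pair X S' T' \<Longrightarrow> adjoint_pair X (S - S') (T - T')"
  by (auto simp: adjoint_pair_def inn_simps)

lemma adjoint_pair_comp:
  assumes "adjoint_pair X S T" "adjoint_pair X S' T'"
  shows "adjoint_pair X (S \<circ> S') (T' \<circ> T)"
proof -
  \<comment> \<open>Off the carrier the inner factor returns 0, which lies in the carrier, and the
    composite has to vanish there too.\<close>
  have "S 0 = 0" "T' 0 = 0"
    using assms adjointable_linear(4)[of _ 0] adjointableI adjoint_pair_sym by (metis car_simps(1))+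
  with assms show ?thesis by (auto simp: adjoint_pair_def)
qed

lemma adjointable_simps [simp]:
  "0 \<in> adjointable X"
  "S \<in> adjointable X \<Longrightarrow> T \<in> adjointable X \<Longrightarrow> S + T \<in> adjointable X"
  "S \<in> adjointable X \<Longrightarrow> T \<in> adjointable X \<Longrightarrow> S - T \<in> adjointable X"
  "S \<in> adjointable X \<Longrightarrow> c *\<^sub>C S \<in> adjointable X"
  "S \<in> adjointable X \<Longrightarrow> T \<in> adjointable X \<Longrightarrow> S \<circ> T \<in> adjointable X"
  "S \<in> adjointable X \<Longrightarrow> adj X S \<in> adjointable X"
  using adjoint_pair_adj adjoint_pair_zero adjoint_pair_add adjoint_pair_diff adjoint_pair_scaleC
    adjoint_pair_comp adjoint_pair_sym adjointableI by meson+

lemma adj_simps: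
  assumes "S \<in> adjointable X"
  shows "T \<in> adjointable X \<Longrightarrow> adj X (S + T) = adj X S + adj X T"
    "T \<in> adjointable X \<Longrightarrow> adj X (S - T) = adj X S - adj X T"
    "T \<in> adjointable X \<Longrightarrow> adj X (S \<circ> T) = adj X T \<circ> adj X S"
    "adj X (c *\<^sub>C S) = cnj c *\<^sub>C adj X S"
    "adj X (adj X S) = S"
  using assms
  by (auto intro!: adj_eq adjoint_pair_add adjoint_pair_diff adjoint_pair_scaleC adjoint_pair_comp
      adjoint_pair_sym[OF adjoint_pair_adj] intro: adjoint_pair_adj)

lemma op_le_adjoint:
  assumes ST: "adjoint_pair X S T" and c: "op_le X S c"
  shows "op_le X T c"
  unfolding op_le_def
proof
  fix z assume z: "z \<in> car X"
  have "(hnorm X (T z))\<^sup>2 = norm (inn X (S (T z)) z)"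
    using z by (simp add: hnorm_square adjoint_pairD[OF ST] adjoint_pair_car[OF ST])
  also have "\<dots> \<le> c * hnorm X (T z) * hnorm X z"
    using z adjoint_pair_car[OF ST]
    by (intro order_trans[OF cauchy_schwarz] mult_right_mono op_leD[OF c]) auto
  finally have *: "hnorm X (T z) * hnorm X (T z) \<le> (c * hnorm X z) * hnorm X (T z)"
    by (simp add: power2_eq_square mult_ac)
  show "hnorm X (T z) \<le> c * hnorm X z"
  proof (cases "hnorm X (T z) = 0")
    case True
    \<comment> \<open>The sign of \<open>c\<close> is unknown, but \<open>c * hnorm X z\<close>
      bounds a norm.\<close>
    have "0 \<le> hnorm X (S z)" by simp
    also have "\<dots> \<le> c * hnorm X z" using op_leD[OF c z] .
    finally show ?thesis using True by simp
  next
    case False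
    then have "0 < hnorm X (T z)" using hnorm_nonneg[of X "T z"] by linarith
    with * show ?thesis by (rule mult_right_le_imp_le)
  qed
qed

lemma op_le_adj: "S \<in> adjointable X \<Longrightarrow> op_le X S c \<Longrightarrow> op_le X (adj X S) c"
  using op_le_adjoint adjoint_pair_adj by blast

lemma op_le_add:
  assumes "S \<in> adjointable X" "T \<in> adjointable X" "op_le X S c" "op_le X T d"
  shows "op_le X (S + T) (c + d)"
  unfolding op_le_def
proof
  fix z assume z: "z \<in> car X"
  have "hnorm X (S z + T z) \<le> hnorm X (S z) + hnorm X (T z)"
    using assms z by (intro hnorm_triangle) auto
  with op_leD[OF assms(3) z] op_leD[OF assms(4) z]
  show "hnorm X ((S + T) z) \<le> (c + d) * hnorm X z" by (simp add: distrib_right)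
qed

lemma op_le_scaleC: "S \<in> adjointable X \<Longrightarrow> op_le X S c \<Longrightarrow> op_le X (k *\<^sub>C S) (cmod k * c)"
  by (auto simp: op_le_def scaleC_fun_def hnorm_scaleC mult.assoc intro: mult_left_mono)

lemma op_le_diff:
  assumes "S \<in> adjointable X" "T \<in> adjointable X" "op_le X S c" "op_le X T d"
  shows "op_le X (S - T) (c + d)"
  using op_le_add[OF assms(1) adjointable_simps(4) assms(3) op_le_scaleC, OF assms(2) assms(2,4), of "-1"]
  by (simp add: scaleC_minus_one)

lemma op_le_comp:
  assumes "op_le X S c" "op_le X T d" "T \<in> adjointable X" "0 \<le> c"
  shows "op_le X (S \<circ> T) (c * d)"
  unfolding op_le_def
proof
  fix z assume z: "z \<in> car X"
  have "hnorm X (S (T z)) \<le> c * hnorm X (T z)" using assms z by (intro op_leD) auto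
  also have "\<dots> \<le> c * (d * hnorm X z)" using assms z by (intro mult_left_mono op_leD) auto
  finally show "hnorm X ((S \<circ> T) z) \<le> c * d * hnorm X z" by simp
qed

lemma op_le_all_eq_zero:
  assumes "T \<in> adjointable X" "\<And>\<epsilon>. 0 < \<epsilon> \<Longrightarrow> op_le X T \<epsilon>"
  shows "T = 0"
proof (rule adjointable_eqI)
  fix x assume x: "x \<in> car X"
  have "hnorm X (T x) \<le> 0"
  proof (rule field_le_epsilon)
    fix e :: real assume e: "e > 0"
    define \<epsilon> where "\<epsilon> = e / (hnorm X x + 1)"
    have "hnorm X x + 1 > 0" using hnorm_nonneg[of X x] by linarith
    then have "\<epsilon> > 0" "\<epsilon> * hnorm X x \<le> e" using e by (auto simp: \<epsilon>_def divide_simps)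
    then show "hnorm X (T x) \<le> 0 + e" using op_leD[OF assms(2) x] by fastforce
  qed
  then have "hnorm X (T x) = 0" using hnorm_nonneg[of X "T x"] by linarith
  then show "T x = 0 x" using hnorm_eq_zero assms x by simp
qed (use assms in auto)

section \<open>Compact operators\<close>

lemma rank_one_adjoint: "x \<in> car X \<Longrightarrow> y \<in> car X \<Longrightarrow> adjoint_pair X (rank_one X x y) (rank_one X y x)"
  by (simp add: adjoint_pair_def rank_one_def inn_simps inn_star)

lemma rank_one_adjointable [simp]: "x \<in> car X \<Longrightarrow> y \<in> car X \<Longrightarrow> rank_one X x y \<in> adjointable X"
  using rank_one_adjoint adjointableI by blast

lemma rank_one_scaleC: "x \<in> car X \<Longrightarrow> y \<in> car X \<Longrightarrow> c *\<^sub>C rank_one X x y = rank_one X (c *\<^sub>C x) y"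
  by (auto simp: rank_one_def scaleC_fun_def ract_scaleC_left)

lemma op_le_rank_one: "x \<in> car X \<Longrightarrow> y \<in> car X \<Longrightarrow> op_le X (rank_one X x y) (hnorm X x * hnorm X y)"
  unfolding op_le_def rank_one_def
  by (auto simp: mult.assoc intro!: order_trans[OF hnorm_ract_le] mult_left_mono cauchy_schwarz)

text \<open>Scalars are absorbed into the first vector of a rank-one operator, so the induction runs
  over plain sums.\<close>

lemma finrank_induct [consumes 1, case_names zero add]:
  assumes "S \<in> finrank X" and "P 0"
    and "\<And>x y S. x \<in> car X \<Longrightarrow> y \<in> car X \<Longrightarrow> S \<in> finrank X \<Longrightarrow> P S \<Longrightarrow> P (rank_one X x y + S)"
  shows "P S"
proof -
  let ?B = "{rank_one X x y | x y. x \<in> car X \<and> y \<in> car X}"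
  have "S \<in> finrank X \<and> P S"
    using assms(1) unfolding finrank_def
  proof (induction rule: complex_vector.span_induct_alt)
    case base
    then show ?case using assms(2) complex_vector.span_zero by blast
  next
    case (step c R S)
    then obtain x y where xy: "x \<in> car X" "y \<in> car X" "R = rank_one X x y" by blast
    have "c *\<^sub>C R + S \<in> complex_vector.span ?B"
      using step by (intro complex_vector.span_add complex_vector.span_scale)
        (auto intro: complex_vector.span_base)
    moreover have "P (rank_one X (c *\<^sub>C x) y + S)"
      using step xy by (intro assms(3)) (auto simp: finrank_def)
    ultimately show ?case using xy by (simp add: rank_one_scaleC finrank_def del: plus_fun_apply)
  qed
  then show ?thesis ..
qed

lemma finrank_rank_one: "x \<in> car X \<Longrightarrow> y \<in> car X \<Longrightarrow> rank_one X x y \<in> finrank X"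
  unfolding finrank_def by (rule complex_vector.span_base) blast

lemmas finrank_zero = complex_vector.span_zero[of "{rank_one X x y | x y. x \<in> car X \<and> y \<in> car X}", folded finrank_def]
lemmas finrank_add = complex_vector.span_add[of _ "{rank_one X x y | x y. x \<in> car X \<and> y \<in> car X}", folded finrank_def]
lemmas finrank_scaleC = complex_vector.span_scale[of _ "{rank_one X x y | x y. x \<in> car X \<and> y \<in> car X}", folded finrank_def]

lemma finrank_adjointable: "S \<in> finrank X \<Longrightarrow> S \<in> adjointable X"
  by (induction rule: finrank_induct) (simp_all del: plus_fun_apply zero_fun_apply)

lemma finrank_bounded: "S \<in> finrank X \<Longrightarrow> \<exists>c\<ge>0. op_le X S c"
proof (induction rule: finrank_induct)
  case (add x y S)
  then obtain c where "c \<ge> 0" "op_le X S c" by blast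
  with add have "op_le X (rank_one X x y + S) (hnorm X x * hnorm X y + c)"
    by (intro op_le_add op_le_rank_one) (auto simp: finrank_adjointable)
  with \<open>c \<ge> 0\<close> show ?case by (meson add_nonneg_nonneg hnorm_nonneg mult_nonneg_nonneg)
qed (auto simp: op_le_def)

lemma finrank_adj: "S \<in> finrank X \<Longrightarrow> adj X S \<in> finrank X"
proof (induction rule: finrank_induct)
  case zero
  then show ?case using finrank_zero adj_eq[OF adjoint_pair_zero] by metis
next
  case (add x y S)
  then have "adj X (rank_one X x y + S) \<in> finrank X"
    by (simp add: adj_simps finrank_adjointable adj_eq[OF rank_one_adjoint] finrank_add finrank_rank_one)
  then show ?case .
qed

lemma finrank_comp_left: "S \<in> finrank X \<Longrightarrow> T \<in> adjointable X \<Longrightarrow> T \<circ> S \<in> finrank X"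
proof (induction rule: finrank_induct)
  case zero
  then have "T \<circ> 0 = 0" using adjointable_linear(4)[of T 0] by (auto simp: fun_eq_iff)
  then show ?case using finrank_zero by metis
next
  case (add x y S)
  have "T \<circ> (rank_one X x y + S) = rank_one X (T x) y + (T \<circ> S)"
  proof (rule adjointable_eqI)
    fix z assume "z \<in> car X"
    with add show "(T \<circ> (rank_one X x y + S)) z = (rank_one X (T x) y + (T \<circ> S)) z"
      by (simp add: rank_one_def adjointable_linear finrank_adjointable)
  qed (use add in \<open>auto simp: finrank_adjointable\<close>)
  with add have "T \<circ> (rank_one X x y + S) \<in> finrank X"
    by (simp only: finrank_add finrank_rank_one adjointable_car)
  then show ?case .
qed

lemma compacts_adjointable [simp]: "T \<in> compacts X \<Longrightarrow> T \<in> adjointable X"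
  by (simp add: compacts_iff)

lemma compactsE:
  assumes "T \<in> compacts X" "0 < \<epsilon>"
  obtains S where "S \<in> finrank X" "op_le X (T - S) \<epsilon>"
  using assms by (auto simp: compacts_iff)

lemma finrank_compacts: "S \<in> finrank X \<Longrightarrow> S \<in> compacts X"
  by (force simp: compacts_iff finrank_adjointable op_le_def)

lemma compacts_bounded:
  assumes "T \<in> compacts X"
  obtains c where "c \<ge> 0" "op_le X T c"
proof -
  obtain S where S: "S \<in> finrank X" "op_le X (T - S) 1" using compactsE[OF assms, of 1] by auto
  obtain c where c: "c \<ge> 0" "op_le X S c" using finrank_bounded S by blast
  have "op_le X (S + (T - S)) (c + 1)"
    using S c assms by (intro op_le_add) (auto simp: finrank_adjointable)
  then show ?thesis using c that[of "c + 1"] by simp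
qed

lemma compacts_approx:
  assumes T: "T \<in> adjointable X" and *: "\<And>\<epsilon>. 0 < \<epsilon> \<Longrightarrow> \<exists>S\<in>compacts X. op_le X (T - S) \<epsilon>"
  shows "T \<in> compacts X"
  unfolding compacts_iff
proof (intro conjI allI impI T)
  fix \<epsilon> :: real assume "\<epsilon> > 0"
  then obtain S where S: "S \<in> compacts X" "op_le X (T - S) (\<epsilon> / 2)" using *[of "\<epsilon> / 2"] by auto
  then obtain R where R: "R \<in> finrank X" "op_le X (S - R) (\<epsilon> / 2)"
    using compactsE[of S "\<epsilon> / 2"] \<open>\<epsilon> > 0\<close> by auto
  have "op_le X ((T - S) + (S - R)) (\<epsilon> / 2 + \<epsilon> / 2)"
    using S R T by (intro op_le_add) (auto simp: finrank_adjointable)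
  then show "\<exists>R\<in>finrank X. op_le X (T - R) \<epsilon>" using R by auto
qed

lemma compacts_zero: "0 \<in> compacts X"
  using finrank_compacts finrank_zero by blast

lemma compacts_add:
  assumes "S \<in> compacts X" "T \<in> compacts X"
  shows "S + T \<in> compacts X"
  unfolding compacts_iff
proof (intro conjI allI impI)
  fix \<epsilon> :: real assume "\<epsilon> > 0"
  then obtain S' T' where *: "S' \<in> finrank X" "op_le X (S - S') (\<epsilon> / 2)"
    "T' \<in> finrank X" "op_le X (T - T') (\<epsilon> / 2)"
    using compactsE[of _ "\<epsilon> / 2"] assms by (metis half_gt_zero)
  have "op_le X ((S - S') + (T - T')) (\<epsilon> / 2 + \<epsilon> / 2)"
    using * assms by (intro op_le_add) (auto simp: finrank_adjointable)
  moreover have "(S - S') + (T - T') = S + T - (S' + T')" by simp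
  ultimately show "\<exists>R\<in>finrank X. op_le X (S + T - R) \<epsilon>" using * finrank_add by auto
qed (use assms in auto)

lemma compacts_comp_left:
  assumes "S \<in> adjointable X" "op_le X S c" "T \<in> compacts X"
  shows "S \<circ> T \<in> compacts X"
  unfolding compacts_iff
proof (intro conjI allI impI)
  fix \<epsilon> :: real assume \<epsilon>: "\<epsilon> > 0"
  define d where "d = max c 0 + 1"
  have d: "op_le X S d" "d > 0" using assms by (auto simp: d_def intro: op_le_mono)
  obtain T' where T': "T' \<in> finrank X" "op_le X (T - T') (\<epsilon> / d)"
    using compactsE[of T "\<epsilon> / d"] assms d \<epsilon> by auto
  have "op_le X (S \<circ> (T - T')) (d * (\<epsilon> / d))"
    using T' d assms by (intro op_le_comp) (auto simp: finrank_adjointable)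
  moreover have "S \<circ> (T - T') = (S \<circ> T) - (S \<circ> T')"
    using T' assms by (intro adjointable_eqI) (auto simp: finrank_adjointable adjointable_linear)
  ultimately show "\<exists>R\<in>finrank X. op_le X ((S \<circ> T) - R) \<epsilon>"
    using d T' assms finrank_comp_left by auto
qed (use assms in auto)

lemma compacts_comp:
  assumes "S \<in> compacts X" "T \<in> compacts X"
  shows "S \<circ> T \<in> compacts X"
proof -
  obtain c where "op_le X S c" using compacts_bounded assms by metis
  then show ?thesis using assms by (intro compacts_comp_left) auto
qed

lemma compacts_adj:
  assumes "T \<in> compacts X"
  shows "adj X T \<in> compacts X"
  unfolding compacts_iff
proof (intro conjI allI impI)
  fix \<epsilon> :: real assume "\<epsilon> > 0"
  then obtain S where S: "S \<in> finrank X" "op_le X (T - S) \<epsilon>" using compactsE assms by blast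
  then have "op_le X (adj X (T - S)) \<epsilon>" using assms by (intro op_le_adj) (auto simp: finrank_adjointable)
  then show "\<exists>R\<in>finrank X. op_le X (adj X T - R) \<epsilon>"
    using S assms finrank_adj by (auto simp: adj_simps finrank_adjointable)
qed (use assms in auto)

lemma compacts_scaleC:
  assumes "T \<in> compacts X"
  shows "c *\<^sub>C T \<in> compacts X"
  unfolding compacts_iff
proof (intro conjI allI impI)
  fix \<epsilon> :: real assume \<epsilon>: "\<epsilon> > 0"
  have pos: "cmod c + 1 > 0" by (simp add: add_nonneg_pos)
  obtain S where S: "S \<in> finrank X" "op_le X (T - S) (\<epsilon> / (cmod c + 1))"
    using compactsE[of T "\<epsilon> / (cmod c + 1)"] assms \<epsilon> pos by auto
  have "op_le X (c *\<^sub>C (T - S)) (cmod c * (\<epsilon> / (cmod c + 1)))"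
    using S assms by (intro op_le_scaleC) (auto simp: finrank_adjointable)
  moreover have "cmod c * (\<epsilon> / (cmod c + 1)) \<le> \<epsilon>" using pos \<epsilon> by (simp add: divide_simps)
  ultimately have "op_le X (c *\<^sub>C T - c *\<^sub>C S) \<epsilon>"
    by (metis complex_vector.scale_right_diff_distrib op_le_mono)
  then show "\<exists>R\<in>finrank X. op_le X (c *\<^sub>C T - R) \<epsilon>" using S finrank_scaleC by blast
qed (use assms in auto)

lemma compacts_diff: "S \<in> compacts X \<Longrightarrow> T \<in> compacts X \<Longrightarrow> S - T \<in> compacts X"
  using compacts_add[OF _ compacts_scaleC[of T "-1"], of S] by (simp add: scaleC_minus_one)

lemma compacts_sum: "(\<And>i. i \<in> I \<Longrightarrow> f i \<in> compacts X) \<Longrightarrow> sum f I \<in> compacts X"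
  by (induction I rule: infinite_finite_induct) (auto simp: compacts_zero compacts_add)

text \<open>The adjoints of a Cauchy sequence are Cauchy as well, and the pointwise limits of both
  sequences form an adjoint pair. This is how a limit of compact operators is shown to be
  adjointable.\<close>

lemma compacts_complete:
  fixes T :: "nat \<Rightarrow> 'x \<Rightarrow> 'x"
  assumes T: "\<And>n. T n \<in> compacts X"
    and Cauchy: "\<And>\<epsilon>. 0 < \<epsilon> \<Longrightarrow> \<exists>N. \<forall>m\<ge>N. \<forall>n\<ge>N. op_le X (T m - T n) \<epsilon>"
  obtains L where "L \<in> compacts X" "\<And>\<epsilon>. 0 < \<epsilon> \<Longrightarrow> \<exists>N. \<forall>n\<ge>N. op_le X (T n - L) \<epsilon>"
proof -
  have lim: "\<exists>l\<in>car X. (\<lambda>n. hnorm X (U n z - l)) \<longlonglongrightarrow> 0"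
    if U: "\<And>n. U n \<in> adjointable X" "\<And>\<epsilon>. 0 < \<epsilon> \<Longrightarrow> \<exists>N. \<forall>m\<ge>N. \<forall>n\<ge>N. op_le X (U m - U n) \<epsilon>"
      and z: "z \<in> car X" for U :: "nat \<Rightarrow> _" and z
  proof (rule complete)
    fix \<epsilon> :: real assume \<epsilon>: "\<epsilon> > 0"
    have pos: "hnorm X z + 1 > 0" using hnorm_nonneg[of X z] by linarith
    obtain N where N: "\<And>m n. m \<ge> N \<Longrightarrow> n \<ge> N \<Longrightarrow> op_le X (U m - U n) (\<epsilon> / (hnorm X z + 1))"
      using U(2)[of "\<epsilon> / (hnorm X z + 1)"] \<epsilon> pos by auto
    have "hnorm X (U m z - U n z) < \<epsilon>" if "m \<ge> N" "n \<ge> N" for m n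
    proof -
      have "\<epsilon> / (hnorm X z + 1) * hnorm X z < \<epsilon>" using \<epsilon> pos by (simp add: field_simps)
      with op_leD[OF N[OF that] z] show ?thesis by simp
    qed
    then show "\<exists>N. \<forall>m\<ge>N. \<forall>n\<ge>N. hnorm X (U m z - U n z) < \<epsilon>" by blast
  qed (use U z in auto)
  have TA: "T n \<in> adjointable X" for n using T by simp
  have adjCauchy: "\<exists>N. \<forall>m\<ge>N. \<forall>n\<ge>N. op_le X (adj X (T m) - adj X (T n)) \<epsilon>" if \<epsilon>: "0 < \<epsilon>" for \<epsilon>
  proof -
    obtain N where N: "\<And>m n. m \<ge> N \<Longrightarrow> n \<ge> N \<Longrightarrow> op_le X (T m - T n) \<epsilon>" using Cauchy[OF \<epsilon>] by blast
    have "op_le X (adj X (T m) - adj X (T n)) \<epsilon>" if "m \<ge> N" "n \<ge> N" for m n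
      using op_le_adj[OF _ N[OF that]] TA by (simp add: adj_simps)
    then show ?thesis by blast
  qed
  define L where "L z = (if z \<in> car X then SOME l. l \<in> car X \<and> (\<lambda>n. hnorm X (T n z - l)) \<longlonglongrightarrow> 0 else 0)" for z
  define L' where "L' z = (if z \<in> car X then SOME l. l \<in> car X \<and> (\<lambda>n. hnorm X (adj X (T n) z - l)) \<longlonglongrightarrow> 0 else 0)" for z
  have L: "L z \<in> car X" "(\<lambda>n. hnorm X (T n z - L z)) \<longlonglongrightarrow> 0" if "z \<in> car X" for z
    using someI_ex[OF lim[of T z, OF TA Cauchy that, unfolded Bex_def]] that by (simp_all add: L_def)
  have L': "L' z \<in> car X" "(\<lambda>n. hnorm X (adj X (T n) z - L' z)) \<longlonglongrightarrow> 0" if "z \<in> car X" for z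
    using someI_ex[OF lim[of "\<lambda>n. adj X (T n)" z, OF _ adjCauchy that, unfolded Bex_def]] that TA
    by (simp_all add: L'_def)
  have pair: "adjoint_pair X L L'"
  proof -
    have "inn X (L x) y = inn X x (L' y)" if xy: "x \<in> car X" "y \<in> car X" for x y
    proof (rule LIMSEQ_unique)
      show "(\<lambda>n. inn X (T n x) y) \<longlonglongrightarrow> inn X (L x) y"
        using xy L[of x] TA by (intro inn_tendsto) auto
      have "(\<lambda>n. inn X x (adj X (T n) y)) \<longlonglongrightarrow> inn X x (L' y)"
        using xy L'[of y] TA by (intro inn_tendsto) auto
      then show "(\<lambda>n. inn X (T n x) y) \<longlonglongrightarrow> inn X x (L' y)"
        using xy TA by (simp add: adjoint_pairD[OF adjoint_pair_adj])
    qed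
    then show ?thesis using L L' by (auto simp: adjoint_pair_def) (auto simp: L_def L'_def)
  qed
  then have LA: "L \<in> adjointable X" by (rule adjointableI)
  have conv: "\<exists>N. \<forall>n\<ge>N. op_le X (T n - L) \<epsilon>" if \<epsilon>: "0 < \<epsilon>" for \<epsilon>
  proof -
    obtain N where N: "\<And>m n. m \<ge> N \<Longrightarrow> n \<ge> N \<Longrightarrow> op_le X (T m - T n) \<epsilon>" using Cauchy[OF \<epsilon>] by blast
    have "op_le X (T n - L) \<epsilon>" if n: "n \<ge> N" for n
      unfolding op_le_def
    proof
      fix z assume z: "z \<in> car X"
      \<comment> \<open>The bound on T n - T m passes to the limit in m; the shift by
        \<open>N\<close> makes it valid for every member of the sequence.\<close>
      show "hnorm X ((T n - L) z) \<le> \<epsilon> * hnorm X z"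
      proof (rule hnorm_tendsto_le[where u = "\<lambda>m. T n z - T (m + N) z" and c = "\<lambda>_. \<epsilon> * hnorm X z"])
        show "(T n - L) z \<in> car X" using z TA LA by simp
        show "T n z - T (m + N) z \<in> car X" for m using z TA by simp
        have "hnorm X (T n z - T (m + N) z - (T n - L) z) = hnorm X (T (m + N) z - L z)" for m
          using hnorm_minus_commute[of "T (m + N) z" "L z"] TA L z by simp
        then show "(\<lambda>m. hnorm X (T n z - T (m + N) z - (T n - L) z)) \<longlonglongrightarrow> 0"
          using LIMSEQ_ignore_initial_segment[OF L(2)[OF z], of N] by simp
        show "hnorm X (T n z - T (m + N) z) \<le> \<epsilon> * hnorm X z" for m
          using op_leD[OF N[of n "m + N"] z] n by simp
      qed simp
    qed
    then show ?thesis by blast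
  qed
  have "L \<in> compacts X"
  proof (rule compacts_approx[OF LA])
    fix \<epsilon> :: real assume "\<epsilon> > 0"
    then obtain n where n: "op_le X (T n - L) \<epsilon>" using conv by blast
    then have "op_le X (L - T n) \<epsilon>"
      using op_le_scaleC[of "T n - L" \<epsilon> "-1"] TA LA by (simp add: scaleC_minus_one)
    then show "\<exists>S\<in>compacts X. op_le X (L - S) \<epsilon>" using T by blast
  qed
  then show ?thesis using conv that by blast
qed

end

section \<open>Contractivity of left actions\<close>

context hilbert_bimodule
begin

lemma lact_zero [simp]: "lact X 0 = 0"
  using lact_scaleC[of 0 0] by simp

lemma lact_minus: "lact X (- a) = - lact X a"
  using lact_scaleC[of "-1" a] by (simp add: scaleC_minus_one)

lemma lact_diff: "lact X (a - b) = lact X a - lact X b"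
  using lact_add[of a "- b"] by (simp add: lact_minus)

lemma lact_car [simp]: "x \<in> car X \<Longrightarrow> lact X a x \<in> car X"
  using lact_adjointable by simp

lemma adjoint_pair_lact: "adjoint_pair X (lact X a) (lact X (star a))"
  using adjoint_pair_adj[OF lact_adjointable, of a] by (simp add: lact_star)

lemma inn_lact: "x \<in> car X \<Longrightarrow> y \<in> car X \<Longrightarrow> inn X (lact X a x) y = inn X x (lact X (star a) y)"
  by (rule adjoint_pairD[OF adjoint_pair_lact])

text \<open>The argument for *-homomorphisms carried out on vectors: with the witness
  \<open>h\<close> for \<open>a\<close>, the operators \<phi>(a) \<plusminus> i(1 - \<phi>(h)) are
  isometric and \<phi>(a) is their average.\<close>

lemma op_le_lact: "op_le X (lact X a) (norm a)"
proof -
  have contr: "op_le X (lact X a) 1" if sa: "star a = a" and "norm a < 1" for a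
    unfolding op_le_def
  proof
    fix z assume z: "z \<in> car X"
    obtain h where h: "star h = h" "a * h = h * a" "2 *\<^sub>R h = a * a + h * h"
      using sqrt_defect \<open>star a = a\<close> \<open>norm a < 1\<close> by blast
    let ?a = "lact X a" and ?h = "lact X h"
    have "(?a \<circ> ?h) z = (?h \<circ> ?a) z" by (simp only: lact_mult[symmetric] h(2))
    then have ah: "?a (?h z) = ?h (?a z)" by simp
    have "lact X (h + h) z = lact X (a * a + h * h) z" using h(3) by (simp add: scaleR_2)
    then have aa: "?a (?a z) = ?h z + ?h z - ?h (?h z)" by (simp add: lact_add lact_mult algebra_simps)
    have lin: "?a (z - ?h z) = ?a z - ?a (?h z)" "?h (z - ?h z) = ?h z - ?h (?h z)"
      using z by (simp_all add: adjointable_linear[OF lact_adjointable])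
    have V: "hnorm X (?a z + c *\<^sub>C (z - ?h z)) = hnorm X z" if c: "c = \<i> \<or> c = - \<i>" for c
    proof -
      let ?v = "?a z + c *\<^sub>C (z - ?h z)"
      have cc: "cnj c = - c" "c * c = -1" using c by auto
      have "inn X ?v ?v = inn X z (?a (?a z)) + inn X z z - inn X z (?h z) - inn X z (?h z)
         + inn X z (?h (?h z)) + c *\<^sub>C (inn X z (?h (?a z)) - inn X z (?a (?h z)))"
        using z cc by (simp add: inn_simps inn_lact sa h(1) scaleC_scaleC scaleC_minus_one lin
            complex_vector.scale_right_diff_distrib algebra_simps)
      also have "\<dots> = inn X z z" using z by (simp add: ah aa inn_simps)
      finally show ?thesis by (simp add: hnorm_def)
    qed
    have "2 *\<^sub>C ?a z = (?a z + \<i> *\<^sub>C (z - ?h z)) + (?a z + (-\<i>) *\<^sub>C (z - ?h z))"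
      using scaleC_add_left[of 1 1 "?a z"] by (simp add: scaleC_one)
    moreover have "hnorm X ((?a z + \<i> *\<^sub>C (z - ?h z)) + (?a z + (-\<i>) *\<^sub>C (z - ?h z))) \<le> hnorm X z + hnorm X z"
      using z hnorm_triangle[of "?a z + \<i> *\<^sub>C (z - ?h z)" "?a z + (-\<i>) *\<^sub>C (z - ?h z)"]
      using V[of \<i>] V[of "- \<i>"] by simp
    ultimately have "hnorm X (2 *\<^sub>C ?a z) \<le> 2 * hnorm X z" by simp
    then show "hnorm X (?a z) \<le> 1 * hnorm X z" using z by (simp add: hnorm_scaleC)
  qed
  have sa_le: "hnorm X (lact X a z) \<le> norm a * hnorm X z" if sa: "star a = a" and z: "z \<in> car X" for a z
  proof (rule field_le_epsilon)
    fix e :: real assume e: "e > 0"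
    define \<delta> where "\<delta> = e / (hnorm X z + 1)"
    have "hnorm X z + 1 > 0" using hnorm_nonneg[of X z] by linarith
    then have \<delta>: "\<delta> > 0" "\<delta> * hnorm X z \<le> e" using e by (auto simp: \<delta>_def divide_simps)
    define t where "t = norm a + \<delta>"
    have t: "t > 0" using \<delta> by (simp add: t_def add_nonneg_pos)
    have "op_le X (lact X ((1/t) *\<^sub>R a)) 1"
      using sa t \<delta> by (intro contr) (auto simp: star_scaleR t_def divide_simps)
    then have "hnorm X ((1/t) *\<^sub>C lact X a z) \<le> hnorm X z"
      using z by (simp add: op_le_def scaleR_scaleC lact_scaleC scaleC_fun_def)
    then have "hnorm X (lact X a z) \<le> t * hnorm X z"
      using z t by (simp add: hnorm_scaleC norm_divide divide_simps mult.commute split: if_splits)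
    then show "hnorm X (lact X a z) \<le> norm a * hnorm X z + e"
      using \<delta> by (simp add: t_def distrib_right)
  qed
  show ?thesis
    unfolding op_le_def
  proof
    fix z assume z: "z \<in> car X"
    have "(hnorm X (lact X a z))\<^sup>2 = norm (inn X z (lact X (star a * a) z))"
      using z by (simp add: hnorm_square inn_lact lact_mult)
    also have "\<dots> \<le> hnorm X z * (norm (star a * a) * hnorm X z)"
      using z by (intro order_trans[OF cauchy_schwarz] mult_left_mono sa_le)
        (auto simp: star_mult star_star)
    also have "\<dots> = (norm a * hnorm X z)\<^sup>2"
      by (simp add: cstar_identity power2_eq_square)
    finally show "hnorm X (lact X a z) \<le> norm a * hnorm X z"
      by (rule power2_le_imp_le) simp
  qed
qed

end

section \<open>Automatic continuity of homomorphisms on the compact operators\<close>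

context hilbert_module
begin

text \<open>The fixed point argument for \<open>T \<circ> T\<close>, repeated inside the compact
  operators. These are functions with bounds rather than elements of a Banach space, so the
  iteration is written out and its limit comes from \<open>compacts_complete\<close>.\<close>

lemma compacts_sqrt_fixpoint:
  assumes T: "T \<in> compacts X" "adj X T = T" "op_le X T c" and c: "0 \<le> c" "c < 1"
  obtains h where "h \<in> compacts X" "adj X h = h" "T \<circ> h = h \<circ> T" "h + h = (T \<circ> T) + (h \<circ> h)"
proof -
  define r where "r = (1 + c * c) / 2"
  have cc: "c * c < 1" using c mult_left_le[of c c] by simp
  have r: "0 < r" "r < 1" using c cc by (auto simp: r_def add_pos_nonneg)
  have r2: "c * c + r * r \<le> 2 * r"
  proof -
    have "(1 - c * c) * (1 - c * c) \<le> 4 * (1 - c * c)"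
      using c cc mult_nonneg_nonneg[of c c] by (intro mult_right_mono) linarith+
    then show ?thesis by (simp add: r_def field_simps)
  qed
  define e where "e = T \<circ> T"
  have e: "e \<in> compacts X" "adj X e = e" "op_le X e (c * c)" "T \<circ> e = e \<circ> T"
    using T c by (auto simp: e_def adj_simps compacts_comp comp_assoc intro!: op_le_comp)
  define f where "f h = (1/2) *\<^sub>C (e + (h \<circ> h))" for h
  define good where "good h \<longleftrightarrow> h \<in> compacts X \<and> adj X h = h \<and> op_le X h r \<and> T \<circ> h = h \<circ> T" for h
  have f_good: "good (f h)" if "good h" for h
  proof -
    have h: "h \<in> compacts X" "adj X h = h" "op_le X h r" "T \<circ> h = h \<circ> T" using that by (auto simp: good_def)
    have "f h \<in> compacts X" unfolding f_def by (intro compacts_scaleC compacts_add compacts_comp e h)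
    moreover have "adj X (f h) = f h" using e h by (simp add: f_def adj_simps)
    moreover have "op_le X (f h) (cmod (1/2) * (c * c + r * r))"
      unfolding f_def using e h r by (intro op_le_scaleC op_le_add op_le_comp) auto
    then have "op_le X (f h) r" by (rule op_le_mono) (use r2 in simp)
    moreover have "T \<circ> f h = f h \<circ> T"
    proof (rule adjointable_eqI)
      fix x assume x: "x \<in> car X"
      have "T (e x) = e (T x)" "T (h (h x)) = h (h (T x))" using e(4) h(4) by (metis comp_apply)+
      then show "(T \<circ> f h) x = (f h \<circ> T) x"
        using x e h T by (simp add: f_def scaleC_fun_def adjointable_linear)
    qed (use T e h \<open>f h \<in> compacts X\<close> in auto)
    ultimately show ?thesis by (simp add: good_def)
  qed
  define u where "u n = (f ^^ n) 0" for n
  have good0: "good 0"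
    using r T adjointable_linear(4)[of T 0]
    by (auto simp: good_def compacts_zero op_le_def adj_eq[OF adjoint_pair_zero] fun_eq_iff)
  have u: "good (u n)" for n
    by (induction n) (use good0 f_good in \<open>auto simp: u_def simp del: zero_fun_apply\<close>)
  have uA: "u n \<in> compacts X" "u n \<in> adjointable X" "op_le X (u n) r" for n
    using u[of n] by (auto simp: good_def)
  have uSuc: "u (Suc n) = f (u n)" for n by (simp add: u_def)
  have f_diff: "f a - f b = (1/2) *\<^sub>C ((a \<circ> (a - b)) + ((a - b) \<circ> b))"
    if "a \<in> adjointable X" "b \<in> adjointable X" for a b
  proof
    fix x
    show "(f a - f b) x = ((1/2) *\<^sub>C ((a \<circ> (a - b)) + ((a - b) \<circ> b))) x"
    proof (cases "x \<in> car X")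
      case True
      then have "a (a x - b x) = a (a x) - a (b x)" using that by (simp add: adjointable_linear)
      then show ?thesis by (simp add: f_def scaleC_fun_def flip: complex_vector.scale_right_diff_distrib)
    next
      case False
      then have "a x = 0" "b x = 0" "a 0 = 0" "b 0 = 0"
        using that adjointable_off adjointable_linear(4)[of _ 0] by auto
      then show ?thesis by (simp add: f_def scaleC_fun_def)
    qed
  qed
  \<comment> \<open>A difference of two values of \<open>f\<close> is the mean of two products, each
    with the difference of the arguments as one factor and an operator bounded by \<open>r\<close>
    as the other.\<close>
  have step: "op_le X (u (Suc n) - u n) (r ^ n)" for n
  proof (induction n)
    case 0
    have "u (Suc 0) - u 0 = (1/2) *\<^sub>C e" by (auto simp: u_def f_def fun_eq_iff scaleC_fun_def)
    moreover have "op_le X ((1/2) *\<^sub>C e) (cmod (1/2) * (c * c))" using e by (intro op_le_scaleC) auto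
    ultimately show ?case using cc by (auto intro: op_le_mono)
  next
    case (Suc n)
    let ?d = "u (Suc n) - u n"
    have "u (Suc (Suc n)) - u (Suc n) = (1/2) *\<^sub>C ((u (Suc n) \<circ> ?d) + (?d \<circ> u n))"
      using f_diff[OF uA(2) uA(2), of "Suc n" n] by (simp only: uSuc)
    moreover have "op_le X ((1/2) *\<^sub>C ((u (Suc n) \<circ> ?d) + (?d \<circ> u n))) (cmod (1/2) * (r * r ^ n + r ^ n * r))"
      using uA r by (intro op_le_scaleC op_le_add op_le_comp Suc) auto
    ultimately have "op_le X (u (Suc (Suc n)) - u (Suc n)) (r ^ Suc n)" by (simp add: mult.commute)
    then show ?case .
  qed
  \<comment> \<open>The closed form of the geometric sum of the steps from \<open>m\<close> to
    \<open>m + k\<close>.\<close>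
  have tele: "op_le X (u (m + k) - u m) ((r ^ m - r ^ (m + k)) / (1 - r))" for m k
  proof (induction k)
    case (Suc k)
    have "op_le X ((u (Suc (m + k)) - u (m + k)) + (u (m + k) - u m))
        (r ^ (m + k) + (r ^ m - r ^ (m + k)) / (1 - r))"
      using uA by (intro op_le_add step Suc) auto
    moreover have "r ^ (m + k) + (r ^ m - r ^ (m + k)) / (1 - r) = (r ^ m - r ^ (m + Suc k)) / (1 - r)"
      using r by (simp add: field_simps)
    ultimately have "op_le X (u (m + Suc k) - u m) ((r ^ m - r ^ (m + Suc k)) / (1 - r))" by simp
    then show ?case .
  qed (simp add: op_le_def)
  have minus_op_le: "op_le X (S - S') d" if "op_le X (S' - S) d" "S \<in> compacts X" "S' \<in> compacts X" for S S' d
    using op_le_scaleC[of "S' - S" d "-1"] that by (simp add: scaleC_minus_one)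
  have "\<exists>N. \<forall>m\<ge>N. \<forall>n\<ge>N. op_le X (u m - u n) \<epsilon>" if \<epsilon>: "0 < \<epsilon>" for \<epsilon>
  proof -
    have "0 < \<epsilon> * (1 - r)" using r \<epsilon> by simp
    then obtain N where N: "r ^ N < \<epsilon> * (1 - r)" using real_arch_pow_inv r by blast
    have *: "op_le X (u m - u n) \<epsilon>" if "n \<ge> N" "m \<ge> n" for m n
    proof (rule op_le_mono)
      show "op_le X (u m - u n) ((r ^ n - r ^ m) / (1 - r))" using tele[of n "m - n"] that by simp
      have "r ^ n \<le> r ^ N" using that r by (intro power_decreasing) auto
      moreover have "0 \<le> r ^ m" using r by simp
      ultimately have "r ^ n - r ^ m \<le> \<epsilon> * (1 - r)" using N by linarith
      then show "(r ^ n - r ^ m) / (1 - r) \<le> \<epsilon>" using r by (simp add: divide_le_eq)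
    qed
    have "op_le X (u m - u n) \<epsilon>" if "n \<ge> N" "m \<ge> N" for m n
      using *[of n m] *[of m n] minus_op_le[of "u n" "u m"] uA that by (cases "n \<le> m") auto
    then show ?thesis by blast
  qed
  then obtain h where h: "h \<in> compacts X" "\<And>\<epsilon>. 0 < \<epsilon> \<Longrightarrow> \<exists>N. \<forall>n\<ge>N. op_le X (u n - h) \<epsilon>"
    using compacts_complete[of u] uA by metis
  have hA: "h \<in> adjointable X" using h by simp
  show ?thesis
  proof (rule that[OF h(1)])
    have "adj X h - h = 0"
    proof (rule op_le_all_eq_zero)
      fix \<epsilon> :: real assume "\<epsilon> > 0"
      then obtain n where n: "op_le X (u n - h) (\<epsilon> / 2)" using h(2)[of "\<epsilon> / 2"] by auto
      have "op_le X ((u n - h) - adj X (u n - h)) (\<epsilon> / 2 + \<epsilon> / 2)"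
        using n uA hA by (intro op_le_diff op_le_adj) auto
      moreover have "(u n - h) - adj X (u n - h) = adj X h - h"
        using u[of n] uA hA by (simp add: adj_simps good_def)
      ultimately show "op_le X (adj X h - h) \<epsilon>" by simp
    qed (use hA in auto)
    then show "adj X h = h" by simp
    have "(T \<circ> h) - (h \<circ> T) = 0"
    proof (rule op_le_all_eq_zero)
      fix \<epsilon> :: real assume "\<epsilon> > 0"
      then obtain n where n: "op_le X (u n - h) (\<epsilon> / 2)" using h(2)[of "\<epsilon> / 2"] by auto
      have "op_le X (((u n - h) \<circ> T) - (T \<circ> (u n - h))) (\<epsilon> / 2 * c + c * (\<epsilon> / 2))"
        using n uA hA T c \<open>\<epsilon> > 0\<close> by (intro op_le_diff op_le_comp) auto
      moreover have "((u n - h) \<circ> T) - (T \<circ> (u n - h)) = (T \<circ> h) - (h \<circ> T)"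
      proof (rule adjointable_eqI)
        fix x assume "x \<in> car X"
        moreover have "T (u n x) = u n (T x)" using u[of n] by (metis good_def comp_apply)
        ultimately show "(((u n - h) \<circ> T) - (T \<circ> (u n - h))) x = ((T \<circ> h) - (h \<circ> T)) x"
          using uA hA T by (simp add: adjointable_linear)
      qed (use uA hA T in auto)
      moreover have "\<epsilon> / 2 * c + c * (\<epsilon> / 2) \<le> \<epsilon>" using c \<open>\<epsilon> > 0\<close> by (simp add: mult_left_le)
      ultimately show "op_le X ((T \<circ> h) - (h \<circ> T)) \<epsilon>" by (metis op_le_mono)
    qed (use hA T in auto)
    then show "T \<circ> h = h \<circ> T" by simp
    have "h + h - ((T \<circ> T) + (h \<circ> h)) = 0"
    proof (rule op_le_all_eq_zero)
      fix \<epsilon> :: real assume "\<epsilon> > 0"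
      obtain d where d: "d \<ge> 0" "op_le X h d" using compacts_bounded h by blast
      define \<delta> where "\<delta> = \<epsilon> / (2 + r + d)"
      have "\<delta> > 0" using \<open>\<epsilon> > 0\<close> d r by (simp add: \<delta>_def)
      then obtain n where "\<forall>k\<ge>n. op_le X (u k - h) \<delta>" using h(2) by blast
      then have n: "op_le X (u n - h) \<delta>" "op_le X (u (Suc n) - h) \<delta>" by auto
      let ?d = "u n - h" and ?d' = "u (Suc n) - h"
      \<comment> \<open>The two products add up to (u n)^2 - h^2, and 2 u (Suc n) = T^2 + (u n)^2
        eliminates the iterate. The errors sum to \<delta>(2 + r + d), which explains the choice of
        \<delta>.\<close>
      have "op_le X ((((u n \<circ> ?d) + (?d \<circ> h)) - ?d') - ?d') (((r * \<delta> + \<delta> * d) + \<delta>) + \<delta>)"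
        using n uA hA r d \<open>\<delta> > 0\<close> by (intro op_le_diff op_le_add op_le_comp) auto
      moreover have "(((u n \<circ> ?d) + (?d \<circ> h)) - ?d') - ?d' = h + h - ((T \<circ> T) + (h \<circ> h))"
      proof (rule adjointable_eqI)
        fix x assume x: "x \<in> car X"
        have "u (Suc n) x + u (Suc n) x = e x + u n (u n x)"
          by (simp add: uSuc f_def scaleC_fun_def scaleC_one flip: scaleC_add_left)
        then have "u (Suc n) x + u (Suc n) x = T (T x) + u n (u n x)" by (simp add: e_def)
        then show "((((u n \<circ> ?d) + (?d \<circ> h)) - ?d') - ?d') x = (h + h - ((T \<circ> T) + (h \<circ> h))) x"
          using uA hA T x by (simp add: adjointable_linear algebra_simps)
      qed (use uA hA T in auto)
      moreover have "((r * \<delta> + \<delta> * d) + \<delta>) + \<delta> = \<epsilon>"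
      proof -
        have "((r * \<delta> + \<delta> * d) + \<delta>) + \<delta> = \<delta> * (2 + r + d)" by (simp add: algebra_simps)
        also have "\<dots> = \<epsilon>" using r d by (simp add: \<delta>_def)
        finally show ?thesis .
      qed
      ultimately show "op_le X (h + h - ((T \<circ> T) + (h \<circ> h))) \<epsilon>" by simp
    qed (use hA T in auto)
    then show "h + h = (T \<circ> T) + (h \<circ> h)" by simp
  qed
qed

text \<open>Continuity is automatic: \<kappa> maps the witness for a self-adjoint operator of bound
  below 1 to a witness for its image in B. The general case follows by applying this to T*
  T.\<close>

lemma compacts_hom_norm_le:
  fixes \<kappa> :: "('x \<Rightarrow> 'x) \<Rightarrow> 'b::cstar_algebra"
  assumes \<kappa>: "compacts_hom X \<kappa>" and T: "T \<in> compacts X" "op_le X T c" and c: "0 \<le> c"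
  shows "norm (\<kappa> T) \<le> c"
proof -
  have k: "S \<in> compacts X \<Longrightarrow> T \<in> compacts X \<Longrightarrow> \<kappa> (S + T) = \<kappa> S + \<kappa> T"
    "T \<in> compacts X \<Longrightarrow> \<kappa> (a *\<^sub>C T) = a *\<^sub>C \<kappa> T"
    "S \<in> compacts X \<Longrightarrow> T \<in> compacts X \<Longrightarrow> \<kappa> (S \<circ> T) = \<kappa> S * \<kappa> T"
    "T \<in> compacts X \<Longrightarrow> \<kappa> (adj X T) = star (\<kappa> T)" for S T a
    using \<kappa> by (auto simp: compacts_hom_def)
  have contr: "norm (\<kappa> T) \<le> 1" if T: "T \<in> compacts X" "adj X T = T" "op_le X T c" and c: "0 \<le> c" "c < 1" for T c
  proof -
    obtain h where h: "h \<in> compacts X" "adj X h = h" "T \<circ> h = h \<circ> T" "h + h = (T \<circ> T) + (h \<circ> h)"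
      using compacts_sqrt_fixpoint[OF T c] by blast
    show ?thesis
    proof (rule norm_le_one_if_sqrt_defect)
      show "star (\<kappa> T) = \<kappa> T" "star (\<kappa> h) = \<kappa> h" using T h by (simp_all flip: k(4))
      show "\<kappa> T * \<kappa> h = \<kappa> h * \<kappa> T" using T h by (simp flip: k(3))
      have "\<kappa> (h + h) = \<kappa> ((T \<circ> T) + (h \<circ> h))" using h(4) by simp
      then have "\<kappa> h + \<kappa> h = \<kappa> T * \<kappa> T + \<kappa> h * \<kappa> h"
        using k(1)[OF h(1,1)] k(1)[of "T \<circ> T" "h \<circ> h"] k(3)[OF T(1,1)] k(3)[OF h(1,1)] T h
          compacts_comp by metis
      then show "2 *\<^sub>R \<kappa> h = \<kappa> T * \<kappa> T + \<kappa> h * \<kappa> h" by (simp add: scaleR_2)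
    qed
  qed
  have sa_le: "norm (\<kappa> T) \<le> c" if T: "T \<in> compacts X" "adj X T = T" "op_le X T c" and c: "0 \<le> c" for T c
  proof (rule field_le_epsilon)
    fix e :: real assume "e > 0"
    define t where "t = c + e"
    have t: "0 < t" "c < t" using c \<open>e > 0\<close> by (auto simp: t_def)
    have "op_le X ((1/t) *\<^sub>C T) (cmod (1/t) * c)" using T by (intro op_le_scaleC) auto
    then have "norm (\<kappa> ((1/t) *\<^sub>C T)) \<le> 1"
      using T t c by (intro contr[where c = "cmod (1/t) * c"]) (auto simp: compacts_scaleC adj_simps norm_divide)
    then show "norm (\<kappa> T) \<le> c + e"
      using T t by (simp add: k norm_scaleC norm_divide t_def[symmetric] divide_simps)
  qed
  have "norm (\<kappa> (adj X T \<circ> T)) \<le> c * c"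
    using T c by (intro sa_le) (auto intro!: compacts_comp compacts_adj op_le_comp op_le_adj simp: adj_simps)
  then have "(norm (\<kappa> T))\<^sup>2 \<le> c\<^sup>2"
    using T by (simp add: k compacts_adj cstar_identity power2_eq_square[of c])
  then show ?thesis using c by (rule power2_le_imp_le)
qed

lemma compacts_hom_diff:
  assumes \<kappa>: "compacts_hom X \<kappa>" and "S \<in> compacts X" "T \<in> compacts X"
  shows "\<kappa> (S - T) = \<kappa> S - \<kappa> T"
proof -
  have "\<kappa> (S - T + T) = \<kappa> (S - T) + \<kappa> T"
    using assms compacts_diff unfolding compacts_hom_def by blast
  then show ?thesis by (simp add: algebra_simps)
qed

lemma compacts_hom_add:
  "compacts_hom X \<kappa> \<Longrightarrow> S \<in> compacts X \<Longrightarrow> T \<in> compacts X \<Longrightarrow> \<kappa> (S + T) = \<kappa> S + \<kappa> T"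
  by (simp add: compacts_hom_def del: plus_fun_apply)

text \<open>Justifies the definite description of \<psi>^(p): values on rank-one operators fix those
  on finite sums, and the norm bound extends agreement to the closure.\<close>

lemma compacts_hom_unique:
  fixes \<kappa> \<kappa>' :: "('x \<Rightarrow> 'x) \<Rightarrow> 'b::cstar_algebra"
  assumes \<kappa>: "compacts_hom X \<kappa>" "compacts_hom X \<kappa>'"
    and eq: "\<And>x y. x \<in> car X \<Longrightarrow> y \<in> car X \<Longrightarrow> \<kappa> (rank_one X x y) = \<kappa>' (rank_one X x y)"
  shows "\<kappa> = \<kappa>'"
proof
  fix T
  have fin: "\<kappa> S = \<kappa>' S" if "S \<in> finrank X" for S
    using that
  proof (induction rule: finrank_induct)
    case zero
    have "\<kappa> 0 = 0" "\<kappa>' 0 = 0"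
      using \<kappa>[THEN compacts_hom_diff, OF compacts_zero compacts_zero] by simp_all
    then show ?case by metis
  next
    case (add x y S)
    then have "\<kappa> (rank_one X x y + S) = \<kappa>' (rank_one X x y + S)"
      using \<kappa>[THEN compacts_hom_add, of "rank_one X x y" S]
      by (simp add: finrank_compacts finrank_rank_one eq del: plus_fun_apply)
    then show ?case .
  qed
  show "\<kappa> T = \<kappa>' T"
  proof (cases "T \<in> compacts X")
    case True
    have "norm (\<kappa> T - \<kappa>' T) \<le> 0"
    proof (rule field_le_epsilon)
      fix e :: real assume e: "e > 0"
      then obtain S where S: "S \<in> finrank X" "op_le X (T - S) (e / 2)"
        using compactsE[OF True, of "e / 2"] by auto
      have TS: "T - S \<in> compacts X" using S True finrank_compacts compacts_diff by blast
      have "\<kappa> T - \<kappa>' T = \<kappa> (T - S) - \<kappa>' (T - S)"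
        using S fin True finrank_compacts by (simp add: compacts_hom_diff[OF \<kappa>(1)] compacts_hom_diff[OF \<kappa>(2)])
      also have "norm \<dots> \<le> e / 2 + e / 2"
        using norm_triangle_ineq4[of "\<kappa> (T - S)" "\<kappa>' (T - S)"] e
          compacts_hom_norm_le[OF \<kappa>(1) TS S(2)] compacts_hom_norm_le[OF \<kappa>(2) TS S(2)] by linarith
      finally show "norm (\<kappa> T - \<kappa>' T) \<le> 0 + e" by simp
    qed
    then show ?thesis by simp
  qed (use \<kappa> in \<open>simp add: compacts_hom_def\<close>)
qed

end

section \<open>Representations of a Hilbert module\<close>

lemma scaleC_fun_apply: "(c *\<^sub>C f) x = c *\<^sub>C f x"
  by (simp add: scaleC_fun_def)

text \<open>A larger base eventually beats any constant. The midpoint \<open>r\<close> is used for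
  division because \<open>q\<close> may be 0.\<close>

lemma power_two_power_dominates:
  fixes q t N C :: real
  assumes "0 \<le> q" "q < t" "0 < N" "0 \<le> C"
  shows "\<exists>j. C * q ^ 2 ^ j < N * t ^ 2 ^ j"
proof -
  define r where "r = (q + t) / 2"
  have r: "0 < r" "q \<le> r" "r < t" using assms by (auto simp: r_def)
  then obtain n where "C / N < (t / r) ^ n" using real_arch_pow[of "t / r" "C / N"] by auto
  also have "\<dots> \<le> (t / r) ^ 2 ^ n" using r less_exp[of n] by (intro power_increasing) auto
  finally have "C * r ^ 2 ^ n < N * t ^ 2 ^ n" using r assms by (simp add: power_divide field_simps)
  moreover have "C * q ^ 2 ^ n \<le> C * r ^ 2 ^ n" using assms r by (intro mult_left_mono power_mono) auto
  ultimately show ?thesis by (intro exI[of _ n]) linarith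
qed

definition rep_span :: "('a::cstar_algebra, 'x::complex_vector) bimod \<Rightarrow> ('x \<Rightarrow> 'b::cstar_algebra) \<Rightarrow> 'b set" where
  "rep_span X \<psi> = complex_vector.span {\<psi> x * star (\<psi> y) | x y. x \<in> car X \<and> y \<in> car X}"

definition rep_compacts :: "('a::cstar_algebra, 'x::complex_vector) bimod \<Rightarrow> ('x \<Rightarrow> 'b::cstar_algebra) \<Rightarrow> 'b set" where
  "rep_compacts X \<psi> = closure (rep_span X \<psi>)"

text \<open>The description of \<open>psi_compacts\<close>, detached from the product system so that
  it can be studied for one module at a time.\<close>

definition compacts_lift :: "('a::cstar_algebra, 'x::complex_vector) bimod \<Rightarrow> ('x \<Rightarrow> 'b::cstar_algebra) \<Rightarrow>
    ('x \<Rightarrow> 'x) \<Rightarrow> 'b" where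
  "compacts_lift X \<psi> = (THE \<kappa>. compacts_hom X \<kappa> \<and>
    (\<forall>x\<in>car X. \<forall>y\<in>car X. \<kappa> (rank_one X x y) = \<psi> x * star (\<psi> y)))"

text \<open>One fibre of a representation; in the application \<pi> is \<psi>_e on A.\<close>

locale module_representation = hilbert_module X
  for X :: "('a::cstar_algebra, 'x::complex_vector) bimod" +
  fixes \<psi> :: "'x \<Rightarrow> 'b::cstar_algebra" and \<pi> :: "'a \<Rightarrow> 'b"
  assumes pi_hom: "star_hom \<pi>"
    and psi_add: "x \<in> car X \<Longrightarrow> y \<in> car X \<Longrightarrow> \<psi> (x + y) = \<psi> x + \<psi> y"
    and psi_scaleC: "x \<in> car X \<Longrightarrow> \<psi> (c *\<^sub>C x) = c *\<^sub>C \<psi> x"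
    and psi_inn: "x \<in> car X \<Longrightarrow> y \<in> car X \<Longrightarrow> \<pi> (inn X x y) = star (\<psi> x) * \<psi> y"
    and psi_ract: "x \<in> car X \<Longrightarrow> \<psi> (ract X x a) = \<psi> x * \<pi> a"
begin

lemma psi_zero [simp]: "\<psi> 0 = 0"
  using psi_scaleC[of 0 0] by simp

lemma psi_diff: "x \<in> car X \<Longrightarrow> y \<in> car X \<Longrightarrow> \<psi> (x - y) = \<psi> x - \<psi> y"
  using psi_add[of "x - y" y] by (simp add: eq_diff_eq)

lemma norm_psi_le: "x \<in> car X \<Longrightarrow> norm (\<psi> x) \<le> hnorm X x"
proof (rule power2_le_imp_le)
  assume "x \<in> car X"
  then have "(norm (\<psi> x))\<^sup>2 = norm (\<pi> (inn X x x))" by (simp add: psi_inn cstar_identity)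
  also have "\<dots> \<le> (hnorm X x)\<^sup>2" by (simp add: hnorm_square star_hom_norm_le[OF pi_hom])
  finally show "(norm (\<psi> x))\<^sup>2 \<le> (hnorm X x)\<^sup>2" .
qed simp

lemma rep_span_induct [consumes 1, case_names zero add]:
  assumes "d \<in> rep_span X \<psi>" and "P 0"
    and "\<And>x y d. x \<in> car X \<Longrightarrow> y \<in> car X \<Longrightarrow> d \<in> rep_span X \<psi> \<Longrightarrow> P d \<Longrightarrow> P (\<psi> x * star (\<psi> y) + d)"
  shows "P d"
proof -
  let ?B = "{\<psi> x * star (\<psi> y) | x y. x \<in> car X \<and> y \<in> car X}"
  have "d \<in> rep_span X \<psi> \<and> P d"
    using assms(1) unfolding rep_span_def
  proof (induction rule: complex_vector.span_induct_alt)
    case base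
    then show ?case using assms(2) complex_vector.span_zero by blast
  next
    case (step c R S)
    then obtain x y where xy: "x \<in> car X" "y \<in> car X" "R = \<psi> x * star (\<psi> y)" by blast
    have "c *\<^sub>C R + S \<in> complex_vector.span ?B"
      using step by (intro complex_vector.span_add complex_vector.span_scale)
        (auto intro: complex_vector.span_base)
    moreover have "P (\<psi> (c *\<^sub>C x) * star (\<psi> y) + S)"
      using step xy by (intro assms(3)) (auto simp: rep_span_def)
    ultimately show ?case using xy by (simp add: psi_scaleC mult_scaleC_left)
  qed
  then show ?thesis ..
qed

lemma rep_span_base: "x \<in> car X \<Longrightarrow> y \<in> car X \<Longrightarrow> \<psi> x * star (\<psi> y) \<in> rep_span X \<psi>"
  unfolding rep_span_def by (rule complex_vector.span_base) blast

lemmas rep_span_zero = complex_vector.span_zero[of "{\<psi> x * star (\<psi> y) | x y. x \<in> car X \<and> y \<in> car X}", folded rep_span_def]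
lemmas rep_span_add = complex_vector.span_add[of _ "{\<psi> x * star (\<psi> y) | x y. x \<in> car X \<and> y \<in> car X}", folded rep_span_def]
lemmas rep_span_scaleC = complex_vector.span_scale[of _ "{\<psi> x * star (\<psi> y) | x y. x \<in> car X \<and> y \<in> car X}", folded rep_span_def]

lemma rep_span_star: "d \<in> rep_span X \<psi> \<Longrightarrow> star d \<in> rep_span X \<psi>"
  by (induction rule: rep_span_induct)
    (simp_all add: star_add star_mult star_star rep_span_add rep_span_base rep_span_zero)

lemma rep_span_mult:
  assumes "d \<in> rep_span X \<psi>" "d' \<in> rep_span X \<psi>"
  shows "d * d' \<in> rep_span X \<psi>"
  using assms(1)
proof (induction rule: rep_span_induct)
  case (add x y d)
  have "\<psi> x * star (\<psi> y) * d' \<in> rep_span X \<psi>"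
    using assms(2)
  proof (induction rule: rep_span_induct)
    case (add z w d')
    have "\<psi> x * star (\<psi> y) * (\<psi> z * star (\<psi> w)) = \<psi> x * (star (\<psi> y) * \<psi> z) * star (\<psi> w)"
      by (simp add: mult.assoc)
    also have "\<dots> = \<psi> (ract X x (inn X y z)) * star (\<psi> w)"
      using add \<open>x \<in> car X\<close> \<open>y \<in> car X\<close> by (simp add: psi_ract psi_inn)
    finally show ?case
      using add \<open>x \<in> car X\<close> \<open>y \<in> car X\<close> by (simp add: distrib_left rep_span_add rep_span_base)
  qed (simp add: rep_span_zero)
  with add show ?case by (simp add: distrib_right rep_span_add)
qed (simp add: rep_span_zero)

section \<open>The closed span of \<psi>(X) \<psi>(X)^*\<close>

lemma rep_compactsE:
  assumes "b \<in> rep_compacts X \<psi>"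
  obtains d where "\<And>n. d n \<in> rep_span X \<psi>" "d \<longlonglongrightarrow> b"
  using assms by (auto simp: rep_compacts_def closure_sequential)

lemma rep_compactsI: "(\<And>n. d n \<in> rep_span X \<psi>) \<Longrightarrow> d \<longlonglongrightarrow> b \<Longrightarrow> b \<in> rep_compacts X \<psi>"
  by (auto simp: rep_compacts_def closure_sequential)

lemma rep_span_compacts: "d \<in> rep_span X \<psi> \<Longrightarrow> d \<in> rep_compacts X \<psi>"
  unfolding rep_compacts_def using closure_subset by blast

lemma rep_compacts_lim: "(\<And>n. d n \<in> rep_compacts X \<psi>) \<Longrightarrow> d \<longlonglongrightarrow> b \<Longrightarrow> b \<in> rep_compacts X \<psi>"
  unfolding rep_compacts_def by (rule closed_sequentially[OF closed_closure]) auto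

lemma rep_compacts_add: "a \<in> rep_compacts X \<psi> \<Longrightarrow> b \<in> rep_compacts X \<psi> \<Longrightarrow> a + b \<in> rep_compacts X \<psi>"
  by (elim rep_compactsE) (rule rep_compactsI[OF rep_span_add tendsto_add])

lemma rep_compacts_mult: "a \<in> rep_compacts X \<psi> \<Longrightarrow> b \<in> rep_compacts X \<psi> \<Longrightarrow> a * b \<in> rep_compacts X \<psi>"
  by (elim rep_compactsE) (rule rep_compactsI[OF rep_span_mult tendsto_mult])

lemma rep_compacts_star: "a \<in> rep_compacts X \<psi> \<Longrightarrow> star a \<in> rep_compacts X \<psi>"
  by (elim rep_compactsE)
    (rule rep_compactsI[OF rep_span_star bounded_linear.tendsto[OF bounded_linear_star]])

lemma rep_compacts_scaleC: "a \<in> rep_compacts X \<psi> \<Longrightarrow> c *\<^sub>C a \<in> rep_compacts X \<psi>"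
  by (elim rep_compactsE)
    (rule rep_compactsI[OF rep_span_scaleC bounded_linear.tendsto[OF bounded_linear_scaleC]])

lemma rep_compacts_diff: "a \<in> rep_compacts X \<psi> \<Longrightarrow> b \<in> rep_compacts X \<psi> \<Longrightarrow> a - b \<in> rep_compacts X \<psi>"
  using rep_compacts_add[OF _ rep_compacts_scaleC[of b "-1"], of a] by (simp add: scaleC_minus_one)

text \<open>If \<open>b\<close> kills \<psi>(X), it kills the closed span. That span contains b*, so
  b b* = 0.\<close>

lemma rep_compacts_eq_zero:
  assumes b: "b \<in> rep_compacts X \<psi>" and zero: "\<And>z. z \<in> car X \<Longrightarrow> b * \<psi> z = 0"
  shows "b = 0"
proof -
  have span: "b * d = 0" if "d \<in> rep_span X \<psi>" for d
    using that by (induction rule: rep_span_induct) (simp_all add: distrib_left zero flip: mult.assoc)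
  obtain d where d: "\<And>n. d n \<in> rep_span X \<psi>" "d \<longlonglongrightarrow> star b"
    using rep_compactsE[OF rep_compacts_star[OF b]] by blast
  have "(\<lambda>n. b * d n) \<longlonglongrightarrow> b * star b" by (intro tendsto_mult tendsto_const d)
  then have "b * star b = 0" using d span by (simp add: LIMSEQ_const_iff)
  then show ?thesis using cstar_identity'[of b] by simp
qed

lemma rep_compacts_eqI:
  assumes "b \<in> rep_compacts X \<psi>" "b' \<in> rep_compacts X \<psi>" "\<And>z. z \<in> car X \<Longrightarrow> b * \<psi> z = b' * \<psi> z"
  shows "b = b'"
  using rep_compacts_eq_zero[OF rep_compacts_diff[OF assms(1,2)]] assms(3)
  by (simp add: left_diff_distrib)

text \<open>
  With $r = b b^*$, the powers $r^n d$ for \<open>d\<close> in the span are expressed through the operators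
  \<open>T\<close> and \<open>T'\<close> up to finitely many vectors, whence the spectral radius of \<open>r\<close> is
  at most $c^2$.
\<close>

lemma rep_compacts_norm_le:
  assumes b: "b \<in> rep_compacts X \<psi>"
    and T: "\<And>z. z \<in> car X \<Longrightarrow> T z \<in> car X" "\<And>z. z \<in> car X \<Longrightarrow> b * \<psi> z = \<psi> (T z)" "op_le X T c"
    and T': "\<And>z. z \<in> car X \<Longrightarrow> T' z \<in> car X" "\<And>z. z \<in> car X \<Longrightarrow> star b * \<psi> z = \<psi> (T' z)" "op_le X T' c"
    and c: "0 \<le> c"
  shows "norm b \<le> c"
proof -
  define r where "r = b * star b"
  \<comment> \<open>Powers with exponent 0 and the formula for powers of self-adjoint elements call
    for a unit.\<close>
  define R where "R = unitize r"
  have sR: "star R = R" by (simp add: R_def r_def star_mult star_star flip: unitize_simps)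
  define f where "f z = T (T' z)" for z
  have f_car: "(f ^^ n) z \<in> car X" if "z \<in> car X" for n z
    using that T T' by (intro car_funpow) (auto simp: f_def)
  have f_norm: "hnorm X ((f ^^ n) z) \<le> (c * c) ^ n * hnorm X z" if z: "z \<in> car X" for n z
  proof (induction n)
    case (Suc n)
    let ?w = "(f ^^ n) z"
    have w: "?w \<in> car X" by (rule f_car[OF z])
    have "hnorm X (T (T' ?w)) \<le> c * hnorm X (T' ?w)" using w T T' by (intro op_leD[OF T(3)])
    also have "\<dots> \<le> c * (c * hnorm X ?w)" using w c by (intro mult_left_mono op_leD[OF T'(3)])
    also have "\<dots> \<le> c * (c * ((c * c) ^ n * hnorm X z))" using Suc c by (intro mult_left_mono) auto
    also have "T (T' ((f ^^ n) z)) = (f ^^ Suc n) z" by (simp add: f_def[of "(f ^^ n) z"])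
    finally show ?case by (simp add: mult_ac)
  qed simp
  have R_psi: "R ^ n * unitize (\<psi> z) = unitize (\<psi> ((f ^^ n) z))" if z: "z \<in> car X" for n z
  proof (induction n)
    case (Suc n)
    have "R ^ Suc n * unitize (\<psi> z) = R * unitize (\<psi> ((f ^^ n) z))" by (simp add: Suc mult.assoc)
    also have "\<dots> = unitize (b * (star b * \<psi> ((f ^^ n) z)))"
      by (simp add: R_def r_def mult.assoc flip: unitize_simps)
    also have "\<dots> = unitize (\<psi> (T (T' ((f ^^ n) z))))" using f_car[OF z] T T' by simp
    also have "T (T' ((f ^^ n) z)) = (f ^^ Suc n) z" by (simp add: f_def[of "(f ^^ n) z"])
    finally show ?case .
  qed simp
  have span: "\<exists>C\<ge>0. \<forall>n. norm (R ^ n * unitize d) \<le> C * (c * c) ^ n" if "d \<in> rep_span X \<psi>" for d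
    using that
  proof (induction rule: rep_span_induct)
    case zero
    have "unitize (0::'b) = 0" using norm_unitize[of "0::'b"] by (simp del: norm_unitize)
    then show ?case by (intro exI[of _ 0]) simp
  next
    case (add x y d)
    then obtain C where C: "C \<ge> 0" "\<And>n. norm (R ^ n * unitize d) \<le> C * (c * c) ^ n" by blast
    let ?C = "hnorm X x * norm (\<psi> y) + C"
    have "norm (R ^ n * unitize (\<psi> x * star (\<psi> y) + d)) \<le> ?C * (c * c) ^ n" for n
    proof -
      have "R ^ n * unitize (\<psi> x * star (\<psi> y) + d)
          = unitize (\<psi> ((f ^^ n) x) * star (\<psi> y)) + R ^ n * unitize d"
        using add by (simp add: unitize_simps distrib_left R_psi flip: mult.assoc)
      also have "norm \<dots> \<le> (c * c) ^ n * hnorm X x * norm (\<psi> y) + C * (c * c) ^ n"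
      proof (rule norm_triangle_mono[OF _ C(2)])
        have "norm (\<psi> ((f ^^ n) x)) \<le> (c * c) ^ n * hnorm X x"
          using add f_car f_norm norm_psi_le order_trans by blast
        then show "norm (unitize (\<psi> ((f ^^ n) x) * star (\<psi> y))) \<le> (c * c) ^ n * hnorm X x * norm (\<psi> y)"
          by (simp add: norm_mult_le)
      qed
      finally show ?thesis by (simp add: algebra_simps)
    qed
    moreover have "?C \<ge> 0" using C by simp
    ultimately show ?case by blast
  qed
  have r: "r \<in> rep_compacts X \<psi>" unfolding r_def by (intro rep_compacts_mult rep_compacts_star b)
  have "norm R \<le> c * c"
  proof (rule ccontr)
    assume "\<not> norm R \<le> c * c"
    then have \<rho>: "c * c < norm R" by simp
    \<comment> \<open>Strictly between \<open>c * c\<close> and \<open>norm R\<close>, and positive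
      even if \<open>c = 0\<close>, since it appears as a divisor.\<close>
    define q where "q = (c * c + norm R) / 2"
    have "0 < q" "c * c \<le> q" "q < norm R"
      unfolding q_def using \<rho> mult_nonneg_nonneg[OF c c] by (simp_all del: zero_le_mult_iff zero_le_square)
    note q = this
    have R0: "0 < norm R" using q by linarith
    obtain ds where ds: "\<And>n. ds n \<in> rep_span X \<psi>" "ds \<longlonglongrightarrow> r" using rep_compactsE[OF r] by blast
    \<comment> \<open>Approximating \<open>r\<close> up to \<open>norm R / 2\<close> costs half of
      \<open>norm R ^ Suc m\<close>, which is absorbed into the left-hand side below.\<close>
    then obtain n0 where n0: "norm (ds n0 - r) < norm R / 2"
      using LIMSEQ_D[OF ds(2), of "norm R / 2"] R0 by auto
    define d where "d = ds n0"
    obtain C where C: "C \<ge> 0" "\<And>n. norm (R ^ n * unitize d) \<le> C * (c * c) ^ n"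
      using span ds(1) d_def by blast
    obtain j where j: "(C / q) * q ^ 2 ^ j < 1 / 2 * norm R ^ 2 ^ j"
      using power_two_power_dominates[of q "norm R" "1/2" "C / q"] q C by auto
    \<comment> \<open>One factor of the power \<open>2 ^ j\<close> is split off and replaced by
      \<open>d\<close>.\<close>
    define m where "m = (2::nat) ^ j - 1"
    have m: "Suc m = 2 ^ j" by (simp add: m_def)
    have "norm R ^ Suc m = norm (R ^ m * R)"
      using norm_power_two_power[OF sR, of j] m by (metis power_Suc2)
    also have "R ^ m * R = R ^ m * unitize d - R ^ m * unitize (d - r)"
      by (simp add: R_def unitize_simps algebra_simps)
    also have "norm \<dots> \<le> C * (c * c) ^ m + norm R ^ m * (norm R / 2)"
      using C(2)[of m] norm_mult_le[OF norm_power_ineq[of R m], of "unitize (d - r)" "norm R / 2"] n0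
      by (intro order_trans[OF norm_triangle_ineq4] add_mono) (auto simp: d_def)
    finally have "norm R ^ Suc m \<le> 2 * (C * (c * c) ^ m)" by (simp add: mult.commute)
    moreover have "C * (c * c) ^ m \<le> C * q ^ m"
      using C q c by (intro mult_left_mono power_mono) auto
    moreover have "C * q ^ m = (C / q) * q ^ Suc m" using q by simp
    ultimately show False using j unfolding m by linarith
  qed
  then have "(norm b)\<^sup>2 \<le> c\<^sup>2"
    by (simp add: R_def r_def cstar_identity' power2_eq_square[of c])
  then show ?thesis using c by (rule power2_le_imp_le)
qed

text \<open>Membership in the closed span makes \<open>b\<close> unique. The clause on
  \<open>star b\<close> makes the relation compatible with adjoints and supplies the second operator
  for \<open>rep_compacts_norm_le\<close>.\<close>

definition represents :: "('x \<Rightarrow> 'x) \<Rightarrow> 'b \<Rightarrow> bool" where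
  "represents T b \<longleftrightarrow> T \<in> adjointable X \<and> b \<in> rep_compacts X \<psi> \<and>
    (\<forall>z\<in>car X. b * \<psi> z = \<psi> (T z) \<and> star b * \<psi> z = \<psi> (adj X T z))"

lemma represents_unique: "represents T b \<Longrightarrow> represents T b' \<Longrightarrow> b = b'"
  by (rule rep_compacts_eqI) (auto simp: represents_def)

lemma represents_norm_le: "represents T b \<Longrightarrow> op_le X T c \<Longrightarrow> 0 \<le> c \<Longrightarrow> norm b \<le> c"
  by (rule rep_compacts_norm_le[where T = T and T' = "adj X T"]) (auto simp: represents_def op_le_adj)

lemma represents_zero: "represents 0 0"
  by (simp add: represents_def adj_eq[OF adjoint_pair_zero] rep_span_compacts rep_span_zero)

lemma represents_add: "represents S b \<Longrightarrow> represents T c \<Longrightarrow> represents (S + T) (b + c)"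
  by (auto simp: represents_def rep_compacts_add distrib_right psi_add adj_simps star_add)

lemma represents_diff: "represents S b \<Longrightarrow> represents T c \<Longrightarrow> represents (S - T) (b - c)"
  by (auto simp: represents_def rep_compacts_diff left_diff_distrib psi_diff adj_simps star_diff)

lemma represents_scaleC: "represents S b \<Longrightarrow> represents (k *\<^sub>C S) (k *\<^sub>C b)"
  by (auto simp: represents_def rep_compacts_scaleC mult_scaleC_left psi_scaleC adj_simps
      star_scaleC scaleC_fun_apply)

lemma represents_comp: "represents S b \<Longrightarrow> represents T c \<Longrightarrow> represents (S \<circ> T) (b * c)"
  by (auto simp: represents_def rep_compacts_mult mult.assoc adj_simps star_mult)

lemma represents_adj: "represents S b \<Longrightarrow> represents (adj X S) (star b)"
  by (auto simp: represents_def rep_compacts_star adj_simps star_star)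

lemma represents_rank_one:
  assumes "x \<in> car X" "y \<in> car X"
  shows "represents (rank_one X x y) (\<psi> x * star (\<psi> y))"
  using assms
  by (simp add: represents_def rep_span_compacts rep_span_base adj_eq[OF rank_one_adjoint])
    (simp add: rank_one_def psi_ract psi_inn star_mult star_star mult.assoc)

lemma represents_finrank: "S \<in> finrank X \<Longrightarrow> \<exists>b. represents S b"
proof (induction rule: finrank_induct)
  case zero
  show ?case using represents_zero by blast
next
  case (add x y S)
  then show ?case using represents_add represents_rank_one by blast
qed

text \<open>Since norms of representing elements are controlled by bounds of the operators, those of
  finite-rank approximants form a Cauchy sequence, and its limit represents
  \<open>T\<close>.\<close>

lemma represents_compacts:
  assumes T: "T \<in> compacts X"
  shows "\<exists>b. represents T b"
proof -
  have "\<exists>S\<in>finrank X. op_le X (T - S) (1 / real (Suc n))" for n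
    using compactsE[OF T, of "1 / real (Suc n)"] by auto
  then obtain S where S: "\<And>n. S n \<in> finrank X" "\<And>n. op_le X (T - S n) (1 / real (Suc n))" by metis
  then have "\<forall>n. \<exists>b. represents (S n) b" using represents_finrank by blast
  then obtain b where b: "\<And>n. represents (S n) (b n)" by metis
  have SA: "S n \<in> adjointable X" and TA: "T \<in> adjointable X" for n using S T finrank_adjointable by auto
  have bd: "norm (b m - b n) \<le> 1 / real (Suc m) + 1 / real (Suc n)" for m n
  proof (rule represents_norm_le[OF represents_diff[OF b b]])
    have "op_le X ((T - S n) - (T - S m)) (1 / real (Suc n) + 1 / real (Suc m))"
      using S SA TA by (intro op_le_diff) auto
    then show "op_le X (S m - S n) (1 / real (Suc m) + 1 / real (Suc n))" by (simp add: add.commute)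
  qed simp
  have "Cauchy b" by (rule Cauchy_if_dist_le) (use bd in \<open>simp add: dist_norm\<close>)
  then obtain l where l: "b \<longlonglongrightarrow> l" using Cauchy_convergent convergent_def by blast
  have conv: "(\<lambda>n. \<psi> (U n z)) \<longlonglongrightarrow> \<psi> (V z)"
    if U: "\<And>n. U n \<in> adjointable X" "V \<in> adjointable X" "\<And>n. op_le X (V - U n) (1 / real (Suc n))"
      and z: "z \<in> car X" for U V z
  proof (rule metric_LIMSEQ_I)
    fix e :: real assume "e > 0"
    have pos: "hnorm X z + 1 > 0" using hnorm_nonneg[of X z] by linarith
    then obtain N where N: "1 / real (Suc N) < e / (hnorm X z + 1)"
      using nat_approx_posE[of "e / (hnorm X z + 1)"] \<open>e > 0\<close> by auto
    have "dist (\<psi> (U n z)) (\<psi> (V z)) < e" if "n \<ge> N" for n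
    proof -
      have "dist (\<psi> (U n z)) (\<psi> (V z)) = norm (\<psi> (V z - U n z))"
        using U z by (simp add: psi_diff dist_norm norm_minus_commute)
      also have "\<dots> \<le> hnorm X (V z - U n z)" using U z by (intro norm_psi_le) auto
      also have "\<dots> \<le> 1 / real (Suc n) * hnorm X z" using op_leD[OF U(3) z] by simp
      also have "\<dots> \<le> 1 / real (Suc N) * hnorm X z"
        using that by (intro mult_right_mono divide_left_mono) auto
      also have "\<dots> \<le> e / (hnorm X z + 1) * hnorm X z" using N by (intro mult_right_mono) auto
      also have "\<dots> < e" using \<open>e > 0\<close> pos by (simp add: field_simps)
      finally show ?thesis .
    qed
    then show "\<exists>no. \<forall>n\<ge>no. dist (\<psi> (U n z)) (\<psi> (V z)) < e" by blast
  qed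
  have "represents T l"
    unfolding represents_def
  proof (intro conjI ballI)
    show "T \<in> adjointable X" by (fact TA)
    show "l \<in> rep_compacts X \<psi>" using b[unfolded represents_def] l rep_compacts_lim by blast
    fix z assume z: "z \<in> car X"
    have "(\<lambda>n. \<psi> (S n z)) \<longlonglongrightarrow> \<psi> (T z)" using S SA TA z by (intro conv)
    moreover have "(\<lambda>n. b n * \<psi> z) \<longlonglongrightarrow> l * \<psi> z" by (intro tendsto_mult l tendsto_const)
    moreover have "b n * \<psi> z = \<psi> (S n z)" for n using b z by (simp add: represents_def)
    ultimately show "l * \<psi> z = \<psi> (T z)" by (simp add: LIMSEQ_unique)
    have "op_le X (adj X T - adj X (S n)) (1 / real (Suc n))" for n
      using op_le_adj[OF _ S(2)[of n]] SA TA by (simp add: adj_simps)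
    then have "(\<lambda>n. \<psi> (adj X (S n) z)) \<longlonglongrightarrow> \<psi> (adj X T z)" using SA TA z by (intro conv) auto
    moreover have "(\<lambda>n. star (b n) * \<psi> z) \<longlonglongrightarrow> star l * \<psi> z"
      by (intro tendsto_mult bounded_linear.tendsto[OF bounded_linear_star] l tendsto_const)
    moreover have "star (b n) * \<psi> z = \<psi> (adj X (S n) z)" for n using b z by (simp add: represents_def)
    ultimately show "star l * \<psi> z = \<psi> (adj X T z)" by (simp add: LIMSEQ_unique)
  qed
  then show ?thesis by blast
qed

text \<open>A choice of representing elements is a homomorphism because they are unique, and it is
  then identified with the definite description.\<close>

lemma compacts_lift:
  "compacts_hom X (compacts_lift X \<psi>)"
  "x \<in> car X \<Longrightarrow> y \<in> car X \<Longrightarrow> compacts_lift X \<psi> (rank_one X x y) = \<psi> x * star (\<psi> y)"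
  "T \<in> compacts X \<Longrightarrow> represents T (compacts_lift X \<psi> T)"
proof -
  define \<kappa> where "\<kappa> T = (if T \<in> compacts X then SOME b. represents T b else 0)" for T
  have \<kappa>: "represents T (\<kappa> T)" if "T \<in> compacts X" for T
    using someI_ex[OF represents_compacts[OF that]] that by (simp add: \<kappa>_def)
  have \<kappa>_eq: "\<kappa> T = b" if "T \<in> compacts X" "represents T b" for T b
    using \<kappa> represents_unique that by blast
  have hom: "compacts_hom X \<kappa>"
    unfolding compacts_hom_def
  proof (intro conjI ballI allI impI)
    fix S T and c :: complex assume T: "T \<in> compacts X"
    show "\<kappa> (c *\<^sub>C T) = c *\<^sub>C \<kappa> T" by (intro \<kappa>_eq compacts_scaleC represents_scaleC \<kappa> T)
    show "\<kappa> (adj X T) = star (\<kappa> T)" by (intro \<kappa>_eq compacts_adj represents_adj \<kappa> T)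
    assume S: "S \<in> compacts X"
    show "\<kappa> (S + T) = \<kappa> S + \<kappa> T" by (intro \<kappa>_eq compacts_add represents_add \<kappa> S T)
    show "\<kappa> (S \<circ> T) = \<kappa> S * \<kappa> T" by (intro \<kappa>_eq compacts_comp represents_comp \<kappa> S T)
  qed (simp add: \<kappa>_def)
  have rank: "\<kappa> (rank_one X x y) = \<psi> x * star (\<psi> y)" if "x \<in> car X" "y \<in> car X" for x y
    using that by (intro \<kappa>_eq represents_rank_one finrank_compacts finrank_rank_one)
  have eq: "compacts_lift X \<psi> = \<kappa>"
    unfolding compacts_lift_def
  proof (rule the_equality)
    fix \<kappa>' assume "compacts_hom X \<kappa>' \<and> (\<forall>x\<in>car X. \<forall>y\<in>car X. \<kappa>' (rank_one X x y) = \<psi> x * star (\<psi> y))"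
    then show "\<kappa>' = \<kappa>" using hom rank by (intro compacts_hom_unique) auto
  qed (use hom rank in blast)
  show "compacts_hom X (compacts_lift X \<psi>)"
    "x \<in> car X \<Longrightarrow> y \<in> car X \<Longrightarrow> compacts_lift X \<psi> (rank_one X x y) = \<psi> x * star (\<psi> y)"
    "T \<in> compacts X \<Longrightarrow> represents T (compacts_lift X \<psi> T)"
    using hom rank \<kappa> by (simp_all add: eq)
qed

lemma compacts_lift_in: "T \<in> compacts X \<Longrightarrow> compacts_lift X \<psi> T \<in> rep_compacts X \<psi>"
  using compacts_lift(3) by (simp add: represents_def)

lemma compacts_lift_mult: "T \<in> compacts X \<Longrightarrow> z \<in> car X \<Longrightarrow> compacts_lift X \<psi> T * \<psi> z = \<psi> (T z)"
  using compacts_lift(3) by (simp add: represents_def)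

lemma compacts_lift_eqI:
  assumes "T \<in> compacts X" "b \<in> rep_compacts X \<psi>" "\<And>z. z \<in> car X \<Longrightarrow> b * \<psi> z = \<psi> (T z)"
  shows "compacts_lift X \<psi> T = b"
proof (rule rep_compacts_eqI)
  show "compacts_lift X \<psi> T * \<psi> z = b * \<psi> z" if "z \<in> car X" for z
    using compacts_lift_mult[OF assms(1) that] assms(3)[OF that] by simp
qed (use assms compacts_lift_in in auto)

lemma compacts_lift_sum:
  assumes "\<And>i. i \<in> I \<Longrightarrow> T i \<in> compacts X"
  shows "compacts_lift X \<psi> (sum T I) = (\<Sum>i\<in>I. compacts_lift X \<psi> (T i))"
proof -
  have zero: "compacts_lift X \<psi> 0 = 0"
    using compacts_hom_diff[OF compacts_lift(1) compacts_zero compacts_zero] by simp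
  show ?thesis
    using assms
    by (induction I rule: infinite_finite_induct)
      (simp_all add: zero compacts_hom_add[OF compacts_lift(1)] compacts_sum del: plus_fun_apply zero_fun_apply)
qed

end

section \<open>Internal tensor products\<close>

lemma square_le_mult_imp_le:
  fixes a b c :: real
  assumes "a\<^sup>2 \<le> b * a" "0 \<le> b"
  shows "a \<le> b"
  using assms by (metis mult_right_le_imp_le not_le_imp_less order.strict_implies_order order_trans power2_eq_square)

text \<open>What an internal tensor product provides after transport along M_{p,q}: in the
  application \<open>m\<close> is the multiplication of the product system, and no separate model of
  the tensor product remains.\<close>

locale tensor_product = L: hilbert_module X + M: hilbert_bimodule Y + N: hilbert_module Z
  for X :: "('a::cstar_algebra, 'x::complex_vector) bimod"
    and Y :: "('a, 'y::complex_vector) bimod"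
    and Z :: "('a, 'z::complex_vector) bimod" +
  fixes m :: "'x \<Rightarrow> 'y \<Rightarrow> 'z"
  assumes m_car [simp]: "x \<in> car X \<Longrightarrow> y \<in> car Y \<Longrightarrow> m x y \<in> car Z"
    and m_add_left: "x \<in> car X \<Longrightarrow> x' \<in> car X \<Longrightarrow> y \<in> car Y \<Longrightarrow> m (x + x') y = m x y + m x' y"
    and m_add_right: "x \<in> car X \<Longrightarrow> y \<in> car Y \<Longrightarrow> y' \<in> car Y \<Longrightarrow> m x (y + y') = m x y + m x y'"
    and m_scaleC_left: "x \<in> car X \<Longrightarrow> y \<in> car Y \<Longrightarrow> m (c *\<^sub>C x) y = c *\<^sub>C m x y"
    and m_balanced: "x \<in> car X \<Longrightarrow> y \<in> car Y \<Longrightarrow> m (ract X x a) y = m x (lact Y a y)"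
    and m_inn: "x \<in> car X \<Longrightarrow> x' \<in> car X \<Longrightarrow> y \<in> car Y \<Longrightarrow> y' \<in> car Y \<Longrightarrow>
      inn Z (m x y) (m x' y') = inn Y y (lact Y (inn X x x') y')"
    and m_ract: "x \<in> car X \<Longrightarrow> y \<in> car Y \<Longrightarrow> ract Z (m x y) a = m x (ract Y y a)"
    and m_dense: "z \<in> car Z \<Longrightarrow> 0 < \<epsilon> \<Longrightarrow>
      \<exists>w\<in>complex_vector.span {m x y | x y. x \<in> car X \<and> y \<in> car Y}. hnorm Z (z - w) < \<epsilon>"
begin

abbreviation "mspan \<equiv> complex_vector.span {m x y | x y. x \<in> car X \<and> y \<in> car Y}"

lemma m_diff_left: "x \<in> car X \<Longrightarrow> x' \<in> car X \<Longrightarrow> y \<in> car Y \<Longrightarrow> m (x - x') y = m x y - m x' y"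
  using m_add_left[of "x - x'" x' y] by (simp add: eq_diff_eq)

lemma m_diff_right: "x \<in> car X \<Longrightarrow> y \<in> car Y \<Longrightarrow> y' \<in> car Y \<Longrightarrow> m x (y - y') = m x y - m x y'"
  using m_add_right[of x "y - y'" y'] by (simp add: eq_diff_eq)

lemma m_zero_left [simp]: "y \<in> car Y \<Longrightarrow> m 0 y = 0"
  using m_scaleC_left[of 0 y 0] by simp

lemma m_zero_right [simp]: "x \<in> car X \<Longrightarrow> m x 0 = 0"
  using m_add_right[of x 0 0] by simp

lemma hnorm_m_le:
  assumes "x \<in> car X" "y \<in> car Y"
  shows "hnorm Z (m x y) \<le> hnorm X x * hnorm Y y"
proof (rule power2_le_imp_le)
  have "(hnorm Z (m x y))\<^sup>2 = norm (inn Y y (lact Y (inn X x x) y))"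
    using assms by (simp add: hnorm_square m_inn)
  also have "\<dots> \<le> hnorm Y y * (norm (inn X x x) * hnorm Y y)"
    using assms by (intro order_trans[OF M.cauchy_schwarz] mult_left_mono op_leD[OF M.op_le_lact]) auto
  also have "\<dots> = (hnorm X x * hnorm Y y)\<^sup>2"
    by (simp add: power2_eq_square flip: hnorm_square)
  finally show "(hnorm Z (m x y))\<^sup>2 \<le> (hnorm X x * hnorm Y y)\<^sup>2" .
qed simp

lemma mspan_induct [consumes 1, case_names zero add]:
  assumes "w \<in> mspan" and "P 0"
    and "\<And>x y w. x \<in> car X \<Longrightarrow> y \<in> car Y \<Longrightarrow> w \<in> car Z \<Longrightarrow> P w \<Longrightarrow> P (m x y + w)"
  shows "P w"
proof -
  have "w \<in> car Z \<and> P w"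
    using assms(1)
  proof (induction rule: complex_vector.span_induct_alt)
    case base
    then show ?case using assms(2) by simp
  next
    case (step c v w)
    then obtain x y where xy: "x \<in> car X" "y \<in> car Y" "v = m x y" by blast
    then have "P (m (c *\<^sub>C x) y + w)" using step by (intro assms(3)) auto
    with xy step show ?case by (simp add: m_scaleC_left)
  qed
  then show ?thesis ..
qed

lemma mspan_car: "w \<in> mspan \<Longrightarrow> w \<in> car Z"
  by (induction rule: mspan_induct) auto

lemma mspan_approx:
  assumes "z \<in> car Z"
  obtains w where "\<And>n. w n \<in> mspan" "\<And>n. w n \<in> car Z" "(\<lambda>n. hnorm Z (w n - z)) \<longlonglongrightarrow> 0"
proof -
  have "\<exists>w\<in>mspan. hnorm Z (z - w) < 1 / real (Suc n)" for n
    using m_dense[OF assms, of "1 / real (Suc n)"] by auto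
  then have "\<forall>n. \<exists>w. w \<in> mspan \<and> hnorm Z (z - w) < 1 / real (Suc n)" by blast
  from choice[OF this] obtain w where w: "\<And>n. w n \<in> mspan" "\<And>n. hnorm Z (z - w n) < 1 / real (Suc n)"
    by blast
  have "hnorm Z (w n - z) \<le> 1 / real (Suc n)" for n
    using w[of n] N.hnorm_minus_commute[of "w n" z] assms mspan_car[OF w(1)] by simp
  then have "(\<lambda>n. hnorm Z (w n - z)) \<longlonglongrightarrow> 0"
    by (intro Lim_null_comparison[OF _ LIMSEQ_Suc[OF lim_1_over_n]]) auto
  then show ?thesis using that w mspan_car by blast
qed

lemma eq_zero_if_inn_m:
  assumes v: "v \<in> car Z" and zero: "\<And>x y. x \<in> car X \<Longrightarrow> y \<in> car Y \<Longrightarrow> inn Z v (m x y) = 0"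
  shows "v = 0"
proof -
  have span: "inn Z v w = 0" if "w \<in> mspan" for w
    using that by (induction rule: mspan_induct) (simp_all add: v zero N.inn_simps)
  obtain w where w: "\<And>n. w n \<in> mspan" "\<And>n. w n \<in> car Z" "(\<lambda>n. hnorm Z (w n - v)) \<longlonglongrightarrow> 0"
    using mspan_approx[OF v] by blast
  have "(\<lambda>n. inn Z v (w n)) \<longlonglongrightarrow> inn Z v v" using w v by (intro N.inn_tendsto)
  then have "inn Z v v = 0" using w span by (simp add: LIMSEQ_const_iff)
  then show ?thesis using v N.inn_definite by blast
qed

lemma eq_if_inn_m:
  assumes "v \<in> car Z" "v' \<in> car Z"
    and "\<And>x y. x \<in> car X \<Longrightarrow> y \<in> car Y \<Longrightarrow> inn Z v (m x y) = inn Z v' (m x y)"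
  shows "v = v'"
  using eq_zero_if_inn_m[of "v - v'"] assms by (simp add: N.inn_simps)

text \<open>Density does not apply directly, as the operators are not known to be bounded. Their
  adjoints are compared instead, by inner products with vectors \<open>m x y\<close>, and these are
  continuous.\<close>

lemma adjointable_eq_if_m:
  assumes U: "U \<in> adjointable Z" "U' \<in> adjointable Z"
    and eq: "\<And>x y. x \<in> car X \<Longrightarrow> y \<in> car Y \<Longrightarrow> U (m x y) = U' (m x y)"
  shows "U = U'"
proof -
  have "adj Z U = adj Z U'"
  proof (rule N.adjointable_eqI)
    fix z assume z: "z \<in> car Z"
    note sym = N.adjoint_pairD[OF N.adjoint_pair_sym[OF N.adjoint_pair_adj]]
    show "adj Z U z = adj Z U' z"
      using z U eq by (intro eq_if_inn_m) (simp_all add: sym)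
  qed (use U in auto)
  then show ?thesis using U N.adj_simps(5) by metis
qed

text \<open>Functionals on Hilbert modules need not be inner products, so the adjoint has to be
  constructed: on x' y it is <x,x'> y, and the bound \<open>hnorm X x\<close> extends it to
  limits.\<close>

lemma creation_adjoint_exists:
  assumes x: "x \<in> car X" and z: "z \<in> car Z"
  shows "\<exists>v\<in>car Y. \<forall>u\<in>car Y. inn Y v u = inn Z z (m x u)"
proof -
  have span: "\<exists>v\<in>car Y. \<forall>u\<in>car Y. inn Y v u = inn Z w (m x u)" if "w \<in> mspan" for w
    using that
  proof (induction rule: mspan_induct)
    case zero
    show ?case using x by (intro bexI[of _ 0]) auto
  next
    case (add x' y w)
    then obtain v where v: "v \<in> car Y" "\<And>u. u \<in> car Y \<Longrightarrow> inn Y v u = inn Z w (m x u)" by blast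
    have "inn Y (lact Y (inn X x x') y + v) u = inn Z (m x' y + w) (m x u)" if "u \<in> car Y" for u
      using add v x that by (simp add: M.inn_simps N.inn_simps M.inn_lact m_inn L.inn_star)
    then show ?case using add v by (intro bexI[of _ "lact Y (inn X x x') y + v"]) auto
  qed
  obtain w where w: "\<And>n. w n \<in> mspan" "\<And>n. w n \<in> car Z" "(\<lambda>n. hnorm Z (w n - z)) \<longlonglongrightarrow> 0"
    using mspan_approx[OF z] by blast
  have "\<exists>v. v \<in> car Y \<and> (\<forall>u\<in>car Y. inn Y v u = inn Z (w n) (m x u))" for n using span[OF w(1)] by blast
  then obtain v where v: "\<And>n. v n \<in> car Y" "\<And>n u. u \<in> car Y \<Longrightarrow> inn Y (v n) u = inn Z (w n) (m x u)" by metis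
  have v_diff: "hnorm Y (v k - v n) \<le> hnorm Z (w k - w n) * hnorm X x" for k n
  proof (rule square_le_mult_imp_le)
    let ?v = "v k - v n"
    have vn: "?v \<in> car Y" using v by simp
    have "(hnorm Y ?v)\<^sup>2 = norm (inn Z (w k - w n) (m x ?v))"
      using v(1) v(2)[OF vn] w(2) x vn by (simp add: hnorm_square M.inn_diff_left N.inn_diff_left)
    also have "\<dots> \<le> hnorm Z (w k - w n) * (hnorm X x * hnorm Y ?v)"
      using w x vn by (intro order_trans[OF N.cauchy_schwarz] mult_left_mono hnorm_m_le) auto
    finally show "(hnorm Y ?v)\<^sup>2 \<le> hnorm Z (w k - w n) * hnorm X x * hnorm Y ?v" by (simp add: mult.assoc)
  qed simp
  have "\<exists>l\<in>car Y. (\<lambda>n. hnorm Y (v n - l)) \<longlonglongrightarrow> 0"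
  proof (rule M.complete)
    fix \<epsilon> :: real assume "\<epsilon> > 0"
    define \<delta> where "\<delta> = \<epsilon> / (hnorm X x + 1) / 2"
    have pos: "hnorm X x + 1 > 0" using hnorm_nonneg[of X x] by linarith
    then have "\<delta> > 0" using \<open>\<epsilon> > 0\<close> by (simp add: \<delta>_def)
    then obtain K where K: "\<And>n. n \<ge> K \<Longrightarrow> hnorm Z (w n - z) < \<delta>"
      using LIMSEQ_D[OF w(3), of \<delta>] by auto
    have "hnorm Y (v k - v n) < \<epsilon>" if "k \<ge> K" "n \<ge> K" for k n
    proof -
      have "hnorm Z (w k - w n) \<le> \<delta> + \<delta>"
        using N.hnorm_diff_trans[of "w k" z "w n"] N.hnorm_minus_commute[of z "w n"] w(2) z K[of k] K[of n] that
        by simp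
      then have "hnorm Z (w k - w n) * hnorm X x \<le> (\<delta> + \<delta>) * hnorm X x" by (intro mult_right_mono) auto
      also have "\<dots> < (\<delta> + \<delta>) * (hnorm X x + 1)" using \<open>\<delta> > 0\<close> by simp
      also have "\<delta> + \<delta> = \<epsilon> / (hnorm X x + 1)" unfolding \<delta>_def by (rule field_sum_of_halves)
      also have "\<epsilon> / (hnorm X x + 1) * (hnorm X x + 1) = \<epsilon>" using pos by simp
      finally show ?thesis using v_diff[of k n] by simp
    qed
    then show "\<exists>K. \<forall>k\<ge>K. \<forall>n\<ge>K. hnorm Y (v k - v n) < \<epsilon>" by blast
  qed (use v in auto)
  then obtain l where l: "l \<in> car Y" "(\<lambda>n. hnorm Y (v n - l)) \<longlonglongrightarrow> 0" by blast
  have "inn Y l u = inn Z z (m x u)" if u: "u \<in> car Y" for u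
  proof (rule LIMSEQ_unique)
    show "(\<lambda>n. inn Y (v n) u) \<longlonglongrightarrow> inn Y l u" using v l u by (intro M.inn_tendsto)
    have "(\<lambda>n. inn Z (w n) (m x u)) \<longlonglongrightarrow> inn Z z (m x u)" using w z u x by (intro N.inn_tendsto) auto
    then show "(\<lambda>n. inn Y (v n) u) \<longlonglongrightarrow> inn Z z (m x u)" using v u by simp
  qed
  with l show ?thesis by blast
qed

text \<open>The adjoint of the creation operator $y \mapsto x y$.\<close>

definition annihilate :: "'x \<Rightarrow> 'z \<Rightarrow> 'y" where
  "annihilate x z = (SOME v. v \<in> car Y \<and> (\<forall>u\<in>car Y. inn Y v u = inn Z z (m x u)))"

lemma annihilate:
  assumes "x \<in> car X" "z \<in> car Z"
  shows annihilate_car [simp]: "annihilate x z \<in> car Y"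
    and inn_annihilate: "u \<in> car Y \<Longrightarrow> inn Y (annihilate x z) u = inn Z z (m x u)"
  using someI_ex[of "\<lambda>v. v \<in> car Y \<and> (\<forall>u\<in>car Y. inn Y v u = inn Z z (m x u))"]
    creation_adjoint_exists[OF assms] by (auto simp: annihilate_def)

lemma inn_annihilate_right:
  assumes "x \<in> car X" "z \<in> car Z" "u \<in> car Y"
  shows "inn Y u (annihilate x z) = inn Z (m x u) z"
proof -
  have "inn Y u (annihilate x z) = star (inn Y (annihilate x z) u)" using assms by (simp add: M.inn_star)
  then show ?thesis using assms by (simp add: inn_annihilate N.inn_star)
qed

lemma hnorm_annihilate_le:
  assumes "x \<in> car X" "z \<in> car Z"
  shows "hnorm Y (annihilate x z) \<le> hnorm X x * hnorm Z z"
proof (rule square_le_mult_imp_le)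
  let ?v = "annihilate x z"
  have "(hnorm Y ?v)\<^sup>2 = norm (inn Z z (m x ?v))"
    using assms by (simp add: hnorm_square inn_annihilate)
  also have "\<dots> \<le> hnorm Z z * (hnorm X x * hnorm Y ?v)"
    using assms by (intro order_trans[OF N.cauchy_schwarz] mult_left_mono hnorm_m_le) auto
  finally show "(hnorm Y ?v)\<^sup>2 \<le> hnorm X x * hnorm Z z * hnorm Y ?v" by (simp add: mult_ac)
qed simp

lemma annihilate_m:
  assumes "x \<in> car X" "x' \<in> car X" "y \<in> car Y"
  shows "annihilate x (m x' y) = lact Y (inn X x x') y"
  using assms
  by (intro M.eq_if_inn) (simp_all add: inn_annihilate m_inn M.inn_lact L.inn_star)

text \<open>This is T_x R T_{x'}^* for the creation operators T_x : y \<mapsto> x y.\<close>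

definition sandwich :: "'x \<Rightarrow> ('y \<Rightarrow> 'y) \<Rightarrow> 'x \<Rightarrow> 'z \<Rightarrow> 'z" where
  "sandwich x R x' z = (if z \<in> car Z then m x (R (annihilate x' z)) else 0)"

lemma sandwich_adjoint_pair:
  assumes x: "x \<in> car X" "x' \<in> car X" and R: "adjoint_pair Y R R'"
  shows "adjoint_pair Z (sandwich x R x') (sandwich x' R' x)"
  using x M.adjoint_pair_car[OF R]
  by (simp add: adjoint_pair_def sandwich_def M.adjoint_pairD[OF R]
      flip: inn_annihilate_right inn_annihilate)

lemma sandwich_adjointable [simp]:
  "x \<in> car X \<Longrightarrow> x' \<in> car X \<Longrightarrow> R \<in> adjointable Y \<Longrightarrow> sandwich x R x' \<in> adjointable Z"
  using sandwich_adjoint_pair M.adjoint_pair_adj N.adjointableI by blast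

lemma op_le_sandwich:
  assumes x: "x \<in> car X" "x' \<in> car X" and R: "R \<in> adjointable Y" "op_le Y R c" and c: "0 \<le> c"
  shows "op_le Z (sandwich x R x') (hnorm X x * c * hnorm X x')"
  unfolding op_le_def
proof
  fix z assume z: "z \<in> car Z"
  let ?v = "annihilate x' z"
  have "hnorm Z (m x (R ?v)) \<le> hnorm X x * hnorm Y (R ?v)" using x z R by (intro hnorm_m_le) auto
  also have "\<dots> \<le> hnorm X x * (c * hnorm Y ?v)" using x z R by (intro mult_left_mono op_leD[OF R(2)]) auto
  also have "\<dots> \<le> hnorm X x * (c * (hnorm X x' * hnorm Z z))"
    using x z c by (intro mult_left_mono hnorm_annihilate_le) auto
  finally show "hnorm Z (sandwich x R x' z) \<le> hnorm X x * c * hnorm X x' * hnorm Z z"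
    using z by (simp add: sandwich_def mult.assoc)
qed

lemma sandwich_rank_one:
  assumes "x \<in> car X" "x' \<in> car X" "u \<in> car Y" "v \<in> car Y"
  shows "sandwich x (rank_one Y u v) x' = rank_one Z (m x u) (m x' v)"
  using assms by (auto simp: sandwich_def rank_one_def m_ract inn_annihilate_right)

lemma sandwich_finrank:
  assumes x: "x \<in> car X" "x' \<in> car X"
  shows "R \<in> finrank Y \<Longrightarrow> sandwich x R x' \<in> finrank Z"
proof (induction rule: M.finrank_induct)
  case zero
  have "sandwich x 0 x' = 0" using x by (auto simp: sandwich_def)
  then show ?case using N.finrank_zero by metis
next
  case (add u v R)
  have "sandwich x (rank_one Y u v + R) x' = rank_one Z (m x u) (m x' v) + sandwich x R x'"
    using add x M.finrank_adjointable
    by (auto simp: sandwich_def m_add_right fun_eq_iff simp flip: sandwich_rank_one)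
  moreover have "rank_one Z (m x u) (m x' v) + sandwich x R x' \<in> finrank Z"
    using add x by (intro N.finrank_add N.finrank_rank_one) auto
  ultimately show ?case by metis
qed

lemma sandwich_compacts:
  assumes x: "x \<in> car X" "x' \<in> car X" and R: "R \<in> compacts Y"
  shows "sandwich x R x' \<in> compacts Z"
proof (rule N.compacts_approx)
  fix \<epsilon> :: real assume \<epsilon>: "\<epsilon> > 0"
  define K where "K = hnorm X x * hnorm X x' + 1"
  have K: "K > 0" by (simp add: K_def add_nonneg_pos)
  obtain S where S: "S \<in> finrank Y" "op_le Y (R - S) (\<epsilon> / K)" using M.compactsE[OF R, of "\<epsilon> / K"] K \<epsilon> by auto
  have SA: "S \<in> adjointable Y" using S M.finrank_adjointable by blast
  have "op_le Z (sandwich x (R - S) x') (hnorm X x * (\<epsilon> / K) * hnorm X x')"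
    using x S SA R K \<epsilon> by (intro op_le_sandwich) auto
  moreover have "hnorm X x * (\<epsilon> / K) * hnorm X x' \<le> \<epsilon>"
  proof -
    have "hnorm X x * (\<epsilon> / K) * hnorm X x' = (\<epsilon> / K) * (K - 1)" by (simp add: K_def mult_ac)
    also have "\<dots> \<le> \<epsilon>" using K \<epsilon> by (simp add: field_simps)
    finally show ?thesis .
  qed
  moreover have "sandwich x (R - S) x' = sandwich x R x' - sandwich x S x'"
    using x R SA by (auto simp: sandwich_def m_diff_right fun_eq_iff)
  ultimately have "op_le Z (sandwich x R x' - sandwich x S x') \<epsilon>" by (metis op_le_mono)
  then show "\<exists>S\<in>compacts Z. op_le Z (sandwich x R x' - S) \<epsilon>"
    using sandwich_finrank[OF x S(1)] N.finrank_compacts by blast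
qed (use x R in auto)

section \<open>Amplification of operators\<close>

text \<open>The relation U = S \<otimes> 1. It is not a function because existence of
  \<open>U\<close> has yet to be established.\<close>

definition amplifies :: "('x \<Rightarrow> 'x) \<Rightarrow> ('z \<Rightarrow> 'z) \<Rightarrow> bool" where
  "amplifies S U \<longleftrightarrow> U \<in> adjointable Z \<and> (\<forall>x\<in>car X. \<forall>y\<in>car Y. U (m x y) = m (S x) y)"

lemma amplifies_zero: "amplifies 0 0"
  by (simp add: amplifies_def)

lemma amplifies_add:
  "amplifies S U \<Longrightarrow> amplifies T V \<Longrightarrow> S \<in> adjointable X \<Longrightarrow> T \<in> adjointable X \<Longrightarrow> amplifies (S + T) (U + V)"
  by (simp add: amplifies_def m_add_left)

lemma amplifies_diff:
  "amplifies S U \<Longrightarrow> amplifies T V \<Longrightarrow> S \<in> adjointable X \<Longrightarrow> T \<in> adjointable X \<Longrightarrow> amplifies (S - T) (U - V)"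
  by (simp add: amplifies_def m_diff_left)

lemma amplifies_comp:
  "amplifies S U \<Longrightarrow> amplifies T V \<Longrightarrow> T \<in> adjointable X \<Longrightarrow> amplifies (S \<circ> T) (U \<circ> V)"
  by (simp add: amplifies_def)

lemma amplifies_adj:
  assumes SU: "amplifies S U" and S: "S \<in> adjointable X"
  shows "amplifies (adj X S) (adj Z U)"
proof -
  have U: "U \<in> adjointable Z" using SU by (simp add: amplifies_def)
  note symU = N.adjoint_pairD[OF N.adjoint_pair_sym[OF N.adjoint_pair_adj[OF U]]]
  note symS = L.adjoint_pairD[OF L.adjoint_pair_sym[OF L.adjoint_pair_adj[OF S]]]
  have "adj Z U (m x y) = m (adj X S x) y" if "x \<in> car X" "y \<in> car Y" for x y
    using that U S SU by (intro eq_if_inn_m) (simp_all add: amplifies_def symU symS m_inn)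
  then show ?thesis using U by (simp add: amplifies_def)
qed

lemma amplifies_op_le:
  assumes SU: "amplifies S U" and S: "S \<in> adjointable X" "op_le X S c" and c: "0 \<le> c"
  shows "op_le Z U c"
proof -
  define T where "T = adj X S \<circ> S"
  define R where "R = adj Z U \<circ> U"
  have U: "U \<in> adjointable Z" using SU by (simp add: amplifies_def)
  have T: "T \<in> adjointable X" "op_le X T (c * c)"
    using S c by (auto simp: T_def intro!: L.op_le_comp L.op_le_adj)
  have R: "R \<in> adjointable Z" "adjoint_pair Z R R"
    using U N.adjoint_pair_adj[of R] by (simp_all add: R_def N.adj_simps)
  have TR: "amplifies T R"
    unfolding T_def R_def using SU S by (intro amplifies_comp amplifies_adj)
  have R_car: "(R ^^ n) z \<in> car Z" if "z \<in> car Z" for n z using that R by (intro N.car_funpow) auto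
  have T_car: "(T ^^ n) z \<in> car X" if "z \<in> car X" for n z using that T by (intro L.car_funpow) auto
  \<comment> \<open>The constant depends on how \<open>w\<close> is written as a sum, so only the
    rate is of use.\<close>
  have bound: "\<exists>C\<ge>0. \<forall>n. hnorm Z ((R ^^ n) w) \<le> C * (c * c) ^ n" if "w \<in> mspan" for w
    using that
  proof (induction rule: mspan_induct)
    case zero
    have "(R ^^ n) 0 = 0" for n using R N.adjointable_linear(4)[of R 0] by (induction n) auto
    then show ?case by (intro exI[of _ 0]) simp
  next
    case (add x y w)
    then obtain C where C: "C \<ge> 0" "\<And>n. hnorm Z ((R ^^ n) w) \<le> C * (c * c) ^ n" by blast
    have Rn: "(R ^^ n) (m x y + w) = m ((T ^^ n) x) y + (R ^^ n) w" for n
    proof (induction n)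
      case (Suc n)
      then show ?case using add R TR T_car R_car by (simp add: N.adjointable_linear amplifies_def)
    qed simp
    have Tn: "hnorm X ((T ^^ n) x) \<le> (c * c) ^ n * hnorm X x" for n
    proof (induction n)
      case (Suc n)
      have "hnorm X (T ((T ^^ n) x)) \<le> c * c * hnorm X ((T ^^ n) x)"
        using add T_car by (intro op_leD[OF T(2)])
      also have "\<dots> \<le> c * c * ((c * c) ^ n * hnorm X x)" using Suc c by (intro mult_left_mono) auto
      finally show ?case by (simp add: mult.assoc)
    qed simp
    let ?C = "hnorm X x * hnorm Y y + C"
    have "hnorm Z ((R ^^ n) (m x y + w)) \<le> ?C * (c * c) ^ n" for n
    proof -
      have "hnorm Z ((R ^^ n) (m x y + w)) \<le> hnorm Z (m ((T ^^ n) x) y) + hnorm Z ((R ^^ n) w)"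
        unfolding Rn using add T_car R_car by (intro N.hnorm_triangle) auto
      also have "hnorm Z (m ((T ^^ n) x) y) \<le> hnorm X ((T ^^ n) x) * hnorm Y y"
        using add T_car by (intro hnorm_m_le)
      also have "\<dots> \<le> (c * c) ^ n * hnorm X x * hnorm Y y" using Tn by (intro mult_right_mono) auto
      finally show ?thesis using C(2)[of n] by (simp add: algebra_simps)
    qed
    moreover have "?C \<ge> 0" using C by simp
    ultimately show ?case by blast
  qed
  have R_le: "hnorm Z (R w) \<le> c * c * hnorm Z w" if w: "w \<in> mspan" for w
  proof (rule ccontr)
    assume "\<not> hnorm Z (R w) \<le> c * c * hnorm Z w"
    then have gt: "c * c * hnorm Z w < hnorm Z (R w)" by simp
    have wc: "w \<in> car Z" using mspan_car[OF w] .
    define N where "N = hnorm Z w"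
    define a where "a k = hnorm Z ((R ^^ k) w)" for k
    \<comment> \<open>The square of the norm of R^k w is the norm of <w, R^(2k) w>, to which
      Cauchy-Schwarz applies.\<close>
    have dbl: "(a k)\<^sup>2 \<le> N * a (k + k)" for k
    proof -
      have swap: "inn Z ((R ^^ k) x) y = inn Z x ((R ^^ k) y)" if "x \<in> car Z" "y \<in> car Z" for x y
        using that
      proof (induction k arbitrary: y)
        case (Suc k)
        have "inn Z ((R ^^ Suc k) x) y = inn Z ((R ^^ k) x) (R y)"
          using Suc.prems R_car N.adjoint_pairD[OF R(2)] by simp
        also have "\<dots> = inn Z x ((R ^^ k) (R y))" using Suc R(1) by simp
        also have "(R ^^ k) (R y) = (R ^^ Suc k) y" by (simp add: funpow_swap1)
        finally show ?case .
      qed simp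
      have "(a k)\<^sup>2 = norm (inn Z w ((R ^^ k) ((R ^^ k) w)))"
        using wc R_car by (simp add: a_def hnorm_square swap)
      also have "\<dots> \<le> N * a (k + k)"
        using wc R_car by (simp add: N_def a_def N.cauchy_schwarz funpow_add)
      finally show ?thesis .
    qed
    have "N \<noteq> 0"
    proof
      assume "N = 0"
      then have "a 1 = 0" using dbl[of 1] by simp
      then show False using gt \<open>N = 0\<close> by (simp add: a_def N_def)
    qed
    then have N: "N > 0" using hnorm_nonneg[of Z w] unfolding N_def by linarith
    \<comment> \<open>Doubling the exponent repeatedly, starting at 1, propagates the first ratio
      \<open>t\<close> into a lower bound for all exponents \<open>2 ^ j\<close>.\<close>
    define t where "t = a 1 / N"
    have t: "c * c < t" using gt N by (simp add: t_def a_def field_simps flip: N_def)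
    have lower: "N * t ^ 2 ^ j \<le> a (2 ^ j)" for j
    proof (induction j)
      case 0
      then show ?case using N by (simp add: t_def)
    next
      case (Suc j)
      have t0: "0 \<le> t" using t c mult_nonneg_nonneg[OF c c] by linarith
      have "(N * t ^ 2 ^ j)\<^sup>2 \<le> (a (2 ^ j))\<^sup>2" using Suc N t0 by (intro power_mono) auto
      also have "\<dots> \<le> N * a (2 ^ Suc j)" using dbl[of "2 ^ j"] by (simp add: mult_2)
      also have "(N * t ^ 2 ^ j)\<^sup>2 = N * (N * t ^ 2 ^ Suc j)"
        by (simp add: power_mult_distrib power2_eq_square mult_2 power_add)
      finally show ?case using N by simp
    qed
    obtain C where C: "C \<ge> 0" "\<And>n. a n \<le> C * (c * c) ^ n" using bound[OF w] by (auto simp: a_def)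
    obtain j where "C * (c * c) ^ 2 ^ j < N * t ^ 2 ^ j"
      using power_two_power_dominates[of "c * c" t N C] t N C c by auto
    then show False using lower[of j] C(2)[of "2 ^ j"] by simp
  qed
  have U_le: "hnorm Z (U w) \<le> c * hnorm Z w" if w: "w \<in> mspan" for w
  proof (rule power2_le_imp_le)
    have wc: "w \<in> car Z" using mspan_car[OF w] .
    have "(hnorm Z (U w))\<^sup>2 = norm (inn Z w (R w))"
      using wc U by (simp add: hnorm_square N.adjoint_pairD[OF N.adjoint_pair_adj] R_def)
    also have "\<dots> \<le> hnorm Z w * (c * c * hnorm Z w)"
      using wc R by (intro order_trans[OF N.cauchy_schwarz] mult_left_mono R_le w) auto
    finally show "(hnorm Z (U w))\<^sup>2 \<le> (c * hnorm Z w)\<^sup>2" by (simp add: power2_eq_square mult_ac)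
  qed (use c in simp)
  show ?thesis
    unfolding op_le_def
  proof
    fix z assume z: "z \<in> car Z"
    obtain w where w: "\<And>n. w n \<in> mspan" "\<And>n. w n \<in> car Z" "(\<lambda>n. hnorm Z (w n - z)) \<longlonglongrightarrow> 0"
      using mspan_approx[OF z] by blast
    show "hnorm Z (U z) \<le> c * hnorm Z z"
    proof (rule square_le_mult_imp_le)
      have "(\<lambda>n. inn Z (U (w n)) (U z)) \<longlonglongrightarrow> inn Z (U z) (U z)"
      proof -
        have "(\<lambda>n. inn Z (w n) (R z)) \<longlonglongrightarrow> inn Z z (R z)" using w z R by (intro N.inn_tendsto) auto
        then show ?thesis using w z U by (simp add: N.adjoint_pairD[OF N.adjoint_pair_adj] R_def)
      qed
      then have 1: "(\<lambda>n. norm (inn Z (U (w n)) (U z))) \<longlonglongrightarrow> (hnorm Z (U z))\<^sup>2"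
        by (simp add: hnorm_square tendsto_norm)
      have 2: "(\<lambda>n. c * (hnorm Z (w n - z) + hnorm Z z) * hnorm Z (U z)) \<longlonglongrightarrow> c * (0 + hnorm Z z) * hnorm Z (U z)"
        by (intro tendsto_intros w)
      have 3: "norm (inn Z (U (w n)) (U z)) \<le> c * (hnorm Z (w n - z) + hnorm Z z) * hnorm Z (U z)" for n
      proof -
        have "norm (inn Z (U (w n)) (U z)) \<le> hnorm Z (U (w n)) * hnorm Z (U z)"
          using w z U by (intro N.cauchy_schwarz) auto
        also have "\<dots> \<le> c * hnorm Z (w n) * hnorm Z (U z)" using U_le[OF w(1)] by (intro mult_right_mono) auto
        also have "\<dots> \<le> c * (hnorm Z (w n - z) + hnorm Z z) * hnorm Z (U z)"
          using N.hnorm_triangle[of "w n - z" z] w z c by (intro mult_right_mono mult_left_mono) auto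
        finally show ?thesis .
      qed
      show "(hnorm Z (U z))\<^sup>2 \<le> c * hnorm Z z * hnorm Z (U z)"
        using LIMSEQ_le[OF 1 2] 3 by simp
    qed (use c in simp)
  qed
qed

definition idop :: "'y \<Rightarrow> 'y" where "idop y = (if y \<in> car Y then y else 0)"

lemma idop_adjointable: "idop \<in> adjointable Y"
  by (rule M.adjointableI[of _ idop]) (simp add: adjoint_pair_def idop_def)

text \<open>On z y, annihilation by x' gives <x',z> y, and the balancing relation moves the
  coefficient to \<open>x\<close>.\<close>

lemma amplifies_rank_one:
  "x \<in> car X \<Longrightarrow> x' \<in> car X \<Longrightarrow> amplifies (rank_one X x x') (sandwich x idop x')"
  by (simp add: amplifies_def idop_adjointable)
    (simp add: sandwich_def annihilate_m rank_one_def m_balanced idop_def)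

text \<open>
  Approximating \<open>x\<close> by \<open>x a\<close> replaces the identity in the middle by the left action of \<open>a\<close>.
\<close>

lemma sandwich_idop_compacts:
  assumes K: "\<And>a. lact Y a \<in> compacts Y" and x: "x \<in> car X" "x' \<in> car X"
  shows "sandwich x idop x' \<in> compacts Z"
proof (rule N.compacts_approx)
  fix \<epsilon> :: real assume \<epsilon>: "\<epsilon> > 0"
  define \<delta> where "\<delta> = \<epsilon> / (hnorm X x' + 1)"
  have pos: "hnorm X x' + 1 > 0" using hnorm_nonneg[of X x'] by linarith
  then have "\<delta> > 0" using \<epsilon> by (simp add: \<delta>_def)
  then obtain a where a: "hnorm X (x - ract X x a) \<le> \<delta>" using L.right_approx_unit x by blast
  have eq: "sandwich x idop x' - sandwich x (lact Y a) x' = sandwich (x - ract X x a) idop x'"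
    using x by (auto simp: fun_eq_iff sandwich_def m_diff_left m_balanced idop_def)
  have "op_le Z (sandwich (x - ract X x a) idop x') (hnorm X (x - ract X x a) * 1 * hnorm X x')"
    using x by (intro op_le_sandwich idop_adjointable) (auto simp: op_le_def idop_def)
  moreover have "hnorm X (x - ract X x a) * 1 * hnorm X x' \<le> \<epsilon>"
  proof -
    have "hnorm X (x - ract X x a) * 1 * hnorm X x' \<le> \<delta> * (hnorm X x' + 1)"
      using a \<open>\<delta> > 0\<close> by (intro mult_mono) auto
    also have "\<dots> = \<epsilon>" using pos by (simp add: \<delta>_def)
    finally show ?thesis .
  qed
  ultimately have "op_le Z (sandwich x idop x' - sandwich x (lact Y a) x') \<epsilon>"
    unfolding eq by (rule op_le_mono)
  then show "\<exists>S\<in>compacts Z. op_le Z (sandwich x idop x' - S) \<epsilon>"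
    using sandwich_compacts[OF x K] by blast
qed (use x idop_adjointable in auto)

text \<open>Amplification does not increase bounds, so the amplifications of finite-rank
  approximants form a Cauchy sequence of compact operators.\<close>

lemma amplifies_compacts:
  assumes K: "\<And>a. lact Y a \<in> compacts Y" and S: "S \<in> compacts X"
  obtains U where "U \<in> compacts Z" "amplifies S U"
proof -
  have fin: "\<exists>U\<in>compacts Z. amplifies S U" if "S \<in> finrank X" for S
    using that
  proof (induction rule: L.finrank_induct)
    case zero
    show ?case using N.compacts_zero amplifies_zero by blast
  next
    case (add x x' S)
    then obtain U where U: "U \<in> compacts Z" "amplifies S U" by blast
    have "amplifies (rank_one X x x' + S) (sandwich x idop x' + U)"
      using add U by (intro amplifies_add amplifies_rank_one) (auto simp: L.finrank_adjointable)
    moreover have "sandwich x idop x' + U \<in> compacts Z"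
      using add U by (intro N.compacts_add sandwich_idop_compacts K)
    ultimately show ?case by blast
  qed
  have SA: "S \<in> adjointable X" using S by simp
  have "\<exists>R\<in>finrank X. op_le X (S - R) (1 / real (Suc n))" for n
    using L.compactsE[OF S, of "1 / real (Suc n)"] by auto
  then obtain R where R: "\<And>n. R n \<in> finrank X" "\<And>n. op_le X (S - R n) (1 / real (Suc n))" by metis
  have RA: "R n \<in> adjointable X" for n using R L.finrank_adjointable by blast
  have "\<exists>U. U \<in> compacts Z \<and> amplifies (R n) U" for n using fin[OF R(1)] by blast
  then obtain U where U: "\<And>n. U n \<in> compacts Z" "\<And>n. amplifies (R n) (U n)" by metis
  have bd: "op_le Z (U k - U n) (1 / real (Suc n) + 1 / real (Suc k))" for k n
  proof (rule amplifies_op_le[OF amplifies_diff[OF U(2) U(2)]])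
    have "op_le X ((S - R n) - (S - R k)) (1 / real (Suc n) + 1 / real (Suc k))"
      using R SA RA by (intro L.op_le_diff) auto
    then show "op_le X (R k - R n) (1 / real (Suc n) + 1 / real (Suc k))" by simp
  qed (use RA in auto)
  have small: "\<exists>N. \<forall>n\<ge>N. 1 / real (Suc n) \<le> \<epsilon>" if pos: "\<epsilon> > 0" for \<epsilon> :: real
  proof -
    obtain N where "1 / real (Suc N) < \<epsilon>" using nat_approx_posE[OF pos] by blast
    moreover have "1 / real (Suc n) \<le> 1 / real (Suc N)" if "n \<ge> N" for n
      using that by (intro divide_left_mono) auto
    ultimately show ?thesis by (meson order.strict_implies_order order_trans)
  qed
  have "\<exists>N. \<forall>k\<ge>N. \<forall>n\<ge>N. op_le Z (U k - U n) \<epsilon>" if "0 < \<epsilon>" for \<epsilon>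
  proof -
    obtain N where N: "\<And>n. n \<ge> N \<Longrightarrow> 1 / real (Suc n) \<le> \<epsilon> / 2" using small[of "\<epsilon> / 2"] \<open>0 < \<epsilon>\<close> by auto
    have "op_le Z (U k - U n) \<epsilon>" if "k \<ge> N" "n \<ge> N" for k n
      using op_le_mono[OF bd[of k n], of \<epsilon>] N[OF that(1)] N[OF that(2)] by linarith
    then show ?thesis by blast
  qed
  then obtain V where V: "V \<in> compacts Z" "\<And>\<epsilon>. 0 < \<epsilon> \<Longrightarrow> \<exists>N. \<forall>n\<ge>N. op_le Z (U n - V) \<epsilon>"
    using N.compacts_complete[of U] U by metis
  have "V (m x y) = m (S x) y" if xy: "x \<in> car X" "y \<in> car Y" for x y
  proof -
    let ?d = "V (m x y) - m (S x) y"
    have dc: "?d \<in> car Z" using V xy SA by simp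
    have "hnorm Z ?d \<le> 0"
    proof (rule field_le_epsilon)
      fix e :: real assume "e > 0"
      define K where "K = hnorm Z (m x y) + hnorm X x * hnorm Y y + 1"
      have pos: "K > 0" by (simp add: K_def add_nonneg_pos)
      define \<delta> where "\<delta> = e / K"
      have \<delta>: "\<delta> > 0" using \<open>e > 0\<close> pos by (simp add: \<delta>_def)
      obtain N1 N2 where "\<forall>n\<ge>N1. op_le Z (U n - V) \<delta>" "\<forall>n\<ge>N2. 1 / real (Suc n) \<le> \<delta>"
        using V(2)[OF \<delta>] small[OF \<delta>] by blast
      then obtain n where n: "op_le Z (U n - V) \<delta>" "1 / real (Suc n) \<le> \<delta>"
        by (metis max.cobounded1 max.cobounded2)
      have 1: "hnorm Z (U n (m x y) - V (m x y)) \<le> \<delta> * hnorm Z (m x y)"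
        using op_leD[OF n(1), of "m x y"] xy by simp
      have Um: "U n (m x y) = m (R n x) y" using U(2)[of n] xy by (simp add: amplifies_def)
      have "m (S x) y - U n (m x y) = m (S x - R n x) y"
        using xy SA RA by (simp add: Um m_diff_left)
      then have "hnorm Z (m (S x) y - U n (m x y)) \<le> hnorm X (S x - R n x) * hnorm Y y"
        using xy SA RA by (simp add: hnorm_m_le)
      also have "\<dots> \<le> (\<delta> * hnorm X x) * hnorm Y y"
        using op_leD[OF op_le_mono[OF R(2) n(2)] xy(1)] by (intro mult_right_mono) auto
      finally have 2: "hnorm Z (m (S x) y - U n (m x y)) \<le> \<delta> * (hnorm X x * hnorm Y y)" by (simp add: mult.assoc)
      have car: "U n (m x y) \<in> car Z" "V (m x y) \<in> car Z" "m (S x) y \<in> car Z" using U V xy SA by simp_all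
      have "hnorm Z ?d = hnorm Z (m (S x) y - V (m x y))" by (rule N.hnorm_minus_commute[OF car(2,3)])
      also have "\<dots> \<le> \<delta> * (hnorm X x * hnorm Y y) + \<delta> * hnorm Z (m x y)"
        using N.hnorm_diff_trans[OF car(3) car(1) car(2)] 1 2 by linarith
      also have "\<dots> \<le> \<delta> * K" using \<delta> by (simp add: K_def algebra_simps)
      also have "\<dots> = e" using pos by (simp add: \<delta>_def)
      finally show "hnorm Z ?d \<le> 0 + e" by simp
    qed
    then have "hnorm Z ?d = 0" using hnorm_nonneg[of Z ?d] by linarith
    then have "?d = 0" by (rule N.hnorm_eq_zero[OF dc])
    then show ?thesis by simp
  qed
  then show ?thesis using V that by (simp add: amplifies_def)
qed

end

section \<open>Representations of internal tensor products\<close>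

locale tensor_representation = tensor_product X Y Z m +
  repX: module_representation X \<psi> \<pi> + repY: module_representation Y \<psi>' \<pi> + repZ: module_representation Z \<psi>'' \<pi>
  for X :: "('a::cstar_algebra, 'x::complex_vector) bimod"
    and Y :: "('a, 'y::complex_vector) bimod"
    and Z :: "('a, 'z::complex_vector) bimod" and m
    and \<psi> :: "'x \<Rightarrow> 'b::cstar_algebra" and \<psi>' :: "'y \<Rightarrow> 'b" and \<psi>'' :: "'z \<Rightarrow> 'b" and \<pi> +
  assumes psi_m: "x \<in> car X \<Longrightarrow> y \<in> car Y \<Longrightarrow> \<psi>'' (m x y) = \<psi> x * \<psi>' y"
begin

text \<open>\<psi>(x) \<psi>(x')^* is a limit of elements \<psi>(x) \<pi>(a) \<psi>(x')^*. If
  \<pi>(a) is approximated by sums of \<psi>'(u) \<psi>'(v)^*, these become sums of \<psi>''(x u)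
  \<psi>''(x' v)^*.\<close>

lemma rep_compacts_subset:
  assumes \<pi>: "\<And>a. \<pi> a \<in> rep_compacts Y \<psi>'" and b: "b \<in> rep_compacts X \<psi>"
  shows "b \<in> rep_compacts Z \<psi>''"
proof -
  have 1: "\<psi> x * d * star (\<psi> x') \<in> rep_span Z \<psi>''"
    if "d \<in> rep_span Y \<psi>'" and x: "x \<in> car X" "x' \<in> car X" for x x' d
    using that(1)
  proof (induction rule: repY.rep_span_induct)
    case zero
    show ?case by (simp add: repZ.rep_span_zero)
  next
    case (add u v d)
    have "\<psi> x * (\<psi>' u * star (\<psi>' v)) * star (\<psi> x') = \<psi>'' (m x u) * star (\<psi>'' (m x' v))"
      using add x by (simp add: psi_m star_mult mult.assoc)
    then show ?case using add x by (simp add: distrib_left distrib_right repZ.rep_span_add repZ.rep_span_base)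
  qed
  have 2: "\<psi> x * \<pi> a * star (\<psi> x') \<in> rep_compacts Z \<psi>''" if x: "x \<in> car X" "x' \<in> car X" for x x' a
  proof -
    obtain d where d: "\<And>n. d n \<in> rep_span Y \<psi>'" "d \<longlonglongrightarrow> \<pi> a" using repY.rep_compactsE[OF \<pi>] by blast
    have "(\<lambda>n. \<psi> x * d n * star (\<psi> x')) \<longlonglongrightarrow> \<psi> x * \<pi> a * star (\<psi> x')"
      by (intro tendsto_mult tendsto_const d)
    then show ?thesis by (rule repZ.rep_compactsI[OF 1[OF d(1) x]])
  qed
  have 3: "\<psi> x * star (\<psi> x') \<in> rep_compacts Z \<psi>''" if x: "x \<in> car X" "x' \<in> car X" for x x'
  proof -
    have "\<exists>a. hnorm X (x - ract X x a) \<le> 1 / real (Suc n)" for n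
      using L.right_approx_unit[OF x(1), of "1 / real (Suc n)"] by auto
    then obtain a where a: "\<And>n. hnorm X (x - ract X x (a n)) \<le> 1 / real (Suc n)" by metis
    have "norm (\<psi> x * \<pi> (a n) - \<psi> x) \<le> 1 / real (Suc n)" for n
    proof -
      have "\<psi> x * \<pi> (a n) - \<psi> x = - \<psi> (x - ract X x (a n))" using x by (simp add: repX.psi_diff repX.psi_ract)
      then show ?thesis using repX.norm_psi_le[of "x - ract X x (a n)"] a[of n] x by simp
    qed
    then have "(\<lambda>n. \<psi> x * \<pi> (a n) - \<psi> x) \<longlonglongrightarrow> 0"
      by (intro Lim_null_comparison[OF _ LIMSEQ_Suc[OF lim_1_over_n]]) auto
    then have "(\<lambda>n. \<psi> x * \<pi> (a n)) \<longlonglongrightarrow> \<psi> x" by (simp add: LIM_zero_iff)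
    then have "(\<lambda>n. \<psi> x * \<pi> (a n) * star (\<psi> x')) \<longlonglongrightarrow> \<psi> x * star (\<psi> x')"
      by (rule tendsto_mult[OF _ tendsto_const])
    then show ?thesis by (rule repZ.rep_compacts_lim[OF 2[OF x]])
  qed
  have 4: "d \<in> rep_compacts Z \<psi>''" if "d \<in> rep_span X \<psi>" for d
    using that
    by (induction rule: repX.rep_span_induct)
      (simp_all add: repZ.rep_compacts_add 3 repZ.rep_span_compacts repZ.rep_span_zero)
  show ?thesis using b by (elim repX.rep_compactsE) (rule repZ.rep_compacts_lim[OF 4])
qed

text \<open>Multiplying \<psi>''(x y) = \<psi>(x) \<psi>'(y) from the left only affects the first
  factor, where \<psi>^(p)(S) acts as \<open>S\<close>; elements of the closed span are determined
  by this action.\<close>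

lemma compacts_lift_amplifies:
  assumes \<pi>: "\<And>a. \<pi> a \<in> rep_compacts Y \<psi>'" and S: "S \<in> compacts X" and U: "U \<in> compacts Z" "amplifies S U"
  shows "compacts_lift Z \<psi>'' U = compacts_lift X \<psi> S"
proof (rule repZ.compacts_lift_eqI[OF U(1)])
  let ?b = "compacts_lift X \<psi> S"
  show "?b \<in> rep_compacts Z \<psi>''" by (intro rep_compacts_subset \<pi> repX.compacts_lift_in S)
  have UA: "U \<in> adjointable Z" using U by simp
  have span: "?b * \<psi>'' w = \<psi>'' (U w)" if "w \<in> mspan" for w
    using that
  proof (induction rule: mspan_induct)
    case zero
    then show ?case using N.adjointable_linear(4)[OF UA, of 0] by simp
  next
    case (add x y w)
    have "?b * \<psi>'' (m x y) = ?b * \<psi> x * \<psi>' y" using add by (simp add: psi_m mult.assoc)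
    also have "\<dots> = \<psi>'' (U (m x y))"
      using add S U by (simp add: repX.compacts_lift_mult amplifies_def psi_m)
    finally show ?case
      using add UA by (simp add: repZ.psi_add distrib_left N.adjointable_linear)
  qed
  fix z assume z: "z \<in> car Z"
  obtain w where w: "\<And>n. w n \<in> mspan" "\<And>n. w n \<in> car Z" "(\<lambda>n. hnorm Z (w n - z)) \<longlonglongrightarrow> 0"
    using mspan_approx[OF z] by blast
  have conv: "(\<lambda>n. \<psi>'' (v n)) \<longlonglongrightarrow> \<psi>'' l"
    if "\<And>n. v n \<in> car Z" "l \<in> car Z" "(\<lambda>n. hnorm Z (v n - l)) \<longlonglongrightarrow> 0" for v l
  proof -
    have "(\<lambda>n. \<psi>'' (v n) - \<psi>'' l) \<longlonglongrightarrow> 0"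
      using that repZ.norm_psi_le[of "v _ - l"]
      by (intro Lim_null_comparison[OF _ that(3)]) (auto simp: repZ.psi_diff)
    then show ?thesis by (simp add: LIM_zero_iff)
  qed
  obtain c where c: "c \<ge> 0" "op_le Z U c" using N.compacts_bounded[OF U(1)] by blast
  have "hnorm Z (U (w n) - U z) \<le> c * hnorm Z (w n - z)" for n
    using op_leD[OF c(2), of "w n - z"] w z UA by (simp add: N.adjointable_linear)
  then have "(\<lambda>n. hnorm Z (U (w n) - U z)) \<longlonglongrightarrow> 0"
    by (intro Lim_null_comparison[OF _ tendsto_mult_right_zero[OF w(3), of c]]) auto
  then have "(\<lambda>n. \<psi>'' (U (w n))) \<longlonglongrightarrow> \<psi>'' (U z)" using w z UA by (intro conv) auto
  moreover have "(\<lambda>n. ?b * \<psi>'' (w n)) \<longlonglongrightarrow> ?b * \<psi>'' z" using w z by (intro tendsto_mult tendsto_const conv)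
  ultimately show "?b * \<psi>'' z = \<psi>'' (U z)" using span[OF w(1)] by (simp add: LIMSEQ_unique)
qed

end

section \<open>Product systems\<close>

lemma (in hilbert_module) eq_zero_if_ract:
  assumes "v \<in> car X" "\<And>a. ract X v a = 0"
  shows "v = 0"
proof -
  have "inn X v v * star (inn X v v) = 0"
    using inn_ract[of v v "star (inn X v v)"] assms by simp
  then show ?thesis using cstar_identity'[of "inn X v v"] inn_definite assms(1) by simp
qed

lemma car_mod_ideal: "car (mod_ideal Y I) = {ract Y y a | y a. y \<in> car Y \<and> a \<in> I}"
  by (simp add: mod_ideal_def Let_def)

lemma lact_mod_ideal: "y \<in> car (mod_ideal Y I) \<Longrightarrow> lact (mod_ideal Y I) a y = lact Y a y"
  by (simp add: mod_ideal_def Let_def)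

lemma inn_mod_ideal: "inn (mod_ideal Y I) = inn Y"
  by (simp add: mod_ideal_def Let_def)

lemma car_direct_sum: "car (direct_sum J M) = {x. (\<forall>i\<in>J. x i \<in> car (M i)) \<and>
    (\<forall>i. i \<notin> J \<longrightarrow> x i = 0) \<and> (\<lambda>i. inn (M i) (x i) (x i)) summable_on J}"
  by (simp add: direct_sum_def Let_def)

lemma lact_direct_sum: "lact (direct_sum J M) a x =
    (if x \<in> car (direct_sum J M) then (\<lambda>i. if i \<in> J then lact (M i) a (x i) else 0) else 0)"
  by (simp add: direct_sum_def Let_def)

lemma bimod_isoD:
  assumes "bimod_iso X Y U"
  shows "bij_betw U (car X) (car Y)"
    "x \<in> car X \<Longrightarrow> y \<in> car X \<Longrightarrow> U (x + y) = U x + U y"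
    "x \<in> car X \<Longrightarrow> U (c *\<^sub>C x) = c *\<^sub>C U x"
    "x \<in> car X \<Longrightarrow> U (ract X x a) = ract Y (U x) a"
    "x \<in> car X \<Longrightarrow> U (lact X a x) = lact Y a (U x)"
    "x \<in> car X \<Longrightarrow> y \<in> car X \<Longrightarrow> inn Y (U x) (U y) = inn X x y"
  using assms by (simp_all add: bimod_iso_def)

context product_system
begin

section \<open>Order relations in P and the fibres as tensor products\<close>

lemma one_in_P [simp]: "\<one>\<^bsub>G\<^esub> \<in> P"
  using P_inv by blast

lemma P_carrier [simp]: "p \<in> P \<Longrightarrow> p \<in> carrier G"
  using P_subset by blast

lemma ple_refl [simp]: "p \<in> P \<Longrightarrow> ple G P p p"
  by (simp add: ple_def)

lemma ple_one [simp]: "p \<in> P \<Longrightarrow> ple G P \<one>\<^bsub>G\<^esub> p"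
  by (simp add: ple_def)

lemma mult_inv_cancel [simp]: "p \<in> P \<Longrightarrow> r \<in> P \<Longrightarrow> p \<otimes>\<^bsub>G\<^esub> (inv\<^bsub>G\<^esub> p \<otimes>\<^bsub>G\<^esub> r) = r"
  by (simp add: m_assoc[symmetric])

lemma ple_trans:
  assumes "ple G P p q" "ple G P q r" "p \<in> P" "q \<in> P" "r \<in> P"
  shows "ple G P p r"
proof -
  have "(inv\<^bsub>G\<^esub> p \<otimes>\<^bsub>G\<^esub> q) \<otimes>\<^bsub>G\<^esub> (inv\<^bsub>G\<^esub> q \<otimes>\<^bsub>G\<^esub> r) = inv\<^bsub>G\<^esub> p \<otimes>\<^bsub>G\<^esub> r"
    using assms by (simp add: m_assoc)
  then show ?thesis using assms P_closed unfolding ple_def by metis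
qed

lemma inv_mult_eq_one: "p \<in> P \<Longrightarrow> r \<in> P \<Longrightarrow> inv\<^bsub>G\<^esub> p \<otimes>\<^bsub>G\<^esub> r = \<one>\<^bsub>G\<^esub> \<Longrightarrow> p = r"
  by (metis P_carrier mult_inv_cancel r_one)

lemma fib_module: "p \<in> P \<Longrightarrow> hilbert_module (fib X p)"
  using fib_bimod hilbert_bimodule.axioms by blast

lemma fib_tensor:
  assumes p: "p \<in> P" "p \<noteq> \<one>\<^bsub>G\<^esub>" and q: "q \<in> P" "q \<noteq> \<one>\<^bsub>G\<^esub>"
  shows "tensor_product (fib X p) (fib X q) (fib X (p \<otimes>\<^bsub>G\<^esub> q)) (pmul X p q)"
proof -
  obtain Z :: "('a, 'x) bimod" and t M where Z: "is_internal_tensor (fib X p) (fib X q) Z t"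
    and M: "bimod_iso Z (fib X (p \<otimes>\<^bsub>G\<^esub> q)) M"
    and Mt: "\<And>x y. x \<in> car (fib X p) \<Longrightarrow> y \<in> car (fib X q) \<Longrightarrow> pmul X p q x y = M (t x y)"
    using tensor_iso[of p q] p q by auto
  let ?X = "fib X p" and ?Y = "fib X q" and ?W = "fib X (p \<otimes>\<^bsub>G\<^esub> q)"
  interpret L: hilbert_module ?X using p by (intro fib_module)
  interpret R: hilbert_bimodule ?Y using q by (intro fib_bimod)
  interpret W: hilbert_module ?W using p q by (intro fib_module P_closed)
  interpret Z: hilbert_bimodule Z using Z by (simp add: is_internal_tensor_def)
  note M' = bimod_isoD[OF M]
  have M_car: "z \<in> car Z \<Longrightarrow> M z \<in> car ?W" for z using M'(1) by (rule bij_betw_apply)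
  have t: "x \<in> car ?X \<Longrightarrow> y \<in> car ?Y \<Longrightarrow> t x y \<in> car Z"
    "x \<in> car ?X \<Longrightarrow> x' \<in> car ?X \<Longrightarrow> y \<in> car ?Y \<Longrightarrow> t (x + x') y = t x y + t x' y"
    "x \<in> car ?X \<Longrightarrow> y \<in> car ?Y \<Longrightarrow> y' \<in> car ?Y \<Longrightarrow> t x (y + y') = t x y + t x y'"
    "x \<in> car ?X \<Longrightarrow> y \<in> car ?Y \<Longrightarrow> t (c *\<^sub>C x) y = c *\<^sub>C t x y"
    "x \<in> car ?X \<Longrightarrow> y \<in> car ?Y \<Longrightarrow> t (ract ?X x a) y = t x (lact ?Y a y)"
    "x \<in> car ?X \<Longrightarrow> x' \<in> car ?X \<Longrightarrow> y \<in> car ?Y \<Longrightarrow> y' \<in> car ?Y \<Longrightarrow>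
       inn Z (t x y) (t x' y') = inn ?Y y (lact ?Y (inn ?X x x') y')"
    "x \<in> car ?X \<Longrightarrow> y \<in> car ?Y \<Longrightarrow> ract Z (t x y) a = t x (ract ?Y y a)"
    "z \<in> car Z \<Longrightarrow> \<epsilon> > 0 \<Longrightarrow>
       \<exists>w\<in>complex_vector.span {t x y | x y. x \<in> car ?X \<and> y \<in> car ?Y}. hnorm Z (z - w) < \<epsilon>"
    for x x' y y' a c z \<epsilon>
    using Z by (simp_all add: is_internal_tensor_def)
  show ?thesis
  proof unfold_locales
    fix z and \<epsilon> :: real assume z: "z \<in> car ?W" and \<epsilon>: "\<epsilon> > 0"
    obtain z' where z': "z' \<in> car Z" "z = M z'" using M'(1) z by (auto simp: bij_betw_def)
    obtain w where w: "w \<in> complex_vector.span {t x y | x y. x \<in> car ?X \<and> y \<in> car ?Y}"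
      "hnorm Z (z' - w) < \<epsilon>" using t(8)[OF z'(1) \<epsilon>] by blast
    have span: "w \<in> car Z \<and> M w \<in> complex_vector.span {pmul X p q x y | x y. x \<in> car ?X \<and> y \<in> car ?Y}"
      using w(1)
    proof (induction rule: complex_vector.span_induct_alt)
      case base
      have "M 0 = 0" using M'(3)[of 0 0] by simp
      then show ?case by (simp add: complex_vector.span_zero)
    next
      case (step c u v)
      then obtain x y where xy: "x \<in> car ?X" "y \<in> car ?Y" "u = t x y" by blast
      have "M (c *\<^sub>C u + v) = c *\<^sub>C pmul X p q x y + M v"
        using step xy t(1) by (simp add: M' Mt)
      moreover have "c *\<^sub>C pmul X p q x y + M v
          \<in> complex_vector.span {pmul X p q x y | x y. x \<in> car ?X \<and> y \<in> car ?Y}"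
        using step xy by (intro complex_vector.span_add complex_vector.span_scale)
          (auto intro: complex_vector.span_base)
      ultimately show ?case using step xy t(1) by simp
    qed
    have "M z' = M (z' - w) + M w" using M'(2)[of "z' - w" w] z' span by simp
    then have "hnorm ?W (z - M w) = hnorm Z (z' - w)"
      using z' span by (simp add: hnorm_def M')
    then show "\<exists>w\<in>complex_vector.span {pmul X p q x y | x y. x \<in> car ?X \<and> y \<in> car ?Y}. hnorm ?W (z - w) < \<epsilon>"
      using w(2) span by (intro bexI[of _ "M w"]) simp_all
  qed (use p q in \<open>simp_all add: Mt t M' M_car\<close>, simp_all add: t flip: M'(4))
qed

section \<open>The fibre over the identity and the maps \<iota>\<close>

lemma emb_simps:
  "car (fib X \<one>\<^bsub>G\<^esub>) = range (emb X)"
  "emb X (a + b) = emb X a + emb X b"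
  "emb X (a * b) = ract (fib X \<one>\<^bsub>G\<^esub>) (emb X a) b"
  "lact (fib X \<one>\<^bsub>G\<^esub>) a (emb X b) = emb X (a * b)"
  "inn (fib X \<one>\<^bsub>G\<^esub>) (emb X a) (emb X b) = star a * b"
  using bimod_isoD[OF fib_one] by (simp_all add: standard_bimod_def bij_betw_def)

lemma emb_car [simp]: "emb X a \<in> car (fib X \<one>\<^bsub>G\<^esub>)"
  by (simp add: emb_simps)

lemma emb_diff: "emb X (a - b) = emb X a - emb X b"
  using emb_simps(2)[of "a - b" b] by (simp add: eq_diff_eq)

lemma hnorm_emb: "hnorm (fib X \<one>\<^bsub>G\<^esub>) (emb X a) = norm a"
  by (simp add: hnorm_def emb_simps cstar_identity)

text \<open>The left action is multiplication by elements of X_e, so this is associativity.\<close>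

lemma lact_pmul:
  assumes "p \<in> P" "q \<in> P" "x \<in> car (fib X p)" "y \<in> car (fib X q)"
  shows "lact (fib X (p \<otimes>\<^bsub>G\<^esub> q)) a (pmul X p q x y) = pmul X p q (lact (fib X p) a x) y"
  using pmul_assoc[of "\<one>\<^bsub>G\<^esub>" p q "emb X a" x y] assms
  by (simp add: pmul_one_left P_closed pmul_closed)

lemma iota_eqI:
  assumes p: "p \<in> P" "p \<noteq> \<one>\<^bsub>G\<^esub>" and r: "r \<in> P" and pr: "ple G P p r"
    and U: "U \<in> adjointable (fib X r)"
    and eq: "\<And>x y. x \<in> car (fib X p) \<Longrightarrow> y \<in> car (fib X (inv\<^bsub>G\<^esub> p \<otimes>\<^bsub>G\<^esub> r)) \<Longrightarrow>
      U (pmul X p (inv\<^bsub>G\<^esub> p \<otimes>\<^bsub>G\<^esub> r) x y) = pmul X p (inv\<^bsub>G\<^esub> p \<otimes>\<^bsub>G\<^esub> r) (S x) y"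
  shows "iota G P X p r S = U"
proof -
  let ?q = "inv\<^bsub>G\<^esub> p \<otimes>\<^bsub>G\<^esub> r"
  have q: "?q \<in> P" using pr by (simp add: ple_def)
  have "V = U" if V: "V \<in> adjointable (fib X r)"
    and V_eq: "\<forall>x\<in>car (fib X p). \<forall>y\<in>car (fib X ?q). V (pmul X p ?q x y) = pmul X p ?q (S x) y" for V
  proof (cases "?q = \<one>\<^bsub>G\<^esub>")
    case False
    then interpret tensor_product "fib X p" "fib X ?q" "fib X r" "pmul X p ?q"
      using fib_tensor[of p ?q] p q r by simp
    show ?thesis using U V V_eq eq by (intro adjointable_eq_if_m) auto
  next
    \<comment> \<open>No tensor product isomorphism is given for q = e. Products with X_e are right
      multiples, and these detect a vector of X_p.\<close>
    case True
    then have rp: "r = p" using inv_mult_eq_one p r by blast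
    interpret hilbert_module "fib X p" using p by (intro fib_module)
    show ?thesis
    proof (rule adjointable_eqI)
      fix x assume x: "x \<in> car (fib X p)"
      have "ract (fib X p) (V x - U x) a = 0" for a
      proof -
        have "V (ract (fib X p) x a) = U (ract (fib X p) x a)"
          using eq[OF x, of "emb X a"] V_eq x True p
          by (simp add: rp pmul_one_right[symmetric])
        then show ?thesis using x U V by (simp add: rp adjointable_linear ract_diff_left)
      qed
      moreover have "V x - U x \<in> car (fib X p)" using x U V by (simp add: rp)
      ultimately have "V x - U x = 0" using eq_zero_if_ract by blast
      then show "V x = U x" by simp
    qed (use U V in \<open>simp_all add: rp\<close>)
  qed
  then have "(THE T. T \<in> adjointable (fib X r) \<and> (\<forall>x\<in>car (fib X p). \<forall>y\<in>car (fib X ?q).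
      T (pmul X p ?q x y) = pmul X p ?q (S x) y)) = U"
    using U eq by (intro the_equality) blast+
  then show ?thesis using p pr by (simp add: iota_def)
qed

lemma iota_lact:
  assumes p: "p \<in> P" "p \<noteq> \<one>\<^bsub>G\<^esub>" and r: "r \<in> P" and pr: "ple G P p r"
  shows "iota G P X p r (lact (fib X p) a) = lact (fib X r) a"
proof (rule iota_eqI[OF p r pr])
  interpret hilbert_bimodule "fib X r" using r by (rule fib_bimod)
  show "lact (fib X r) a \<in> adjointable (fib X r)" by (rule lact_adjointable)
  fix x y assume "x \<in> car (fib X p)" "y \<in> car (fib X (inv\<^bsub>G\<^esub> p \<otimes>\<^bsub>G\<^esub> r))"
  then show "lact (fib X r) a (pmul X p (inv\<^bsub>G\<^esub> p \<otimes>\<^bsub>G\<^esub> r) x y) =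
      pmul X p (inv\<^bsub>G\<^esub> p \<otimes>\<^bsub>G\<^esub> r) (lact (fib X p) a x) y"
    using lact_pmul[of p "inv\<^bsub>G\<^esub> p \<otimes>\<^bsub>G\<^esub> r" x y a] p r pr by (simp add: ple_def)
qed

lemma rank_one_emb:
  "rank_one (fib X \<one>\<^bsub>G\<^esub>) (emb X a) (emb X b) = lact (fib X \<one>\<^bsub>G\<^esub>) (a * star b)"
proof -
  interpret hilbert_bimodule "fib X \<one>\<^bsub>G\<^esub>" by (intro fib_bimod) simp
  show ?thesis
  proof (rule adjointable_eqI)
    fix x assume "x \<in> car (fib X \<one>\<^bsub>G\<^esub>)"
    then obtain c where "x = emb X c" by (auto simp: emb_simps)
    then show "rank_one (fib X \<one>\<^bsub>G\<^esub>) (emb X a) (emb X b) x = lact (fib X \<one>\<^bsub>G\<^esub>) (a * star b) x"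
      by (simp add: rank_one_def emb_simps(4,5) mult.assoc flip: emb_simps(3))
  qed (simp_all add: lact_adjointable)
qed

lemma emb_approx:
  fixes a :: 'a
  assumes "0 < \<epsilon>"
  obtains d where "norm (a - a * d) \<le> \<epsilon>"
proof -
  interpret hilbert_bimodule "fib X \<one>\<^bsub>G\<^esub>" by (intro fib_bimod) simp
  obtain d where "hnorm (fib X \<one>\<^bsub>G\<^esub>) (emb X a - ract (fib X \<one>\<^bsub>G\<^esub>) (emb X a) d) \<le> \<epsilon>"
    using right_approx_unit[of "emb X a"] assms by auto
  then show ?thesis using that[of d] by (simp add: hnorm_emb flip: emb_simps(3) emb_diff)
qed

text \<open>For a right approximate unit \<open>d\<close> of \<open>a\<close>, left multiplication
  by \<open>a * d\<close> is the rank-one operator of \<open>a\<close> and d*.\<close>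

lemma lact_one_compacts: "lact (fib X \<one>\<^bsub>G\<^esub>) a \<in> compacts (fib X \<one>\<^bsub>G\<^esub>)"
proof -
  interpret hilbert_bimodule "fib X \<one>\<^bsub>G\<^esub>" by (intro fib_bimod) simp
  show ?thesis
  proof (rule compacts_approx[OF lact_adjointable])
    fix \<epsilon> :: real assume "\<epsilon> > 0"
    then obtain d where d: "norm (a - a * d) \<le> \<epsilon>" using emb_approx by blast
    have "lact (fib X \<one>\<^bsub>G\<^esub>) (a * d) \<in> compacts (fib X \<one>\<^bsub>G\<^esub>)"
      using finrank_compacts[OF finrank_rank_one[of "emb X a" "emb X (star d)"]]
      by (simp add: rank_one_emb star_star)
    moreover have "op_le (fib X \<one>\<^bsub>G\<^esub>) (lact (fib X \<one>\<^bsub>G\<^esub>) a - lact (fib X \<one>\<^bsub>G\<^esub>) (a * d)) \<epsilon>"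
      using op_le_mono[OF op_le_lact d] by (simp add: lact_diff)
    ultimately show "\<exists>S\<in>compacts (fib X \<one>\<^bsub>G\<^esub>). op_le (fib X \<one>\<^bsub>G\<^esub>) (lact (fib X \<one>\<^bsub>G\<^esub>) a - S) \<epsilon>"
      by blast
  qed
qed

text \<open>Finite-rank operators on X_e are left multiplications, whose bounds control the norms in
  A. Completeness of A then provides the coefficient of the limit.\<close>

lemma compacts_one_eq_lact:
  assumes T: "T \<in> compacts (fib X \<one>\<^bsub>G\<^esub>)"
  obtains a where "T = lact (fib X \<one>\<^bsub>G\<^esub>) a"
proof -
  let ?E = "fib X \<one>\<^bsub>G\<^esub>"
  interpret hilbert_bimodule ?E by (intro fib_bimod) simp
  have fin: "\<exists>a. S = lact ?E a" if "S \<in> finrank ?E" for S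
    using that
  proof (induction rule: finrank_induct)
    case zero
    show ?case using lact_zero by metis
  next
    case (add x y S)
    then obtain b c a where "x = emb X b" "y = emb X c" "S = lact ?E a" by (auto simp: emb_simps)
    then have "rank_one ?E x y + S = lact ?E (b * star c + a)" by (simp only: rank_one_emb lact_add)
    then show ?case by blast
  qed
  have "\<exists>S\<in>finrank ?E. op_le ?E (T - S) (1 / real (Suc n))" for n
    using compactsE[OF T, of "1 / real (Suc n)"] by auto
  then have "\<forall>n. \<exists>a. op_le ?E (T - lact ?E a) (1 / real (Suc n))" using fin by metis
  from choice[OF this] obtain a where a: "\<And>n. op_le ?E (T - lact ?E (a n)) (1 / real (Suc n))" by blast
  have TA: "T \<in> adjointable ?E" using T by simp
  have bd: "norm (a k - a n) \<le> 1 / real (Suc k) + 1 / real (Suc n)" for k n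
  proof (rule norm_le_if_mult_le)
    fix x
    have "op_le ?E ((T - lact ?E (a n)) - (T - lact ?E (a k))) (1 / real (Suc n) + 1 / real (Suc k))"
      using TA a lact_adjointable by (intro op_le_diff) auto
    then have "op_le ?E (lact ?E (a k - a n)) (1 / real (Suc k) + 1 / real (Suc n))"
      by (simp add: lact_diff add.commute)
    from op_leD[OF this emb_car[of x]] show "norm ((a k - a n) * x) \<le> (1 / real (Suc k) + 1 / real (Suc n)) * norm x"
      by (simp add: emb_simps(4) hnorm_emb)
  qed simp
  have "Cauchy a" by (rule Cauchy_if_dist_le) (use bd in \<open>simp add: dist_norm\<close>)
  then obtain l where l: "a \<longlonglongrightarrow> l" using Cauchy_convergent convergent_def by blast
  have "T = lact ?E l"
  proof (rule adjointable_eqI[OF TA lact_adjointable])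
    fix x assume x: "x \<in> car ?E"
    then obtain b where b: "x = emb X b" by (auto simp: emb_simps)
    obtain c where c: "T x = emb X c" using x TA adjointable_car by (force simp: emb_simps(1))
    have "norm (c - a n * b) \<le> 1 / real (Suc n) * norm b" for n
      using op_leD[OF a x, of n] c b by (simp add: emb_simps(4) hnorm_emb flip: emb_diff)
    then have "(\<lambda>n. c - a n * b) \<longlonglongrightarrow> 0"
      by (intro Lim_null_comparison[OF _ tendsto_mult_left_zero[OF LIMSEQ_Suc[OF lim_1_over_n], of "norm b"]]) auto
    moreover have "(\<lambda>n. c - a n * b) \<longlonglongrightarrow> c - l * b" by (intro tendsto_intros l)
    ultimately have "c - l * b = 0" using LIMSEQ_unique by blast
    then have "T x = emb X (l * b)" using c by simp
    then show "T x = lact ?E l x" by (simp add: b emb_simps(4))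
  qed
  then show ?thesis by (rule that)
qed

lemma coeff_of_lact: "inj (lact (fib X \<one>\<^bsub>G\<^esub>)) \<Longrightarrow> coeff_of G X (lact (fib X \<one>\<^bsub>G\<^esub>) a) = a"
  unfolding coeff_of_def by (rule the_equality) (auto dest: injD)

lemma iota_one_lact:
  "inj (lact (fib X \<one>\<^bsub>G\<^esub>)) \<Longrightarrow> r \<in> P \<Longrightarrow> iota G P X \<one>\<^bsub>G\<^esub> r (lact (fib X \<one>\<^bsub>G\<^esub>) a) = lact (fib X r) a"
  by (simp add: iota_def coeff_of_lact)

section \<open>Compatibility of the homomorphisms \<psi>^(p) with \<iota>\<close>

lemma psi_module_representation:
  assumes \<psi>: "representation G P X \<psi>" and p: "p \<in> P"
  shows "module_representation (fib X p) (\<psi> p) (\<lambda>a. \<psi> \<one>\<^bsub>G\<^esub> (emb X a))"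
proof -
  interpret hilbert_bimodule "fib X p" using p by (rule fib_bimod)
  have r: "\<psi> p x * \<psi> \<one>\<^bsub>G\<^esub> (emb X a) = \<psi> (p \<otimes>\<^bsub>G\<^esub> \<one>\<^bsub>G\<^esub>) (pmul X p \<one>\<^bsub>G\<^esub> x (emb X a))"
    if "x \<in> car (fib X p)" for x a
    using \<psi> p that by (simp add: representation_def)
  show ?thesis
    using \<psi> p r by unfold_locales (simp_all add: representation_def pmul_one_right)
qed

lemma psi_compacts_eq: "psi_compacts X \<psi> p = compacts_lift (fib X p) (\<psi> p)"
  by (simp add: psi_compacts_def compacts_lift_def)

text \<open>Covariance holds at the identity for every representation, since \<psi>_e(a) is a limit
  of products \<psi>_e(a) \<psi>_e(d).\<close>

lemma psi_compacts_one_lact: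
  assumes \<psi>: "representation G P X \<psi>"
  shows "psi_compacts X \<psi> \<one>\<^bsub>G\<^esub> (lact (fib X \<one>\<^bsub>G\<^esub>) a) = \<psi> \<one>\<^bsub>G\<^esub> (emb X a)"
proof -
  let ?\<pi> = "\<lambda>a. \<psi> \<one>\<^bsub>G\<^esub> (emb X a)"
  interpret module_representation "fib X \<one>\<^bsub>G\<^esub>" "\<psi> \<one>\<^bsub>G\<^esub>" ?\<pi>
    using \<psi> by (rule psi_module_representation) simp
  have \<pi>: "?\<pi> (b * c) = ?\<pi> b * ?\<pi> c" "?\<pi> (star c) = star (?\<pi> c)" for b c
    using pi_hom by (auto simp: star_hom_def)
  have \<pi>_diff: "?\<pi> (b - c) = ?\<pi> b - ?\<pi> c" for b c by (simp add: emb_diff psi_diff)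
  show ?thesis
    unfolding psi_compacts_eq
  proof (rule compacts_lift_eqI[OF lact_one_compacts])
    have "\<exists>d. norm (a - a * d) \<le> 1 / real (Suc n)" for n
      using emb_approx[of "1 / real (Suc n)" a] by auto
    then obtain d where d: "\<And>n. norm (a - a * d n) \<le> 1 / real (Suc n)" by metis
    show "?\<pi> a \<in> rep_compacts (fib X \<one>\<^bsub>G\<^esub>) (\<psi> \<one>\<^bsub>G\<^esub>)"
    proof (rule rep_compactsI)
      show "?\<pi> (a * d n) \<in> rep_span (fib X \<one>\<^bsub>G\<^esub>) (\<psi> \<one>\<^bsub>G\<^esub>)" for n
        using rep_span_base[of "emb X a" "emb X (star (d n))"] by (simp add: \<pi> star_star)
      have "norm (?\<pi> (a * d n) - ?\<pi> a) \<le> 1 / real (Suc n)" for n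
        using star_hom_norm_le[OF pi_hom, of "a - a * d n"] d[of n]
        by (simp add: \<pi>_diff norm_minus_commute)
      then have "(\<lambda>n. ?\<pi> (a * d n) - ?\<pi> a) \<longlonglongrightarrow> 0"
        by (intro Lim_null_comparison[OF _ LIMSEQ_Suc[OF lim_1_over_n]]) auto
      then show "(\<lambda>n. ?\<pi> (a * d n)) \<longlonglongrightarrow> ?\<pi> a" by (simp add: LIM_zero_iff)
    qed
    fix z assume "z \<in> car (fib X \<one>\<^bsub>G\<^esub>)"
    then obtain c where "z = emb X c" by (auto simp: emb_simps)
    then show "?\<pi> a * \<psi> \<one>\<^bsub>G\<^esub> z = \<psi> \<one>\<^bsub>G\<^esub> (lact (fib X \<one>\<^bsub>G\<^esub>) a z)" by (simp add: emb_simps(4) \<pi>)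
  qed
qed

lemma iota_compacts:
  assumes inj: "\<And>p. p \<in> P \<Longrightarrow> inj (lact (fib X p))"
    and \<psi>: "representation G P X \<psi>"
    and K: "\<And>p a. p \<in> P \<Longrightarrow> lact (fib X p) a \<in> compacts (fib X p)"
    and CP: "Fowler_CP_covariant G P X \<psi>"
    and p: "p \<in> P" and r: "r \<in> P" and pr: "ple G P p r" and S: "S \<in> compacts (fib X p)"
  shows "iota G P X p r S \<in> compacts (fib X r)"
    and "psi_compacts X \<psi> r (iota G P X p r S) = psi_compacts X \<psi> p S"
proof -
  let ?\<pi> = "\<lambda>a. \<psi> \<one>\<^bsub>G\<^esub> (emb X a)"
  let ?q = "inv\<^bsub>G\<^esub> p \<otimes>\<^bsub>G\<^esub> r"
  have q: "?q \<in> P" using pr by (simp add: ple_def)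
  have cov: "psi_compacts X \<psi> s (lact (fib X s) a) = ?\<pi> a" if "s \<in> P" for s a
    using CP K that by (simp add: Fowler_CP_covariant_def)
  \<comment> \<open>The cases p = e and p = r lie outside \<open>fib_tensor\<close>. In the first,
    \<open>S\<close> is \<phi>_e(a) and goes to \<phi>_r(a), with equal images by covariance; in the
    second, \<iota> leaves \<open>S\<close> unchanged.\<close>
  have "iota G P X p r S \<in> compacts (fib X r) \<and> psi_compacts X \<psi> r (iota G P X p r S) = psi_compacts X \<psi> p S"
  proof (cases "p = \<one>\<^bsub>G\<^esub>")
    case True
    then obtain a where "S = lact (fib X \<one>\<^bsub>G\<^esub>) a" using compacts_one_eq_lact S by blast
    then show ?thesis using True r inj cov K by (simp add: iota_one_lact)
  next
    case p1: False
    show ?thesis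
    proof (cases "?q = \<one>\<^bsub>G\<^esub>")
      case True
      then have rp: "r = p" using inv_mult_eq_one p r by blast
      interpret hilbert_module "fib X p" using p by (rule fib_module)
      have "iota G P X p r S = S"
      proof (rule iota_eqI[OF p p1 r pr])
        show "S \<in> adjointable (fib X r)" using S by (simp add: rp)
        fix x y assume x: "x \<in> car (fib X p)" and "y \<in> car (fib X ?q)"
        then obtain a where "y = emb X a" using True by (auto simp: emb_simps)
        then show "S (pmul X p ?q x y) = pmul X p ?q (S x) y"
          using x p S True by (simp add: pmul_one_right adjointable_linear)
      qed
      then show ?thesis using S by (simp add: rp)
    next
      case False
      interpret P: module_representation "fib X p" "\<psi> p" ?\<pi> by (rule psi_module_representation[OF \<psi> p])
      interpret Q: module_representation "fib X ?q" "\<psi> ?q" ?\<pi> by (rule psi_module_representation[OF \<psi> q])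
      interpret R: module_representation "fib X r" "\<psi> r" ?\<pi> by (rule psi_module_representation[OF \<psi> r])
      interpret T: tensor_product "fib X p" "fib X ?q" "fib X r" "pmul X p ?q"
        using fib_tensor[of p ?q] p p1 q False r by simp
      interpret tensor_representation "fib X p" "fib X ?q" "fib X r" "pmul X p ?q" "\<psi> p" "\<psi> ?q" "\<psi> r" ?\<pi>
      proof unfold_locales
        fix x y assume "x \<in> car (fib X p)" "y \<in> car (fib X ?q)"
        then have "\<psi> p x * \<psi> ?q y = \<psi> (p \<otimes>\<^bsub>G\<^esub> ?q) (pmul X p ?q x y)"
          using \<psi> p q unfolding representation_def by blast
        then show "\<psi> r (pmul X p ?q x y) = \<psi> p x * \<psi> ?q y" using p r by simp
      qed
      obtain U where U: "U \<in> compacts (fib X r)" "T.amplifies S U"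
        using T.amplifies_compacts[OF K[OF q] S] by blast
      have iota: "iota G P X p r S = U"
        using U by (intro iota_eqI p p1 r pr) (auto simp: T.amplifies_def)
      \<comment> \<open>By covariance \<psi>_e(a) is a value of \<psi>^(q), and these values lie in
        the closed span.\<close>
      have "?\<pi> a \<in> rep_compacts (fib X ?q) (\<psi> ?q)" for a
        using Q.compacts_lift_in[OF K[OF q], of a] cov[OF q, of a] by (simp add: psi_compacts_eq)
      then have "compacts_lift (fib X r) (\<psi> r) U = compacts_lift (fib X p) (\<psi> p) S"
        by (rule compacts_lift_amplifies[OF _ S U])
      then show ?thesis using U iota by (simp add: psi_compacts_eq)
    qed
  qed
  then show "iota G P X p r S \<in> compacts (fib X r)"
    "psi_compacts X \<psi> r (iota G P X p r S) = psi_compacts X \<psi> p S" by auto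
qed

section \<open>The modules $\widetilde{X}_q$\<close>

lemma ideal_I_one: "ideal_I G P X \<one>\<^bsub>G\<^esub> = UNIV"
  by (simp add: ideal_I_def)

lemma zero_in_ideal_I: "0 \<in> ideal_I G P X q"
proof -
  have "lact (fib X r) 0 = 0" if "r \<in> P" for r
    using hilbert_bimodule.lact_zero[OF fib_bimod[OF that]] .
  then show ?thesis by (auto simp: ideal_I_def simp del: zero_fun_apply)
qed

text \<open>The intersection defining I_q includes the kernel of \<phi>_q itself.\<close>

lemma ideal_I_trivial:
  assumes "q \<in> P" "q \<noteq> \<one>\<^bsub>G\<^esub>" "inj (lact (fib X q))"
  shows "ideal_I G P X q \<subseteq> {0}"
proof
  fix a assume "a \<in> ideal_I G P X q"
  then have "lact (fib X q) a = 0" using assms by (auto simp: ideal_I_def)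
  also have "0 = lact (fib X q) 0" using hilbert_bimodule.lact_zero[OF fib_bimod[OF assms(1)]] by simp
  finally show "a \<in> {0}" using assms(3) by (auto dest: injD)
qed

lemma Xtilde_car_trivial:
  assumes inj: "\<And>p. p \<in> P \<Longrightarrow> inj (lact (fib X p))"
    and x: "x \<in> car (Xtilde G P X s)" and i: "i \<in> P" "ple G P i s" "i \<noteq> s" and s: "s \<in> P"
  shows "x i = 0"
proof -
  let ?q = "inv\<^bsub>G\<^esub> i \<otimes>\<^bsub>G\<^esub> s"
  have q: "?q \<in> P" "?q \<noteq> \<one>\<^bsub>G\<^esub>" using i s inv_mult_eq_one by (auto simp: ple_def)
  have "x i \<in> car (mod_ideal (fib X i) (ideal_I G P X ?q))"
    using x i by (simp add: Xtilde_def car_direct_sum)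
  then obtain y a where "x i = ract (fib X i) y a" "y \<in> car (fib X i)" "a \<in> ideal_I G P X ?q"
    by (auto simp: car_mod_ideal)
  moreover have "a = 0" using ideal_I_trivial[OF q inj[OF q(1)]] calculation by blast
  ultimately show ?thesis using hilbert_module.ract_zero(1)[OF fib_module[OF i(1)]] by simp
qed

lemma Xtilde_lact:
  assumes "x \<in> car (Xtilde G P X s)"
  shows "lact (Xtilde G P X s) a x = (\<lambda>i. if i \<in> P \<and> ple G P i s then lact (fib X i) a (x i) else 0)"
  using assms by (auto simp: Xtilde_def lact_direct_sum fun_eq_iff car_direct_sum lact_mod_ideal)

lemma Xtilde_lact_off: "x \<notin> car (Xtilde G P X s) \<Longrightarrow> lact (Xtilde G P X s) a x = 0"
  by (simp add: Xtilde_def lact_direct_sum)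

text \<open>The top summand is X_s A, a set of products, so a multiple of \<open>y\<close> is placed
  there rather than \<open>y\<close> itself.\<close>

lemma Xtilde_single:
  assumes y: "y \<in> car (fib X s)" and s: "s \<in> P"
  shows "(\<lambda>i. if i = s then ract (fib X s) y a else 0) \<in> car (Xtilde G P X s)"
proof -
  have fin: "(\<lambda>i. inn (fib X i) (if i = s then ract (fib X s) y a else 0)
      (if i = s then ract (fib X s) y a else 0)) summable_on {p \<in> P. ple G P p s}"
  proof (rule finite_nonzero_values_imp_summable_on)
    have "inn (fib X i) 0 0 = 0" if "i \<in> P" for i
    proof -
      interpret hilbert_module "fib X i" using that by (rule fib_module)
      show ?thesis by simp
    qed
    then have "{i \<in> {p \<in> P. ple G P p s}. inn (fib X i) (if i = s then ract (fib X s) y a else 0)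
      (if i = s then ract (fib X s) y a else 0) \<noteq> 0} \<subseteq> {s}" by auto
    then show "finite {i \<in> {p \<in> P. ple G P p s}. inn (fib X i) (if i = s then ract (fib X s) y a else 0)
      (if i = s then ract (fib X s) y a else 0) \<noteq> 0}"
      by (rule finite_subset) simp
  qed
  have zero: "0 \<in> car (mod_ideal (fib X i) (ideal_I G P X q))" if "i \<in> P" for i q
  proof -
    interpret hilbert_module "fib X i" using that by (rule fib_module)
    have "0 = ract (fib X i) 0 0" by simp
    then show ?thesis using zero_in_ideal_I car_simps(1) unfolding car_mod_ideal by blast
  qed
  have top: "ract (fib X s) y a \<in> car (mod_ideal (fib X s) (ideal_I G P X (inv\<^bsub>G\<^esub> s \<otimes>\<^bsub>G\<^esub> s)))"
    using y s by (auto simp: car_mod_ideal ideal_I_one)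
  show ?thesis
    unfolding Xtilde_def car_direct_sum mem_Collect_eq inn_mod_ideal
    using fin zero top s by auto
qed

lemma iota_tilde_top:
  assumes x: "x \<in> car (Xtilde G P X s)" and s: "s \<in> P" and p: "p \<in> P" "ple G P p s"
  shows "iota_tilde G P X p s T x s = iota G P X p s T (x s)"
  using assms by (simp add: iota_tilde_def Xtilde_lact iota_def)

lemma iota_tilde_lact_cancel:
  assumes inj: "\<And>p. p \<in> P \<Longrightarrow> inj (lact (fib X p))"
    and p: "p \<in> P" "p \<noteq> \<one>\<^bsub>G\<^esub>" and s: "s \<in> P" and ps: "ple G P p s"
  shows "iota_tilde G P X p s (lact (fib X p) a) + iota_tilde G P X \<one>\<^bsub>G\<^esub> s (lact (fib X \<one>\<^bsub>G\<^esub>) (- a)) = 0"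
proof
  fix x
  show "(iota_tilde G P X p s (lact (fib X p) a) + iota_tilde G P X \<one>\<^bsub>G\<^esub> s (lact (fib X \<one>\<^bsub>G\<^esub>) (- a))) x = 0 x"
  proof (cases "x \<in> car (Xtilde G P X s)")
    case False
    then show ?thesis using p by (simp add: iota_tilde_def Xtilde_lact_off)
  next
    case True
    have "iota G P X p i (lact (fib X p) a) (x i) + lact (fib X i) (- a) (x i) = 0"
      if i: "i \<in> P" "ple G P i s" for i
    proof -
      interpret hilbert_bimodule "fib X i" using i by (intro fib_bimod)
      show ?thesis
      proof (cases "ple G P p i")
        case True
        then show ?thesis using i p by (simp add: iota_lact lact_minus)
      next
        case False
        \<comment> \<open>Here \<open>i\<close> differs from \<open>s\<close>, which lies above
          \<open>p\<close>; so \<open>i\<close> indexes one of the vanishing summands.\<close>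
        then have "x i = 0" using Xtilde_car_trivial[OF inj True i] ps s by auto
        then show ?thesis
          using False adjointable_linear(4)[OF lact_adjointable, of 0] by (simp add: iota_def)
      qed
    qed
    then show ?thesis
      using True p inj by (simp add: iota_tilde_def Xtilde_lact coeff_of_lact fun_eq_iff)
  qed
qed

lemma iota_tilde_sum_zero:
  assumes F: "finite F" "F \<subseteq> P" and s: "s \<in> P" "\<And>p. p \<in> F \<Longrightarrow> ple G P p s"
    and adj: "\<And>p. p \<in> F \<Longrightarrow> iota G P X p s (T p) \<in> adjointable (fib X s)"
    and zero: "(\<Sum>p\<in>F. iota_tilde G P X p s (T p)) = 0"
  shows "(\<Sum>p\<in>F. iota G P X p s (T p)) = 0"
proof -
  interpret hilbert_module "fib X s" using s by (intro fib_module)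
  have fun_sum: "(\<Sum>p\<in>F. f p) x = (\<Sum>p\<in>F. f p x)" for f :: "'g \<Rightarrow> 'b \<Rightarrow> 'c::comm_monoid_add" and x
    by (induction F rule: infinite_finite_induct) auto
  let ?U = "\<Sum>p\<in>F. iota G P X p s (T p)"
  have UA: "?U \<in> adjointable (fib X s)"
    using F(1) adj by (induction F rule: finite_induct) (simp_all del: plus_fun_apply zero_fun_apply)
  show ?thesis
  proof (rule adjointable_eqI[OF UA adjointable_simps(1)])
    fix y assume y: "y \<in> car (fib X s)"
    \<comment> \<open>The sum is evaluated at the vector with the single entry y a at
      \<open>s\<close>; letting \<open>a\<close> vary recovers the value at
      \<open>y\<close>.\<close>
    have "ract (fib X s) (?U y) a = 0" for a
    proof -
      let ?\<xi> = "\<lambda>i. if i = s then ract (fib X s) y a else 0"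
      have \<xi>: "?\<xi> \<in> car (Xtilde G P X s)" by (rule Xtilde_single[OF y s(1)])
      have "ract (fib X s) (?U y) a = ?U (ract (fib X s) y a)"
        using y UA by (simp only: adjointable_linear)
      also have "\<dots> = (\<Sum>p\<in>F. iota_tilde G P X p s (T p) ?\<xi> s)"
        using F s by (simp add: fun_sum iota_tilde_top[OF \<xi>] subset_iff)
      also have "\<dots> = (\<Sum>p\<in>F. iota_tilde G P X p s (T p)) ?\<xi> s"
        by (simp add: fun_sum)
      finally show ?thesis by (simp add: zero)
    qed
    then show "?U y = 0 y" using eq_zero_if_ract[of "?U y"] y UA by simp
  qed
qed

section \<open>The two implications\<close>

lemma finite_upper_bound:
  assumes sup: "\<forall>p\<in>P. \<forall>q\<in>P. \<exists>r. is_sup G P p q r"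
  shows "finite F \<Longrightarrow> F \<subseteq> P \<Longrightarrow> \<exists>u\<in>P. \<forall>p\<in>F. ple G P p u"
proof (induction F rule: finite_induct)
  case (insert q F)
  then obtain u where u: "u \<in> P" "\<forall>p\<in>F. ple G P p u" by blast
  then obtain r where r: "is_sup G P q u r" using sup insert by blast
  then have "\<forall>p\<in>insert q F. ple G P p r" "r \<in> P"
    using u insert ple_trans[of _ u r] by (auto simp: is_sup_def)
  then show ?case by blast
qed (use one_in_P in blast)

lemma CP_imp_Fowler:
  assumes sup: "\<forall>p\<in>P. \<forall>q\<in>P. \<exists>r. is_sup G P p q r"
    and inj: "\<And>p. p \<in> P \<Longrightarrow> inj (lact (fib X p))"
    and \<psi>: "representation G P X \<psi>" and CP: "satisfies_CP G P X \<psi>"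
  shows "Fowler_CP_covariant G P X \<psi>"
  unfolding Fowler_CP_covariant_def
proof (intro ballI allI impI)
  fix p a assume p: "p \<in> P" and a: "lact (fib X p) a \<in> compacts (fib X p)"
  show "psi_compacts X \<psi> p (lact (fib X p) a) = \<psi> \<one>\<^bsub>G\<^esub> (emb X a)"
  proof (cases "p = \<one>\<^bsub>G\<^esub>")
    \<comment> \<open>Kept apart because the index set {p, e} used below would collapse.\<close>
    case True
    then show ?thesis using psi_compacts_one_lact[OF \<psi>] by simp
  next
    case False
    interpret E: module_representation "fib X \<one>\<^bsub>G\<^esub>" "\<psi> \<one>\<^bsub>G\<^esub>" "\<lambda>a. \<psi> \<one>\<^bsub>G\<^esub> (emb X a)"
      using \<psi> by (rule psi_module_representation) simp
    \<comment> \<open>The relation \<phi>_p(a) - \<phi>_e(a), written as a family of compact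
      operators over {p, e}.\<close>
    define T where "T q = (if q = p then lact (fib X p) a else lact (fib X \<one>\<^bsub>G\<^esub>) (- a))" for q
    have "for_large G P (\<lambda>s. (\<Sum>q\<in>{p, \<one>\<^bsub>G\<^esub>}. iota_tilde G P X q s (T q)) = 0)"
      unfolding for_large_def
    proof
      fix q assume q: "q \<in> P"
      then obtain r where "is_sup G P p q r" using sup p by blast
      then have r: "r \<in> P" "ple G P p r" "ple G P q r" by (simp_all add: is_sup_def)
      have "(\<Sum>q\<in>{p, \<one>\<^bsub>G\<^esub>}. iota_tilde G P X q s (T q)) = 0" if "s \<in> P" "ple G P r s" for s
        using iota_tilde_lact_cancel[OF inj p False \<open>s \<in> P\<close> ple_trans[OF r(2) that(2) p r(1) that(1)], of a] False
        by (simp add: T_def del: plus_fun_apply zero_fun_apply)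
      then show "\<exists>r\<in>P. ple G P q r \<and>
          (\<forall>s\<in>P. ple G P r s \<longrightarrow> (\<Sum>q\<in>{p, \<one>\<^bsub>G\<^esub>}. iota_tilde G P X q s (T q)) = 0)"
        using r by blast
    qed
    moreover have "\<forall>q\<in>{p, \<one>\<^bsub>G\<^esub>}. T q \<in> compacts (fib X q)"
      using a False lact_one_compacts by (auto simp: T_def)
    ultimately have "(\<Sum>q\<in>{p, \<one>\<^bsub>G\<^esub>}. psi_compacts X \<psi> q (T q)) = 0"
      using CP[unfolded satisfies_CP_def, rule_format, of "{p, \<one>\<^bsub>G\<^esub>}" T] p by auto
    then have "psi_compacts X \<psi> p (lact (fib X p) a) + \<psi> \<one>\<^bsub>G\<^esub> (emb X (- a)) = 0"
      using False psi_compacts_one_lact[OF \<psi>, of "- a"] by (simp add: T_def)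
    moreover have "\<psi> \<one>\<^bsub>G\<^esub> (emb X (- a)) = - \<psi> \<one>\<^bsub>G\<^esub> (emb X a)"
      using E.psi_add[of "emb X (- a)" "emb X a"] emb_simps(2)[of "- a" a] emb_diff[of a a]
      by (simp add: eq_neg_iff_add_eq_0)
    ultimately show ?thesis by simp
  qed
qed

lemma Fowler_imp_CP:
  assumes sup: "\<forall>p\<in>P. \<forall>q\<in>P. \<exists>r. is_sup G P p q r"
    and inj: "\<And>p. p \<in> P \<Longrightarrow> inj (lact (fib X p))"
    and \<psi>: "representation G P X \<psi>"
    and K: "\<And>p a. p \<in> P \<Longrightarrow> lact (fib X p) a \<in> compacts (fib X p)"
    and Fowler: "Fowler_CP_covariant G P X \<psi>"
  shows "satisfies_CP G P X \<psi>"
  unfolding satisfies_CP_def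
proof (intro allI impI)
  fix F T
  assume F: "finite F" "F \<subseteq> P" and T: "\<forall>p\<in>F. T p \<in> compacts (fib X p)"
    and large: "for_large G P (\<lambda>s. (\<Sum>p\<in>F. iota_tilde G P X p s (T p)) = 0)"
  obtain u where u: "u \<in> P" "\<forall>p\<in>F. ple G P p u" using finite_upper_bound[OF sup F] by blast
  \<comment> \<open>Validity for large s, started at the upper bound \<open>u\<close>, is used only
    for s = r.\<close>
  then obtain r where r: "r \<in> P" "ple G P u r" "(\<Sum>p\<in>F. iota_tilde G P X p r (T p)) = 0"
    using large unfolding for_large_def by (metis ple_refl)
  have pr: "ple G P p r" if "p \<in> F" for p using ple_trans[of p u r] u r F that by blast
  note iota = iota_compacts[OF inj \<psi> K Fowler _ r(1) pr]
  interpret R: module_representation "fib X r" "\<psi> r" "\<lambda>a. \<psi> \<one>\<^bsub>G\<^esub> (emb X a)"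
    by (rule psi_module_representation[OF \<psi> r(1)])
  have comp: "iota G P X p r (T p) \<in> compacts (fib X r)" if "p \<in> F" for p
    using iota(1)[of p "T p"] that F T by blast
  have "(\<Sum>p\<in>F. psi_compacts X \<psi> p (T p)) = (\<Sum>p\<in>F. psi_compacts X \<psi> r (iota G P X p r (T p)))"
    using iota(2) F T by (intro sum.cong refl) (metis subsetD)
  also have "\<dots> = psi_compacts X \<psi> r (\<Sum>p\<in>F. iota G P X p r (T p))"
    using comp by (simp add: psi_compacts_eq R.compacts_lift_sum)
  also have "(\<Sum>p\<in>F. iota G P X p r (T p)) = 0"
    using comp r pr by (intro iota_tilde_sum_zero F) auto
  also have "psi_compacts X \<psi> r 0 = 0"
    using R.compacts_lift_sum[of "{}" "\<lambda>_. 0"] by (simp add: psi_compacts_eq)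
  finally show "(\<Sum>p\<in>F. psi_compacts X \<psi> p (T p)) = 0" .
qed

end

theorem proposition5p1:
  fixes G :: "('g, 'm) monoid_scheme"
    and P :: "'g set"
    and X :: "('g, 'a::cstar_algebra, 'x::complex_vector) prodsys"
    and \<psi> :: "'g \<Rightarrow> 'x \<Rightarrow> 'b::cstar_algebra"
  assumes "quasi_lattice_ordered_group G P"
    and "product_system G P X"
    and "compactly_aligned G P X"
    and "\<forall>p\<in>P. \<forall>q\<in>P. \<exists>r. is_sup G P p q r"
    and "\<forall>p\<in>P. inj (lact (fib X p))"
    and "representation G P X \<psi>"
  shows "(satisfies_CP G P X \<psi> \<longrightarrow> Fowler_CP_covariant G P X \<psi>) \<and>
    ((\<forall>p\<in>P. range (lact (fib X p)) \<subseteq> compacts (fib X p)) \<longrightarrow> Fowler_CP_covariant G P X \<psi> \<longrightarrow>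
      satisfies_CP G P X \<psi>)"
proof -
  interpret product_system G P X by fact
  show ?thesis
    using CP_imp_Fowler Fowler_imp_CP assms(4-6) by (metis range_subsetD)
qed

end
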